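(* Let $d\in\mathbb N$, $\boldsymbol\alpha\in(0,\infty)^d$, $\boldsymbol\beta\in\mathbb R^d$, and let $l,m$ be integers with $0\le l<m$. (i) (Regular hyperbolic cross) There is a constant $C$ depending only on $\boldsymbol\alpha,l,m,d$ such that for all sufficiently large $N$ and every $u\in\mathcal K^m_{\boldsymbol\alpha,\boldsymbol\beta}(\mathbb R^d)$, $$\inf_{U_N\in X_N}\|u-U_N\|_{\mathcal K^l_{\boldsymbol\alpha,\boldsymbol\beta}(\mathbb R^d)}\le C\,N^{\frac{l-m}{2}}\,|u|_{\mathcal K^m_{\boldsymbol\alpha,\boldsymbol\beta}(\mathbb R^d)}.$$ (ii) (Optimized hyperbolic cross) If moreover $0<\gamma\le \frac lm$, there is a constant $C$ depending only on $\boldsymbol\alpha,l,m,d,\gamma$ such that for all sufficiently large $N$ and every $u\in\mathcal K^m_{\boldsymbol\alpha,\boldsymbol\beta}(\mathbb R^d)$, $$\inf_{U_N\in X_{N,\gamma}}\|u-U_N\|_{\mathcal W^l_{\boldsymbol\alpha,\boldsymbol\beta}(\mathbb R^d)}\le C\,N^{\frac{l-m}{2}}\,|u|_{\mathcal K^m_{\boldsymbol\alpha,\boldsymbol\beta}(\mathbb R^d)}.$$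
   Context: $\|\cdot\|$ is the $L^2(\mathbb R^d)$ norm and $\mathbb N_0=\{0,1,2,\dots\}$. For $\alpha>0$, $\beta\in\mathbb R$, $n\in\mathbb N_0$, the generalized Hermite function is $\mathcal H_n^{\alpha,\beta}(x)=\left(\frac{\alpha}{2^n n!\sqrt\pi}\right)^{1/2}H_n(\alpha(x-\beta))e^{-\frac12\alpha^2(x-\beta)^2}$, where $H_n(x)=(-1)^ne^{x^2}\partial_x^ne^{-x^2}$. For $\mathbf n\in\mathbb N_0^d$, $\mathcal H_{\mathbf n}^{\boldsymbol\alpha,\boldsymbol\beta}(\mathbf x)=\prod_{j=1}^d\mathcal H_{n_j}^{\alpha_j,\beta_j}(x_j)$; these form an orthonormal basis of $L^2(\mathbb R^d)$. Let $\mathcal D_{x_j}=\partial_{x_j}+\alpha_j^2(x_j-\beta_j)$ (weak derivatives) and, for $\mathbf k\in\mathbb N_0^d$, $\mathcal D_{\mathbf x}^{\mathbf k}=\mathcal D_{x_1}^{k_1}\cdots\mathcal D_{x_d}^{k_d}$. For $\mathbf k\in\mathbb N_0^d$: $|\mathbf k|_1=\sum_jk_j$, $|\mathbf k|_\infty=\max_jk_j$, $|\mathbf k|_{\rm mix}=\prod_{j}\max\{1,k_j\}$. For $r\in\mathbb N_0$, $\mathcal W^r_{\boldsymbol\alpha,\boldsymbol\beta}(\mathbb R^d)=\{u:\mathcal D^{\mathbf k}_{\mathbf x}u\in L^2(\mathbb R^d),\ 0\le|\mathbf k|_1\le r\}$ with norm $\|u\|_{\mathcal W^r_{\boldsymbol\alpha,\boldsymbol\beta}}=\big(\sum_{0\le|\mathbf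 k|_1\le r}\|\mathcal D_{\mathbf x}^{\mathbf k}u\|^2\big)^{1/2}$. For $r\in\mathbb N_0$, $\mathcal K^r_{\boldsymbol\alpha,\boldsymbol\beta}(\mathbb R^d)=\{u:\mathcal D^{\mathbf k}_{\mathbf x}u\in L^2(\mathbb R^d),\ 0\le|\mathbf k|_\infty\le r\}$ with norm $\|u\|_{\mathcal K^r_{\boldsymbol\alpha,\boldsymbol\beta}}=\big(\sum_{0\le|\mathbf k|_\infty\le r}\|\mathcal D_{\mathbf x}^{\mathbf k}u\|^2\big)^{1/2}$ and seminorm $|u|_{\mathcal K^r_{\boldsymbol\alpha,\boldsymbol\beta}}=\big(\sum_{|\mathbf k|_\infty=r}\|\mathcal D_{\mathbf x}^{\mathbf k}u\|^2\big)^{1/2}$. Regular hyperbolic cross space: $X_N=\mathrm{span}\{\mathcal H_{\mathbf n}^{\boldsymbol\alpha,\boldsymbol\beta}:|\mathbf n|_{\rm mix}\le N\}$. Optimized hyperbolic cross space, for $\gamma<1$: $X_{N,\gamma}=\mathrm{span}\{\mathcal H_{\mathbf n}^{\boldsymbol\alpha,\boldsymbol\beta}:|\mathbf n|_{\rm mix}|\mathbf n|_\infty^{-\gamma}\le N^{1-\gamma}\}$, where the index $\mathbf n=\mathbf 0$ is always taken to belong to the index set. "Sufficiently large $N$" means $N\ge N_0$ for some $N_0$ depending only on the fixed parameters ($d,l,m,\gamma$), not on $u$. *)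

theory Defs
  imports "HOL-Analysis.Analysis"
begin

subsection \<open>Multi-indices\<close>

definition mi_sum :: "nat^'d \<Rightarrow> nat" where
  "mi_sum k = (\<Sum>j\<in>UNIV. k $ j)"

definition mi_max :: "nat^'d \<Rightarrow> nat" where
  "mi_max k = Max (range (($) k))"

definition mi_mix :: "nat^'d \<Rightarrow> nat" where
  "mi_mix k = (\<Prod>j\<in>UNIV. max 1 (k $ j))"

subsection \<open>Generalized Hermite functions\<close>

definition hermite_poly :: "nat \<Rightarrow> real \<Rightarrow> real" where
  "hermite_poly n x = (-1) ^ n * exp (x\<^sup>2) * (deriv ^^ n) (\<lambda>t. exp (- (t\<^sup>2))) x"

definition hermite_fun1 :: "real \<Rightarrow> real \<Rightarrow> nat \<Rightarrow> real \<Rightarrow> real" where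
  "hermite_fun1 a b n x =
     sqrt (a / (2 ^ n * fact n * sqrt pi)) * hermite_poly n (a * (x - b))
       * exp (- (1 / 2) * a\<^sup>2 * (x - b)\<^sup>2)"

definition hermite_fun :: "real^'d \<Rightarrow> real^'d \<Rightarrow> nat^'d \<Rightarrow> real^'d \<Rightarrow> real" where
  "hermite_fun \<alpha> \<beta> n x = (\<Prod>j\<in>UNIV. hermite_fun1 (\<alpha> $ j) (\<beta> $ j) (n $ j) (x $ j))"

subsection \<open>Square-integrable functions\<close>

text \<open>Elements of $L^2$ are represented by Borel functions, which are not identified
  when they agree almost everywhere.\<close>

definition L2 :: "(real^'d \<Rightarrow> real) set" where
  "L2 = {f. f \<in> borel_measurable lborel \<and> integrable lborel (\<lambda>x. (f x)\<^sup>2)}"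

definition L2_norm :: "(real^'d \<Rightarrow> real) \<Rightarrow> real" where
  "L2_norm f = sqrt (\<integral>x. (f x)\<^sup>2 \<partial>lborel)"

subsection \<open>Test functions and the weak operators \<open>D\<close>\<close>

definition partial :: "'d \<Rightarrow> (real^'d \<Rightarrow> real) \<Rightarrow> real^'d \<Rightarrow> real" where
  "partial j f x = frechet_derivative f (at x) (axis j 1)"

text \<open>Compactly supported functions of class $C^\infty$: differentiability of every iterated
  partial derivative also makes every one of them continuous.\<close>

definition test_funs :: "(real^'d \<Rightarrow> real) set" where
  "test_funs = {\<phi>. (\<forall>js x. fold partial js \<phi> differentiable (at x))
                 \<and> compact (closure {x. \<phi> x \<noteq> 0})}"

text \<open>Formal adjoint of $\mathcal D_{x_j} = \partial_{x_j} + \alpha_j^2 (x_j - \beta_j)$.\<close>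

definition D_adj :: "real^'d \<Rightarrow> real^'d \<Rightarrow> 'd \<Rightarrow> (real^'d \<Rightarrow> real) \<Rightarrow> real^'d \<Rightarrow> real" where
  "D_adj \<alpha> \<beta> j \<phi> x = - partial j \<phi> x + (\<alpha> $ j)\<^sup>2 * (x $ j - \<beta> $ j) * \<phi> x"

text \<open>\<open>v\<close> represents the distribution $\mathcal D_{\mathbf x}^{\mathbf k} u$.
  A list \<open>js\<close> of directions containing each \<open>j\<close> exactly \<open>k $ j\<close> times spells
  $\mathcal D_{\mathbf x}^{\mathbf k}$ as the composition of the $\mathcal D_{x_j}$ with
  \<open>j\<close> running through \<open>js\<close>; the head of \<open>js\<close> is the outermost operator, so its adjoint
  is the first to act on the test function. As the index type carries no order, all spellings
  are admitted; the operators commute, so every spelling gives the same distribution.\<close>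

definition has_weak_D ::
  "real^'d \<Rightarrow> real^'d \<Rightarrow> nat^'d \<Rightarrow> (real^'d \<Rightarrow> real) \<Rightarrow> (real^'d \<Rightarrow> real) \<Rightarrow> bool" where
  "has_weak_D \<alpha> \<beta> k u v \<longleftrightarrow>
     (\<forall>js. (\<forall>j. count_list js j = k $ j) \<longrightarrow>
       (\<forall>\<phi>\<in>test_funs.
          (\<integral>x. v x * \<phi> x \<partial>lborel) = (\<integral>x. u x * fold (D_adj \<alpha> \<beta>) js \<phi> x \<partial>lborel)))"

text \<open>A representative of $\mathcal D_{\mathbf x}^{\mathbf k} u$, meaningful when this
  distribution is in $L^2$; it is then unique up to null sets.\<close>

definition weak_D ::
  "real^'d \<Rightarrow> real^'d \<Rightarrow> nat^'d \<Rightarrow> (real^'d \<Rightarrow> real) \<Rightarrow> real^'d \<Rightarrow> real" where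
  "weak_D \<alpha> \<beta> k u = (SOME v. v \<in> L2 \<and> has_weak_D \<alpha> \<beta> k u v)"

subsection \<open>The spaces \<open>W\<close> and \<open>K\<close>\<close>

text \<open>The norms and the seminorm below are meaningful on the respective spaces only.
  The condition \<open>u \<in> L2\<close> is the case $\mathbf k = \mathbf 0$ of the defining condition.
  Membership in \<open>W\<close> is never assumed of \<open>u\<close> in the estimates, since \<open>K_space \<alpha> \<beta> r\<close> is
  contained in \<open>W_space \<alpha> \<beta> r\<close>.\<close>

definition W_space :: "real^'d \<Rightarrow> real^'d \<Rightarrow> nat \<Rightarrow> (real^'d \<Rightarrow> real) set" where
  "W_space \<alpha> \<beta> r = {u\<in>L2. \<forall>k. mi_sum k \<le> r \<longrightarrow> (\<exists>v\<in>L2. has_weak_D \<alpha> \<beta> k u v)}"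

definition W_norm :: "real^'d \<Rightarrow> real^'d \<Rightarrow> nat \<Rightarrow> (real^'d \<Rightarrow> real) \<Rightarrow> real" where
  "W_norm \<alpha> \<beta> r u = sqrt (\<Sum>k | mi_sum k \<le> r. (L2_norm (weak_D \<alpha> \<beta> k u))\<^sup>2)"

definition K_space :: "real^'d \<Rightarrow> real^'d \<Rightarrow> nat \<Rightarrow> (real^'d \<Rightarrow> real) set" where
  "K_space \<alpha> \<beta> r = {u\<in>L2. \<forall>k. mi_max k \<le> r \<longrightarrow> (\<exists>v\<in>L2. has_weak_D \<alpha> \<beta> k u v)}"

definition K_norm :: "real^'d \<Rightarrow> real^'d \<Rightarrow> nat \<Rightarrow> (real^'d \<Rightarrow> real) \<Rightarrow> real" where
  "K_norm \<alpha> \<beta> r u = sqrt (\<Sum>k | mi_max k \<le> r. (L2_norm (weak_D \<alpha> \<beta> k u))\<^sup>2)"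

definition K_seminorm :: "real^'d \<Rightarrow> real^'d \<Rightarrow> nat \<Rightarrow> (real^'d \<Rightarrow> real) \<Rightarrow> real" where
  "K_seminorm \<alpha> \<beta> r u = sqrt (\<Sum>k | mi_max k = r. (L2_norm (weak_D \<alpha> \<beta> k u))\<^sup>2)"

subsection \<open>Hyperbolic cross spaces\<close>

text \<open>The linear span of the Hermite functions with index in \<open>I\<close>, written out as the set of
  finite linear combinations because the function space is no instance of the class
  \<open>real_vector\<close>.\<close>

definition hermite_span ::
  "real^'d \<Rightarrow> real^'d \<Rightarrow> (nat^'d) set \<Rightarrow> (real^'d \<Rightarrow> real) set" where
  "hermite_span \<alpha> \<beta> I =
     {U. \<exists>F c. finite F \<and> F \<subseteq> I \<and> U = (\<lambda>x. \<Sum>n\<in>F. c n * hermite_fun \<alpha> \<beta> n x)}"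

definition X_reg :: "real^'d \<Rightarrow> real^'d \<Rightarrow> nat \<Rightarrow> (real^'d \<Rightarrow> real) set" where
  "X_reg \<alpha> \<beta> N = hermite_span \<alpha> \<beta> {n. mi_mix n \<le> N}"

definition X_opt :: "real^'d \<Rightarrow> real^'d \<Rightarrow> nat \<Rightarrow> real \<Rightarrow> (real^'d \<Rightarrow> real) set" where
  "X_opt \<alpha> \<beta> N \<gamma> = hermite_span \<alpha> \<beta>
     {n. n = 0 \<or> real (mi_mix n) * real (mi_max n) powr (- \<gamma>) \<le> real N powr (1 - \<gamma>)}"

end

(* Under D^k the coefficient of u at the Hermite function with index n is multiplied by a number whose
   square is comparable to the product of the n_j^k_j (as long as n_j >= k_j), and its index drops to
   n - k. By Parseval's identity, applied to the weak derivatives of u minus the truncation of its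
   Hermite series to the hyperbolic cross, both estimates reduce to comparing such products for each
   index n outside the cross. The seminorm controls mix(n)^m there: given n, differentiate m times in
   exactly the directions with n_j >= m, at least one of which exists for large N. The other side is
   at most mix(n)^l in the first case and max(n)^l in the second.

   Completeness in one dimension: dominated Taylor expansion of exp(-z^2/4) and the Weierstrass theorem
   in the variable exp(-z^2/4) show that the closed span of the functions z^k exp(-z^2/2) contains the
   indicators of intervals. Products of those generate everything in several dimensions. *)

theory Submission
  imports Defs "HOL-Probability.Distributions" "HOL-Real_Asymp.Real_Asymp"
begin

section \<open>One-dimensional Hermite functions\<close>

text \<open>Completeness is needed for one half only. The seminorm bounds coefficients by Bessel's
  inequality alone; the norm of the error is bounded by its coefficients only because the Hermite
  functions are dense. Weak derivatives are tested against compactly supported functions, and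
  Hermite functions are not among them. Hence the cut-offs, with control of all their derivatives,
  and a dominated limit that removes them. \<open>weak_D\<close> is a choice, so its value on the
  error means something only once some square integrable weak derivative of the truncated series is
  known. For this, Hermite functions are differentiated weakly by an integration by parts. Functions
  of exp (- z^2 / 4) alone are even in z; in the density argument the powers of z supply the odd
  ones. The condition gamma <= l / m makes the exponent l - gamma m nonnegative, which is used for
  indices with max(n) < N; with l < m it also gives gamma < 1 and so a finite cross.\<close>

primrec hermite_p :: "nat \<Rightarrow> real poly" where
  "hermite_p 0 = 1"
| "hermite_p (Suc n) = [:0, 2:] * hermite_p n - pderiv (hermite_p n)"

text \<open>Differentiation turns p exp (- x^2) into (p' - 2 x p) exp (- x^2). The recursion of
  \<open>hermite_p\<close> is the negative of this operator, hence the sign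
  \<open>(-1) ^ n\<close>.\<close>

lemma higher_deriv_gauss:
  "(deriv ^^ n) (\<lambda>t::real. exp (- t\<^sup>2)) = (\<lambda>x. (-1) ^ n * poly (hermite_p n) x * exp (- x\<^sup>2))"
proof (induction n)
  case (Suc n)
  have "((\<lambda>x. (-1) ^ n * poly (hermite_p n) x * exp (- x\<^sup>2)) has_real_derivative
      (-1) ^ Suc n * poly (hermite_p (Suc n)) x * exp (- x\<^sup>2)) (at x)" for x
    by (rule derivative_eq_intros poly_DERIV refl | simp add: algebra_simps)+
  then have "deriv (\<lambda>x. (-1) ^ n * poly (hermite_p n) x * exp (- x\<^sup>2)) x =
      (-1) ^ Suc n * poly (hermite_p (Suc n)) x * exp (- x\<^sup>2)" for x
    by (rule DERIV_imp_deriv)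
  then show ?case
    unfolding funpow.simps comp_def Suc by (rule ext)
qed auto

lemma hermite_poly_eq: "hermite_poly n x = poly (hermite_p n) x"
proof -
  have "hermite_poly n x = ((-1) ^ n * (-1) ^ n) * (exp (x\<^sup>2) * exp (- x\<^sup>2)) * poly (hermite_p n) x"
    by (simp only: hermite_poly_def higher_deriv_gauss mult_ac)
  then show ?thesis
    by (simp flip: exp_add power_mult_distrib)
qed

text \<open>Differentiating the recursion for H_(k+1) gives 2 H_k + 2 x H_k' - H_k''. After
  inserting H_k' = 2 k H_(k-1), the last two terms are 2 k times the recursion for H_k. At n = 0 the
  factor 0 absorbs the truncated index \<open>n - 1\<close>.\<close>

lemma pderiv_hermite_p: "pderiv (hermite_p n) = smult (2 * real n) (hermite_p (n - 1))"
proof (induction n rule: less_induct)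
  case (less n)
  show ?case
  proof (cases n)
    case (Suc k)
    show ?thesis
    proof (cases k)
      case (Suc i)
      have "pderiv (hermite_p (Suc k)) =
          smult 2 (hermite_p k) + [:0, 2:] * pderiv (hermite_p k) - pderiv (pderiv (hermite_p k))"
        by (simp add: pderiv_diff pderiv_mult pderiv_pCons pderiv_smult algebra_simps)
      also have "pderiv (hermite_p k) = smult (2 * real k) (hermite_p i)"
        using less[of k] \<open>n = Suc k\<close> Suc by simp
      also have "smult 2 (hermite_p k) + [:0, 2:] * smult (2 * real k) (hermite_p i)
          - pderiv (smult (2 * real k) (hermite_p i))
          = smult 2 (hermite_p k) + smult (2 * real k) (hermite_p (Suc i))"
        by (simp add: pderiv_smult smult_diff_right)
      also have "\<dots> = smult (2 * real (Suc k)) (hermite_p k)"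
        by (simp add: Suc algebra_simps flip: smult_add_left)
      finally show ?thesis
        using \<open>n = Suc k\<close> by simp
    qed (use Suc in \<open>simp add: pderiv_pCons\<close>)
  qed simp
qed

text \<open>Put w(x) = a^2 (x - b). The Gaussian factor contributes - w h_n to the derivative. The
  polynomial factor contributes H_n', which is a multiple of H_(n-1) and, by the recursion, also
  equals 2 z H_n - H_(n+1) with z = a (x - b). So - d/dx + w raises the index and d/dx + w lowers
  it.\<close>

lemma
  assumes "0 < a"
  shows hermite_fun1_raise: "(hermite_fun1 a b n has_real_derivative
      (a\<^sup>2 * (x - b) * hermite_fun1 a b n x - a * sqrt (2 * real (Suc n)) * hermite_fun1 a b (Suc n) x)) (at x)"
      (is ?raise)
    and hermite_fun1_lower: "(hermite_fun1 a b n has_real_derivative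
      (a * sqrt (2 * real n) * hermite_fun1 a b (n - 1) x - a\<^sup>2 * (x - b) * hermite_fun1 a b n x)) (at x)"
      (is ?lower)
proof -
  define s where "s n = sqrt (a / (2 ^ n * fact n * sqrt pi))" for n
  \<comment> \<open>The normalizing constants of neighbouring indices differ by the factor sqrt (2
    (n + 1)); the square roots in both formulas come from here.\<close>
  have s: "sqrt (2 * real (Suc n)) * s (Suc n) = s n" for n
  proof -
    have "sqrt (2 * real (Suc n)) * s (Suc n) = sqrt (2 * real (Suc n) * (a / (2 ^ Suc n * fact (Suc n) * sqrt pi)))"
      unfolding s_def by (simp only: real_sqrt_mult)
    also have "2 * real (Suc n) * (a / (2 ^ Suc n * fact (Suc n) * sqrt pi)) = a / (2 ^ n * fact n * sqrt pi)"
      by (simp add: divide_simps)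
    finally show ?thesis by (simp add: s_def)
  qed
  have h: "hermite_fun1 a b n = (\<lambda>x. s n * poly (hermite_p n) (a * (x - b)) * exp (- (1 / 2) * a\<^sup>2 * (x - b)\<^sup>2))" for n
    by (simp add: fun_eq_iff hermite_fun1_def hermite_poly_eq s_def)
  have P: "((\<lambda>x. poly (hermite_p n) (a * (x - b))) has_real_derivative
      poly (pderiv (hermite_p n)) (a * (x - b)) * a) (at x)"
    by (rule DERIV_chain2[OF poly_DERIV]) (auto intro!: derivative_eq_intros)
  have D: "(hermite_fun1 a b n has_real_derivative
      s n * poly (pderiv (hermite_p n)) (a * (x - b)) * a * exp (- (1 / 2) * a\<^sup>2 * (x - b)\<^sup>2)
      - a\<^sup>2 * (x - b) * hermite_fun1 a b n x) (at x)"
    unfolding h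
    by (rule derivative_eq_intros P refl | simp add: algebra_simps power2_eq_square)+
  have eq: "s n * poly (pderiv (hermite_p n)) (a * (x - b)) * a * exp (- (1 / 2) * a\<^sup>2 * (x - b)\<^sup>2)
      = a * sqrt (2 * real n) * hermite_fun1 a b (n - 1) x"
  proof (cases n)
    case (Suc k)
    have "sqrt (2 * real n) * (sqrt (2 * real n) * s n) = sqrt (2 * real n) * s k"
      using s[of k] by (simp only: Suc)
    then have "2 * real n * s n = sqrt (2 * real n) * s k"
      by (simp flip: mult.assoc)
    then show ?thesis
      unfolding pderiv_hermite_p by (simp add: h Suc mult_ac)
  qed (simp add: pderiv_hermite_p)
  show ?lower using D unfolding eq .
  have "poly (hermite_p (Suc n)) z = 2 * z * poly (hermite_p n) z - poly (pderiv (hermite_p n)) z" for z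
    by simp
  then have "a * sqrt (2 * real (Suc n)) * hermite_fun1 a b (Suc n) x =
    a * s n * (2 * (a * (x - b)) * poly (hermite_p n) (a * (x - b)) - poly (pderiv (hermite_p n)) (a * (x - b)))
     * exp (- (1 / 2) * a\<^sup>2 * (x - b)\<^sup>2)"
    unfolding h by (simp add: mult_ac flip: s[of n])
  also have "a\<^sup>2 * (x - b) * hermite_fun1 a b n x - \<dots>
     = s n * poly (pderiv (hermite_p n)) (a * (x - b)) * a * exp (- (1 / 2) * a\<^sup>2 * (x - b)\<^sup>2)
      - a\<^sup>2 * (x - b) * hermite_fun1 a b n x"
    by (simp add: h algebra_simps power2_eq_square)
  finally show ?raise using D by (simp only:)
qed

text \<open>Comparing the two formulas for the same derivative eliminates it. The result keeps the
  span of the Hermite functions stable under multiplication by x.\<close>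

lemma hermite_fun1_recurrence:
  assumes "0 < a"
  shows "2 * a\<^sup>2 * (x - b) * hermite_fun1 a b n x =
     a * sqrt (2 * real n) * hermite_fun1 a b (n - 1) x + a * sqrt (2 * real (Suc n)) * hermite_fun1 a b (Suc n) x"
  using DERIV_unique[OF hermite_fun1_raise[OF assms, of b n x] hermite_fun1_lower[OF assms, of b n x]]
  by (simp add: mult_ac)

section \<open>Polynomials times Gaussians, and orthonormality\<close>

lemma hermite_fun1_poly_gauss:
  obtains q where "hermite_fun1 a b n = (\<lambda>x. poly q x * exp (- (1 / 2) * a\<^sup>2 * (x - b)\<^sup>2))"
  by (rule that[of "smult (sqrt (a / (2 ^ n * fact n * sqrt pi))) (pcompose (hermite_p n) [:- a * b, a:])"])
     (simp add: fun_eq_iff hermite_fun1_def hermite_poly_eq poly_pcompose algebra_simps)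

lemma integrable_poly_gauss:
  fixes b c :: real
  assumes "0 < c"
  shows "integrable lborel (\<lambda>x. poly p x * exp (- (c * (x - b)\<^sup>2)))"
proof -
  \<comment> \<open>Makes the normal density with mean b a constant multiple of exp (- c (x - b)^2),
    so that integrability follows from the normal moments.\<close>
  define \<sigma> where "\<sigma> = sqrt (1 / (2 * c))"
  have \<sigma>: "0 < \<sigma>" "2 * \<sigma>\<^sup>2 = 1 / c" using assms by (auto simp: \<sigma>_def)
  define q where "q = pcompose p [:b, 1:]"
  have "integrable lborel (\<lambda>x. sqrt (2 * pi * \<sigma>\<^sup>2) * (normal_density b \<sigma> x * (x - b) ^ k))" for k
    by (intro integrable_mult_right integrable_normal_moment \<sigma>)
  also have "(\<lambda>x. sqrt (2 * pi * \<sigma>\<^sup>2) * (normal_density b \<sigma> x * (x - b) ^ k))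
      = (\<lambda>x. (x - b) ^ k * exp (- (c * (x - b)\<^sup>2)))" for k
    using \<sigma> by (simp add: fun_eq_iff normal_density_def)
  finally have int: "integrable lborel (\<lambda>x. (x - b) ^ k * exp (- (c * (x - b)\<^sup>2)))" for k .
  have "integrable lborel (\<lambda>x. \<Sum>k\<le>degree q. coeff q k * ((x - b) ^ k * exp (- (c * (x - b)\<^sup>2))))"
    by (intro Bochner_Integration.integrable_sum integrable_mult_right int)
  also have "(\<lambda>x. \<Sum>k\<le>degree q. coeff q k * ((x - b) ^ k * exp (- (c * (x - b)\<^sup>2))))
      = (\<lambda>x. poly q (x - b) * exp (- (c * (x - b)\<^sup>2)))"
    by (simp add: poly_altdef sum_distrib_right mult.assoc)
  also have "\<dots> = (\<lambda>x. poly p x * exp (- (c * (x - b)\<^sup>2)))"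
    by (simp add: q_def poly_pcompose)
  finally show ?thesis .
qed

lemma poly_gauss_tendsto_0:
  fixes b c :: real
  assumes "0 < c"
  shows "((\<lambda>x. poly p x * exp (- (c * (x - b)\<^sup>2))) \<longlongrightarrow> 0) at_top"
    and "((\<lambda>x. poly p x * exp (- (c * (x - b)\<^sup>2))) \<longlongrightarrow> 0) at_bot"
proof -
  have gen: "((\<lambda>x. poly p x * exp (- (c * (x - b)\<^sup>2))) \<longlongrightarrow> 0) at_top" for p b
  proof -
    have lim: "((\<lambda>x::real. x ^ k * exp (- (c * (x - b)\<^sup>2))) \<longlongrightarrow> 0) at_top" for k
      using assms by real_asymp
    have "((\<lambda>x. \<Sum>k\<le>degree p. coeff p k * (x ^ k * exp (- (c * (x - b)\<^sup>2)))) \<longlongrightarrow> (\<Sum>k\<le>degree p. coeff p k * 0)) at_top"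
      by (intro tendsto_intros lim)
    then show ?thesis
      by (simp add: poly_altdef sum_distrib_right mult.assoc)
  qed
  show "((\<lambda>x. poly p x * exp (- (c * (x - b)\<^sup>2))) \<longlongrightarrow> 0) at_top" by (rule gen)
  have "((\<lambda>x. poly (pcompose p [:0, -1:]) x * exp (- (c * (x + b)\<^sup>2))) \<longlongrightarrow> 0) at_top"
    using gen[of _ "-b"] by simp
  then show "((\<lambda>x. poly p x * exp (- (c * (x - b)\<^sup>2))) \<longlongrightarrow> 0) at_bot"
    by (simp add: filterlim_at_bot_mirror poly_pcompose power2_commute[of "- _" b] add.commute)
qed

text \<open>The derivative is again a polynomial times the same Gaussian, hence integrable, and
  \<open>F\<close> vanishes at both infinities. This is the integration by parts behind
  orthogonality.\<close>

lemma integral_deriv_poly_gauss: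
  fixes b c :: real
  assumes "0 < c" and F: "F = (\<lambda>x. poly p x * exp (- (c * (x - b)\<^sup>2)))"
    and F': "\<And>x. (F has_real_derivative F' x) (at x)"
  shows "(\<integral>x. F' x \<partial>lborel) = 0"
proof -
  define q where "q = pderiv p - [:- 2 * c * b, 2 * c:] * p"
  have "(F has_real_derivative poly q x * exp (- (c * (x - b)\<^sup>2))) (at x)" for x
    unfolding F q_def
    by (rule derivative_eq_intros poly_DERIV refl | simp add: algebra_simps)+
  then have eq: "F' = (\<lambda>x. poly q x * exp (- (c * (x - b)\<^sup>2)))"
    using F' DERIV_unique by blast
  have "interval_lebesgue_integral lborel (-\<infinity>) \<infinity> F' = 0 - 0"
  proof (rule interval_integral_FTC_integrable)
    show "(F has_vector_derivative F' x) (at x)" for x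
      using F' by (simp add: has_real_derivative_iff_has_vector_derivative)
    show "isCont F' x" for x unfolding eq by (intro continuous_intros)
    show "set_integrable lborel (einterval (- \<infinity>) \<infinity>) F'"
      using integrable_poly_gauss[OF assms(1), of q b] by (simp add: eq set_integrable_def)
    show "((F \<circ> real_of_ereal) \<longlongrightarrow> 0) (at_right (- \<infinity>))" "((F \<circ> real_of_ereal) \<longlongrightarrow> 0) (at_left \<infinity>)"
      using poly_gauss_tendsto_0[OF assms(1), of p b]
      unfolding F ereal_tendsto_simps by simp_all
  qed auto
  then show ?thesis
    by (simp add: interval_lebesgue_integral_def set_lebesgue_integral_def)
qed

lemma hermite_fun1_mult_form:
  obtains q where "(\<lambda>x. hermite_fun1 a b n x * hermite_fun1 a b m x) = (\<lambda>x. poly q x * exp (- (a\<^sup>2 * (x - b)\<^sup>2)))"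
proof -
  obtain p q where pq: "hermite_fun1 a b n = (\<lambda>x. poly p x * exp (- (1 / 2) * a\<^sup>2 * (x - b)\<^sup>2))"
    "hermite_fun1 a b m = (\<lambda>x. poly q x * exp (- (1 / 2) * a\<^sup>2 * (x - b)\<^sup>2))"
    by (meson hermite_fun1_poly_gauss)
  have "exp (- (1 / 2) * a\<^sup>2 * (x - b)\<^sup>2) * exp (- (1 / 2) * a\<^sup>2 * (x - b)\<^sup>2) = exp (- (a\<^sup>2 * (x - b)\<^sup>2))" for x
    by (simp flip: exp_add)
  then have "hermite_fun1 a b n x * hermite_fun1 a b m x = poly (p * q) x * exp (- (a\<^sup>2 * (x - b)\<^sup>2))" for x
    unfolding pq poly_mult by (metis (no_types, lifting) mult.assoc mult.left_commute)
  then show ?thesis using that by blast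
qed

lemma integrable_hermite_fun1_mult:
  assumes "0 < a"
  shows "integrable lborel (\<lambda>x. hermite_fun1 a b n x * hermite_fun1 a b m x)"
proof -
  obtain q where "(\<lambda>x. hermite_fun1 a b n x * hermite_fun1 a b m x) = (\<lambda>x. poly q x * exp (- (a\<^sup>2 * (x - b)\<^sup>2)))"
    by (rule hermite_fun1_mult_form)
  then show ?thesis using integrable_poly_gauss[of "a\<^sup>2" q b] assms by simp
qed

lemma continuous_on_hermite_fun1: "continuous_on S (hermite_fun1 a b n)"
proof -
  obtain p where "hermite_fun1 a b n = (\<lambda>x. poly p x * exp (- (1 / 2) * a\<^sup>2 * (x - b)\<^sup>2))"
    by (rule hermite_fun1_poly_gauss)
  then show ?thesis by (auto intro!: continuous_intros)
qed

lemma measurable_hermite_fun1 [measurable]: "hermite_fun1 a b n \<in> borel_measurable borel"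
  by (intro borel_measurable_continuous_onI continuous_on_hermite_fun1)

text \<open>Integrate the derivative of h_n h_m, with h_n' from the raising formula and h_m' from
  the lowering formula: the terms with x - b cancel, and the integral of the derivative is
  0.\<close>

lemma hermite_fun1_adjoint:
  assumes "0 < a"
  shows "sqrt (2 * real (Suc n)) * (\<integral>x. hermite_fun1 a b (Suc n) x * hermite_fun1 a b m x \<partial>lborel)
     = sqrt (2 * real m) * (\<integral>x. hermite_fun1 a b n x * hermite_fun1 a b (m - 1) x \<partial>lborel)"
proof -
  let ?h = "hermite_fun1 a b"
  obtain q where q: "(\<lambda>x. ?h n x * ?h m x) = (\<lambda>x. poly q x * exp (- (a\<^sup>2 * (x - b)\<^sup>2)))"
    by (rule hermite_fun1_mult_form)
  have "(\<integral>x. a * sqrt (2 * real m) * (?h n x * ?h (m - 1) x) - a * sqrt (2 * real (Suc n)) * (?h (Suc n) x * ?h m x) \<partial>lborel) = 0"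
  proof (rule integral_deriv_poly_gauss[OF _ q])
    show "((\<lambda>x. ?h n x * ?h m x) has_real_derivative
        a * sqrt (2 * real m) * (?h n x * ?h (m - 1) x) - a * sqrt (2 * real (Suc n)) * (?h (Suc n) x * ?h m x)) (at x)" for x
      using DERIV_mult[OF hermite_fun1_raise[OF assms, of b n x] hermite_fun1_lower[OF assms, of b m x]]
      by (simp add: algebra_simps)
  qed (use assms in simp)
  then show ?thesis
    using assms by (subst (asm) Bochner_Integration.integral_diff)
      (auto intro!: integrable_mult_right integrable_hermite_fun1_mult)
qed

text \<open>The adjoint relation lowers both indices by one, so induction on n ends at n = 0. There
  h_0^2 is the normal density with standard deviation 1 / (sqrt 2 * a), and for m > 0 the same
  relation, read with the two functions exchanged, has the factor sqrt 0 on one side.\<close>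

lemma hermite_fun1_orthonormal:
  assumes "0 < a"
  shows "(\<integral>x. hermite_fun1 a b n x * hermite_fun1 a b m x \<partial>lborel) = (if n = m then 1 else 0)"
proof (induction n arbitrary: m)
  case 0
  show ?case
  proof (cases m)
    case 0
    have "hermite_fun1 a b 0 x * hermite_fun1 a b 0 x = normal_density b (1 / (sqrt 2 * a)) x" for x
    proof -
      have "hermite_fun1 a b 0 x * hermite_fun1 a b 0 x = (sqrt (a / sqrt pi))\<^sup>2 * (exp (- (1 / 2) * a\<^sup>2 * (x - b)\<^sup>2))\<^sup>2"
        by (simp add: hermite_fun1_def hermite_poly_eq power2_eq_square[of "_ * _"] flip: power_mult_distrib)
      also have "(exp (- (1 / 2) * a\<^sup>2 * (x - b)\<^sup>2))\<^sup>2 = exp (- (a\<^sup>2 * (x - b)\<^sup>2))"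
        by (simp flip: exp_double)
      also have "(sqrt (a / sqrt pi))\<^sup>2 = a / sqrt pi" using assms by simp
      also have "a / sqrt pi * exp (- (a\<^sup>2 * (x - b)\<^sup>2)) = normal_density b (1 / (sqrt 2 * a)) x"
        using assms by (simp add: normal_density_def real_sqrt_divide power_divide power_mult_distrib field_simps)
      finally show ?thesis .
    qed
    then show ?thesis using 0 assms by (simp add: integral_normal_density)
  next
    case (Suc k)
    then show ?thesis
      using hermite_fun1_adjoint[OF assms, of k b 0] by (simp add: mult.commute)
  qed
next
  case (Suc n)
  have *: "sqrt (2 * real (Suc n)) * (\<integral>x. hermite_fun1 a b (Suc n) x * hermite_fun1 a b m x \<partial>lborel)
     = sqrt (2 * real m) * (if n = m - 1 then 1 else 0)"
    using hermite_fun1_adjoint[OF assms, of n b m] Suc by simp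
  show ?case
  proof (cases m)
    case 0
    then show ?thesis using * by simp
  next
    case (Suc k)
    have "sqrt (2 * real (Suc n)) \<noteq> 0" by simp
    then show ?thesis using * Suc by (cases "n = k") (auto simp del: of_nat_Suc)
  qed
qed

section \<open>Completeness in one dimension\<close>

definition sq_int :: "'a measure \<Rightarrow> ('a \<Rightarrow> real) set" where
  "sq_int M = {f. f \<in> borel_measurable M \<and> integrable M (\<lambda>x. (f x)\<^sup>2)}"

text \<open>The measure is a parameter because closures are taken both on the line and on R^d.
  Distances stay squared, so that no norm and no quotient by null sets has to be set up.\<close>

definition sq_closure :: "'a measure \<Rightarrow> ('a \<Rightarrow> real) set \<Rightarrow> ('a \<Rightarrow> real) set" where
  "sq_closure M S = {f \<in> sq_int M. \<forall>e>0. \<exists>s\<in>S. (\<integral>x. (f x - s x)\<^sup>2 \<partial>M) < e}"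

definition lin_span :: "('i \<Rightarrow> 'a \<Rightarrow> real) \<Rightarrow> ('a \<Rightarrow> real) set" where
  "lin_span h = {U. \<exists>F c. finite F \<and> U = (\<lambda>x. \<Sum>n\<in>F. c n * h n x)}"

lemma L2_eq_sq_int: "L2 = sq_int lborel"
  by (simp add: L2_def sq_int_def)

lemma sq_int_measurable: "f \<in> sq_int M \<Longrightarrow> f \<in> borel_measurable M"
  by (simp add: sq_int_def)

lemma sq_int_integrable: "f \<in> sq_int M \<Longrightarrow> integrable M (\<lambda>x. (f x)\<^sup>2)"
  by (simp add: sq_int_def)

lemma sq_int_bound:
  assumes "g \<in> sq_int M" "f \<in> borel_measurable M" "\<And>x. x \<in> space M \<Longrightarrow> \<bar>f x\<bar> \<le> \<bar>g x\<bar>"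
  shows "f \<in> sq_int M"
proof -
  note [measurable] = assms(2)
  have "integrable M (\<lambda>x. (f x)\<^sup>2)"
    by (rule Bochner_Integration.integrable_bound[OF sq_int_integrable[OF assms(1)]])
       (use assms(3) in \<open>auto simp flip: abs_le_square_iff\<close>)
  then show ?thesis using assms(2) by (simp add: sq_int_def)
qed

lemma sum_power2_le: "((a::real) + b)\<^sup>2 \<le> 2 * a\<^sup>2 + 2 * b\<^sup>2"
  using sum_squares_bound[of a b] by (simp add: power2_sum)

lemma sq_int_cmult: "f \<in> sq_int M \<Longrightarrow> (\<lambda>x. c * f x) \<in> sq_int M"
  by (auto simp: sq_int_def power_mult_distrib)

lemma sq_int_add:
  assumes f: "f \<in> sq_int M" and g: "g \<in> sq_int M"
  shows "(\<lambda>x. f x + g x) \<in> sq_int M"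
proof -
  note [measurable] = sq_int_measurable[OF f] sq_int_measurable[OF g]
  have "integrable M (\<lambda>x. (f x + g x)\<^sup>2)"
  proof (rule Bochner_Integration.integrable_bound)
    show "integrable M (\<lambda>x. 2 * (f x)\<^sup>2 + 2 * (g x)\<^sup>2)"
      using f g by (auto intro!: sq_int_integrable)
    show "AE x in M. norm ((f x + g x)\<^sup>2) \<le> norm (2 * (f x)\<^sup>2 + 2 * (g x)\<^sup>2)"
      by (simp add: sum_power2_le)
  qed measurable
  then show ?thesis by (simp add: sq_int_def)
qed

lemma sq_int_diff: "f \<in> sq_int M \<Longrightarrow> g \<in> sq_int M \<Longrightarrow> (\<lambda>x. f x - g x) \<in> sq_int M"
  using sq_int_add[of f M "\<lambda>x. -1 * g x"] sq_int_cmult[of g M "-1"] by simp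

lemma sq_int_zero: "(\<lambda>x. 0) \<in> sq_int M"
  by (simp add: sq_int_def)

lemma sq_int_sum: "(\<And>i. i \<in> I \<Longrightarrow> f i \<in> sq_int M) \<Longrightarrow> (\<lambda>x. \<Sum>i\<in>I. f i x) \<in> sq_int M"
  by (induction I rule: infinite_finite_induct) (auto intro!: sq_int_add sq_int_zero)

lemma sq_int_mult_integrable:
  assumes f: "f \<in> sq_int M" and g: "g \<in> sq_int M"
  shows "integrable M (\<lambda>x. f x * g x)"
proof (rule Bochner_Integration.integrable_bound)
  note [measurable] = sq_int_measurable[OF f] sq_int_measurable[OF g]
  show "integrable M (\<lambda>x. (f x)\<^sup>2 + (g x)\<^sup>2)"
    using f g by (auto intro!: sq_int_integrable)
  show "(\<lambda>x. f x * g x) \<in> borel_measurable M" by measurable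
  have "\<bar>a * b\<bar> \<le> a\<^sup>2 + b\<^sup>2" for a b :: real
  proof -
    have "2 * (\<bar>a\<bar> * \<bar>b\<bar>) \<le> a\<^sup>2 + b\<^sup>2"
      using sum_squares_bound[of "\<bar>a\<bar>" "\<bar>b\<bar>"] by simp
    moreover have "0 \<le> \<bar>a\<bar> * \<bar>b\<bar>" by simp
    ultimately show ?thesis unfolding abs_mult by linarith
  qed
  then show "AE x in M. norm (f x * g x) \<le> norm ((f x)\<^sup>2 + (g x)\<^sup>2)"
    by simp
qed

text \<open>Dominated convergence for (f - fn)^2, which stays below 4 G^2 because the limit inherits
  the bound by G.\<close>

lemma sq_int_dominated_limit:
  assumes fn: "\<And>n::nat. fn n \<in> borel_measurable M" and f: "f \<in> borel_measurable M" and G: "G \<in> sq_int M"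
    and bound: "\<And>n x. x \<in> space M \<Longrightarrow> \<bar>fn n x\<bar> \<le> \<bar>G x\<bar>"
    and lim: "\<And>x. x \<in> space M \<Longrightarrow> (\<lambda>n. fn n x) \<longlonglongrightarrow> f x"
  shows "f \<in> sq_int M" and "(\<lambda>n. \<integral>x. (f x - fn n x)\<^sup>2 \<partial>M) \<longlonglongrightarrow> 0"
proof -
  note [measurable] = fn f
  have fG: "\<bar>f x\<bar> \<le> \<bar>G x\<bar>" if "x \<in> space M" for x
    by (rule LIMSEQ_le_const2[OF tendsto_rabs[OF lim[OF that]]]) (use bound[OF that] in auto)
  then show "f \<in> sq_int M" by (intro sq_int_bound[OF G f])
  have "(\<lambda>n. \<integral>x. (f x - fn n x)\<^sup>2 \<partial>M) \<longlonglongrightarrow> (\<integral>x. 0 \<partial>M)"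
  proof (rule integral_dominated_convergence[where w = "\<lambda>x. 4 * (G x)\<^sup>2"])
    show "integrable M (\<lambda>x. 4 * (G x)\<^sup>2)" using sq_int_integrable[OF G] by simp
    show "AE x in M. (\<lambda>n. (f x - fn n x)\<^sup>2) \<longlonglongrightarrow> 0"
    proof (rule AE_I2)
      fix x assume "x \<in> space M"
      from tendsto_power[OF tendsto_diff[OF tendsto_const lim[OF this]], of "f x" 2]
      show "(\<lambda>n. (f x - fn n x)\<^sup>2) \<longlonglongrightarrow> 0" by simp
    qed
    show "AE x in M. norm ((f x - fn n x)\<^sup>2) \<le> 4 * (G x)\<^sup>2" for n
    proof (rule AE_I2)
      fix x assume x: "x \<in> space M"
      have "\<bar>f x - fn n x\<bar> \<le> 2 * \<bar>G x\<bar>"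
        using fG[OF x] bound[OF x, of n] by linarith
      then have "(f x - fn n x)\<^sup>2 \<le> (2 * \<bar>G x\<bar>)\<^sup>2"
        by (intro power2_le_iff_abs_le[THEN iffD2]) auto
      then show "norm ((f x - fn n x)\<^sup>2) \<le> 4 * (G x)\<^sup>2"
        by (simp add: power_mult_distrib)
    qed
  qed auto
  then show "(\<lambda>n. \<integral>x. (f x - fn n x)\<^sup>2 \<partial>M) \<longlonglongrightarrow> 0" by simp
qed

lemma integral_sq_add_le:
  assumes "f \<in> sq_int M" "g \<in> sq_int M"
  shows "(\<integral>x. (f x + g x)\<^sup>2 \<partial>M) \<le> 2 * (\<integral>x. (f x)\<^sup>2 \<partial>M) + 2 * (\<integral>x. (g x)\<^sup>2 \<partial>M)"
proof -
  have "(\<integral>x. (f x + g x)\<^sup>2 \<partial>M) \<le> (\<integral>x. 2 * (f x)\<^sup>2 + 2 * (g x)\<^sup>2 \<partial>M)"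
    using assms by (intro integral_mono) (auto intro!: sq_int_integrable sq_int_add simp: sum_power2_le)
  also have "\<dots> = 2 * (\<integral>x. (f x)\<^sup>2 \<partial>M) + 2 * (\<integral>x. (g x)\<^sup>2 \<partial>M)"
    using assms by (subst Bochner_Integration.integral_add) (auto intro!: sq_int_integrable)
  finally show ?thesis .
qed

lemma sq_closure_sq_int: "f \<in> sq_closure M S \<Longrightarrow> f \<in> sq_int M"
  by (simp add: sq_closure_def)

lemma sq_closureD: "f \<in> sq_closure M S \<Longrightarrow> 0 < e \<Longrightarrow> \<exists>s\<in>S. (\<integral>x. (f x - s x)\<^sup>2 \<partial>M) < e"
  by (simp add: sq_closure_def)

locale sq_subspace =
  fixes M :: "'a measure" and S :: "('a \<Rightarrow> real) set"
  assumes subset: "S \<subseteq> sq_int M"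
    and zero: "(\<lambda>x. 0) \<in> S"
    and add: "f \<in> S \<Longrightarrow> g \<in> S \<Longrightarrow> (\<lambda>x. f x + g x) \<in> S"
    and cmult: "f \<in> S \<Longrightarrow> (\<lambda>x. c * f x) \<in> S"
begin

lemma incl: "f \<in> S \<Longrightarrow> f \<in> sq_closure M S"
  using subset by (auto simp: sq_closure_def intro!: bexI[of _ f])

lemma closure_approx:
  assumes f: "f \<in> sq_int M" and approx: "\<And>e. 0 < e \<Longrightarrow> \<exists>g\<in>sq_closure M S. (\<integral>x. (f x - g x)\<^sup>2 \<partial>M) < e"
  shows "f \<in> sq_closure M S"
proof -
  have "\<exists>s\<in>S. (\<integral>x. (f x - s x)\<^sup>2 \<partial>M) < e" if "0 < e" for e
  proof -
    \<comment> \<open>Two errors below e / 4, each doubled by \<open>sum_power2_le\<close>, add up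
      to less than e.\<close>
    from approx[of "e / 4"] that obtain g where g: "g \<in> sq_closure M S" "(\<integral>x. (f x - g x)\<^sup>2 \<partial>M) < e / 4" by auto
    then obtain s where s: "s \<in> S" "(\<integral>x. (g x - s x)\<^sup>2 \<partial>M) < e / 4"
      using sq_closureD[OF g(1), of "e / 4"] \<open>0 < e\<close> by (meson divide_pos_pos zero_less_numeral)
    have "(\<integral>x. (f x - s x)\<^sup>2 \<partial>M) = (\<integral>x. ((f x - g x) + (g x - s x))\<^sup>2 \<partial>M)" by simp
    also have "\<dots> \<le> 2 * (\<integral>x. (f x - g x)\<^sup>2 \<partial>M) + 2 * (\<integral>x. (g x - s x)\<^sup>2 \<partial>M)"
      using f g s subset by (intro integral_sq_add_le sq_int_diff) (auto intro: sq_closure_sq_int)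
    also have "\<dots> < e" using g s by linarith
    finally show ?thesis using s by blast
  qed
  with f show ?thesis by (simp add: sq_closure_def)
qed

lemma closure_add:
  assumes f: "f \<in> sq_closure M S" and g: "g \<in> sq_closure M S"
  shows "(\<lambda>x. f x + g x) \<in> sq_closure M S"
proof -
  have "\<exists>s\<in>S. (\<integral>x. (f x + g x - s x)\<^sup>2 \<partial>M) < e" if "0 < e" for e
  proof -
    from f g that obtain s t where s: "s \<in> S" "(\<integral>x. (f x - s x)\<^sup>2 \<partial>M) < e / 4"
      and t: "t \<in> S" "(\<integral>x. (g x - t x)\<^sup>2 \<partial>M) < e / 4"
      using sq_closureD[OF f, of "e / 4"] sq_closureD[OF g, of "e / 4"] by auto
    have "(\<integral>x. (f x + g x - (s x + t x))\<^sup>2 \<partial>M) = (\<integral>x. ((f x - s x) + (g x - t x))\<^sup>2 \<partial>M)"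
      by (simp add: algebra_simps)
    also have "\<dots> \<le> 2 * (\<integral>x. (f x - s x)\<^sup>2 \<partial>M) + 2 * (\<integral>x. (g x - t x)\<^sup>2 \<partial>M)"
      using f g s t subset by (intro integral_sq_add_le sq_int_diff) (auto intro: sq_closure_sq_int)
    also have "\<dots> < e" using s t by linarith
    finally show ?thesis by (intro bexI[OF _ add[OF s(1) t(1)]])
  qed
  then show ?thesis using f g by (auto simp: sq_closure_def intro: sq_int_add)
qed

lemma closure_cmult:
  assumes f: "f \<in> sq_closure M S"
  shows "(\<lambda>x. c * f x) \<in> sq_closure M S"
proof -
  have "\<exists>s\<in>S. (\<integral>x. (c * f x - s x)\<^sup>2 \<partial>M) < e" if "0 < e" for e
  proof -
    have "0 < e / (c\<^sup>2 + 1)" using that by (simp add: add_nonneg_pos)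
    with f obtain s where s: "s \<in> S" "(\<integral>x. (f x - s x)\<^sup>2 \<partial>M) < e / (c\<^sup>2 + 1)"
      unfolding sq_closure_def by blast
    have "(\<integral>x. (c * f x - c * s x)\<^sup>2 \<partial>M) = c\<^sup>2 * (\<integral>x. (f x - s x)\<^sup>2 \<partial>M)"
      by (simp flip: right_diff_distrib add: power_mult_distrib)
    also have "\<dots> \<le> (c\<^sup>2 + 1) * (\<integral>x. (f x - s x)\<^sup>2 \<partial>M)"
      by (intro mult_right_mono) auto
    also have "\<dots> < e" using s(2) by (simp add: pos_less_divide_eq add_nonneg_pos mult.commute)
    finally show ?thesis by (intro bexI[OF _ cmult[OF s(1)]])
  qed
  then show ?thesis using f by (auto simp: sq_closure_def intro: sq_int_cmult)
qed

lemma closure_diff: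
  "f \<in> sq_closure M S \<Longrightarrow> g \<in> sq_closure M S \<Longrightarrow> (\<lambda>x. f x - g x) \<in> sq_closure M S"
  using closure_add[of f "\<lambda>x. -1 * g x"] closure_cmult[of g "-1"] by simp

lemma closure_sum:
  "(\<And>i. i \<in> I \<Longrightarrow> f i \<in> sq_closure M S) \<Longrightarrow> (\<lambda>x. \<Sum>i\<in>I. f i x) \<in> sq_closure M S"
  by (induction I rule: infinite_finite_induct) (auto intro!: closure_add intro: incl zero)

text \<open>Pointwise limits under a square integrable bound are mean square limits. Most limit
  passages of the completeness proofs have this form.\<close>

lemma closure_dominated_limit:
  assumes fn: "\<And>n::nat. fn n \<in> sq_closure M S" and f: "f \<in> borel_measurable M" and G: "G \<in> sq_int M"
    and bound: "\<And>n x. x \<in> space M \<Longrightarrow> \<bar>fn n x\<bar> \<le> \<bar>G x\<bar>"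
    and lim: "\<And>x. x \<in> space M \<Longrightarrow> (\<lambda>n. fn n x) \<longlonglongrightarrow> f x"
  shows "f \<in> sq_closure M S"
proof (rule closure_approx)
  have m: "fn n \<in> borel_measurable M" for n
    using fn by (blast intro: sq_int_measurable sq_closure_sq_int)
  note lims = sq_int_dominated_limit[OF m f G bound lim]
  show "f \<in> sq_int M" by (rule lims)
  fix e :: real assume "0 < e"
  from order_tendstoD(2)[OF lims(2) this]
  obtain n where "(\<integral>x. (f x - fn n x)\<^sup>2 \<partial>M) < e"
    by (auto simp: eventually_sequentially)
  then show "\<exists>g\<in>sq_closure M S. (\<integral>x. (f x - g x)\<^sup>2 \<partial>M) < e" using fn by blast
qed

text \<open>Serves to ignore the finitely many points where a combination of explicit cut-offs
  differs from the indicator of an interval.\<close>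

lemma closure_cong_AE:
  assumes f: "f \<in> sq_closure M S" and g: "g \<in> borel_measurable M" and ae: "AE x in M. f x = g x"
  shows "g \<in> sq_closure M S"
proof (rule closure_approx)
  note [measurable] = g sq_int_measurable[OF sq_closure_sq_int[OF f]]
  have "integrable M (\<lambda>x. (f x)\<^sup>2) \<longleftrightarrow> integrable M (\<lambda>x. (g x)\<^sup>2)"
    by (rule integrable_cong_AE) (use ae in auto)
  then show "g \<in> sq_int M"
    using g sq_int_integrable[OF sq_closure_sq_int[OF f]] by (simp add: sq_int_def)
  have "(\<integral>x. (g x - f x)\<^sup>2 \<partial>M) = (\<integral>x. 0 \<partial>M)"
    by (rule integral_cong_AE) (use ae in auto)
  then show "\<exists>h\<in>sq_closure M S. (\<integral>x. (g x - h x)\<^sup>2 \<partial>M) < e" if "0 < e" for e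
    using that by (intro bexI[OF _ f]) simp
qed

end

lemma lin_spanI: "finite F \<Longrightarrow> (\<lambda>x. \<Sum>n\<in>F. c n * h n x) \<in> lin_span h"
  unfolding lin_span_def mem_Collect_eq by (intro exI conjI) (assumption, rule refl)

lemma lin_spanE:
  assumes "f \<in> lin_span h"
  obtains F c where "finite F" "f = (\<lambda>x. \<Sum>n\<in>F. c n * h n x)"
  using assms unfolding lin_span_def mem_Collect_eq by (elim exE conjE)

lemma lin_span_add:
  assumes "f \<in> lin_span h" "g \<in> lin_span h"
  shows "(\<lambda>x. f x + g x) \<in> lin_span h"
proof -
  from assms obtain F c G d where F: "finite F" "f = (\<lambda>x. \<Sum>n\<in>F. c n * h n x)"
    and G: "finite G" "g = (\<lambda>x. \<Sum>n\<in>G. d n * h n x)"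
    by (elim lin_spanE)
  \<comment> \<open>F and G may overlap, so both families of coefficients are extended by 0 to the
    union.\<close>
  define e where "e n = (if n \<in> F then c n else 0) + (if n \<in> G then d n else 0)" for n
  have "(\<Sum>n\<in>F \<union> G. e n * h n x) = (\<Sum>n\<in>F \<union> G. if n \<in> F then c n * h n x else 0)
       + (\<Sum>n\<in>F \<union> G. if n \<in> G then d n * h n x else 0)" for x
    by (simp add: e_def distrib_right sum.distrib if_distrib[of "\<lambda>t. t * _"] cong: if_cong)
  also have "\<dots> x = f x + g x" for x
    using F G by (simp add: Int_absorb1 flip: sum.inter_restrict)
  finally have "(\<lambda>x. f x + g x) = (\<lambda>x. \<Sum>n\<in>F \<union> G. e n * h n x)" by simp
  then show ?thesis using F(1) G(1) by (simp only: lin_spanI finite_UnI)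
qed

lemma lin_span_cmult:
  assumes "f \<in> lin_span h" shows "(\<lambda>x. c * f x) \<in> lin_span h"
proof -
  from assms obtain F d where F: "finite F" and f: "f = (\<lambda>x. \<Sum>n\<in>F. d n * h n x)"
    by (rule lin_spanE)
  have "(\<lambda>x. c * f x) = (\<lambda>x. \<Sum>n\<in>F. (c * d n) * h n x)"
    unfolding f sum_distrib_left mult.assoc ..
  with F show ?thesis by (simp only: lin_spanI)
qed

lemma lin_span_zero: "(\<lambda>x. 0) \<in> lin_span h"
  using lin_spanI[of "{}"] by simp

lemma lin_span_base: "h n \<in> lin_span h"
  using lin_spanI[of "{n}" "\<lambda>_. 1"] by simp

lemma lin_span_sum: "(\<And>i. i \<in> I \<Longrightarrow> f i \<in> lin_span h) \<Longrightarrow> (\<lambda>x. \<Sum>i\<in>I. f i x) \<in> lin_span h"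
  by (induction I rule: infinite_finite_induct) (auto intro!: lin_span_add lin_span_zero)

lemma sq_subspace_lin_span:
  assumes "\<And>n. h n \<in> sq_int M"
  shows "sq_subspace M (lin_span h)"
proof
  show "lin_span h \<subseteq> sq_int M"
    using assms by (auto elim!: lin_spanE intro!: sq_int_sum sq_int_cmult)
qed (auto intro: lin_span_add lin_span_cmult lin_span_zero)

section \<open>Density of the Hermite functions on the line\<close>

lemma hermite_fun1_sq_int: "0 < a \<Longrightarrow> hermite_fun1 a b n \<in> sq_int lborel"
  using integrable_hermite_fun1_mult[of a b n n] by (simp add: sq_int_def power2_eq_square)

locale hermite1 =
  fixes a b :: real
  assumes a_pos: "0 < a"
begin

sublocale sq_subspace lborel "lin_span (hermite_fun1 a b)"
  using a_pos by (intro sq_subspace_lin_span hermite_fun1_sq_int)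

text \<open>The variable in which the Gaussian factor of every Hermite function is exp (- z^2 /
  2).\<close>

definition z :: "real \<Rightarrow> real" where "z x = a * (x - b)"

abbreviation dense :: "(real \<Rightarrow> real) set" where
  "dense \<equiv> sq_closure lborel (lin_span (hermite_fun1 a b))"

lemma measurable_z [measurable]: "z \<in> borel_measurable borel"
  unfolding z_def by measurable

lemma integrable_z_gauss:
  assumes "0 < c" shows "integrable lborel (\<lambda>x. z x ^ k * exp (- (c * (z x)\<^sup>2)))"
proof -
  have "integrable lborel (\<lambda>x. poly ([:- a * b, a:] ^ k) x * exp (- ((c * a\<^sup>2) * (x - b)\<^sup>2)))"
    using a_pos assms by (intro integrable_poly_gauss) simp
  moreover have "poly ([:- a * b, a:] ^ k) x = z x ^ k" for x
    by (simp add: z_def poly_power algebra_simps)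
  moreover have "c * a\<^sup>2 * (x - b)\<^sup>2 = c * (z x)\<^sup>2" for x
    by (simp add: z_def power_mult_distrib)
  ultimately show ?thesis by (simp only:)
qed

lemma sq_int_z_gauss:
  assumes "0 < c" shows "(\<lambda>x. z x ^ k * exp (- (c * (z x)\<^sup>2))) \<in> sq_int lborel"
proof -
  have "(z x ^ k * exp (- (c * (z x)\<^sup>2)))\<^sup>2 = z x ^ (2 * k) * exp (- ((2 * c) * (z x)\<^sup>2))" for x
    by (simp add: power_mult_distrib flip: power_mult exp_double) (simp add: mult.commute)
  moreover have "(\<lambda>x. z x ^ k * exp (- (c * (z x)\<^sup>2))) \<in> borel_measurable lborel" by simp
  ultimately show ?thesis using integrable_z_gauss[of "2 * c" "2 * k"] assms by (simp add: sq_int_def)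
qed

lemma lin_span_z_mult:
  assumes "f \<in> lin_span (hermite_fun1 a b)"
  shows "(\<lambda>x. z x * f x) \<in> lin_span (hermite_fun1 a b)"
proof -
  from assms obtain F c where F: "f = (\<lambda>x. \<Sum>n\<in>F. c n * hermite_fun1 a b n x)"
    by (rule lin_spanE)
  have "z x * hermite_fun1 a b n x = sqrt (2 * real n) / 2 * hermite_fun1 a b (n - 1) x
     + sqrt (2 * real (Suc n)) / 2 * hermite_fun1 a b (Suc n) x" for n x
  proof -
    have "2 * a * (z x * hermite_fun1 a b n x) = 2 * a * (sqrt (2 * real n) / 2 * hermite_fun1 a b (n - 1) x
     + sqrt (2 * real (Suc n)) / 2 * hermite_fun1 a b (Suc n) x)"
      using hermite_fun1_recurrence[OF a_pos, of x b n]
      by (simp add: z_def algebra_simps power2_eq_square)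
    then show ?thesis using a_pos by simp
  qed
  then have "c n * (z x * hermite_fun1 a b n x) = c n * (sqrt (2 * real n) / 2 * hermite_fun1 a b (n - 1) x
     + sqrt (2 * real (Suc n)) / 2 * hermite_fun1 a b (Suc n) x)" for n x
    by (rule arg_cong)
  then have "(\<lambda>x. z x * f x) = (\<lambda>x. \<Sum>n\<in>F. c n * (sqrt (2 * real n) / 2 * hermite_fun1 a b (n - 1) x
     + sqrt (2 * real (Suc n)) / 2 * hermite_fun1 a b (Suc n) x))"
    by (simp only: F sum_distrib_left mult.left_commute[of "z _"])
  also have "\<dots> \<in> lin_span (hermite_fun1 a b)"
    by (intro lin_span_sum lin_span_cmult lin_span_add lin_span_base)
  finally show ?thesis .
qed

text \<open>h_0 is a multiple of the Gaussian, and multiplication by z does not leave the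
  span.\<close>

lemma z_power_gauss_span: "(\<lambda>x. z x ^ k * exp (- ((z x)\<^sup>2 / 2))) \<in> lin_span (hermite_fun1 a b)"
proof (induction k)
  case 0
  have "exp (- ((z x)\<^sup>2 / 2)) = 1 / sqrt (a / sqrt pi) * hermite_fun1 a b 0 x" for x
    using a_pos by (simp add: hermite_fun1_def hermite_poly_eq z_def power_mult_distrib)
  then show ?case
    by (simp only: power_0 mult_1) (intro lin_span_cmult lin_span_base)
next
  case (Suc k)
  from lin_span_z_mult[OF this] show ?case by (simp add: mult.assoc)
qed

(* Multiplication by exp (- z^2 / 4) is the limit of its Taylor polynomials; these stay below
   exp (z^2 / 4), which the factor exp (- z^2 / 2) absorbs. *)
lemma z_power_gauss_dense:
  "(\<lambda>x. z x ^ k * exp (- ((z x)\<^sup>2 / 2)) * exp (- ((z x)\<^sup>2 / 4)) ^ j) \<in> dense"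
\<comment> \<open>k has to vary: the i-th Taylor term of the next factor raises the power of z by 2
  i.\<close>
proof (induction j arbitrary: k)
  case 0
  show ?case using z_power_gauss_span by (auto intro: incl)
next
  case (Suc j)
  let ?E = "\<lambda>x. exp (- ((z x)\<^sup>2 / 4))"
  let ?f = "\<lambda>n x. \<Sum>i<n. (- 1 / 4) ^ i / fact i * (z x ^ (k + 2 * i) * exp (- ((z x)\<^sup>2 / 2)) * ?E x ^ j)"
  have f_eq: "?f n x = z x ^ k * exp (- ((z x)\<^sup>2 / 2)) * ?E x ^ j * (\<Sum>i<n. (- ((z x)\<^sup>2 / 4)) ^ i /\<^sub>R fact i)" for n x
    unfolding sum_distrib_left
  proof (rule sum.cong)
    fix i
    have *: "c / f * (p * q * e * e') = p * e * e' * ((c * q) /\<^sub>R f)" for c f p q e e' :: real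
      by (simp add: divide_inverse)
    have "(- ((z x)\<^sup>2 / 4)) ^ i = ((- 1 / 4) * (z x)\<^sup>2) ^ i" by simp
    also have "\<dots> = (- 1 / 4) ^ i * z x ^ (2 * i)"
      by (simp only: power_mult_distrib power_mult)
    finally show "(- 1 / 4) ^ i / fact i * (z x ^ (k + 2 * i) * exp (- ((z x)\<^sup>2 / 2)) * ?E x ^ j)
      = z x ^ k * exp (- ((z x)\<^sup>2 / 2)) * ?E x ^ j * ((- ((z x)\<^sup>2 / 4)) ^ i /\<^sub>R fact i)"
      unfolding power_add by (simp only: *)
  qed simp
  have "(\<lambda>x. z x ^ k * exp (- ((z x)\<^sup>2 / 2)) * ?E x ^ j * ?E x) \<in> dense"
  proof (rule closure_dominated_limit)
    show "?f n \<in> dense" for n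
      by (intro closure_sum closure_cmult Suc)
    show "(\<lambda>x. z x ^ k * exp (- ((z x)\<^sup>2 / 2)) * ?E x ^ j * ?E x) \<in> borel_measurable lborel" by simp
    show "(\<lambda>x. z x ^ k * exp (- (1 / 4 * (z x)\<^sup>2))) \<in> sq_int lborel"
      by (rule sq_int_z_gauss) simp
    show "(\<lambda>n. ?f n x) \<longlonglongrightarrow> z x ^ k * exp (- ((z x)\<^sup>2 / 2)) * ?E x ^ j * ?E x" for x
      unfolding f_eq using exp_converges[of "- ((z x)\<^sup>2 / 4)"] by (intro tendsto_intros) (simp add: sums_def)
    show "\<bar>?f n x\<bar> \<le> \<bar>z x ^ k * exp (- (1 / 4 * (z x)\<^sup>2))\<bar>" for n x
    proof -
      have "\<bar>\<Sum>i<n. (- ((z x)\<^sup>2 / 4)) ^ i /\<^sub>R fact i\<bar> \<le> (\<Sum>i<n. ((z x)\<^sup>2 / 4) ^ i /\<^sub>R fact i)"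
        by (rule sum_abs[THEN order_trans]) (simp add: abs_mult power_abs)
      also have "\<dots> \<le> exp ((z x)\<^sup>2 / 4)"
        unfolding exp_def by (rule sum_le_suminf) (use summable_exp_generic[of "(z x)\<^sup>2 / 4"] in auto)
      finally have 1: "\<bar>\<Sum>i<n. (- ((z x)\<^sup>2 / 4)) ^ i /\<^sub>R fact i\<bar> \<le> exp ((z x)\<^sup>2 / 4)" .
      have 2: "?E x ^ j \<le> 1" by (intro power_le_one) auto
      have "\<bar>?f n x\<bar> = \<bar>z x\<bar> ^ k * exp (- ((z x)\<^sup>2 / 2)) * ?E x ^ j * \<bar>\<Sum>i<n. (- ((z x)\<^sup>2 / 4)) ^ i /\<^sub>R fact i\<bar>"
        unfolding f_eq by (simp add: abs_mult power_abs)
      also have "\<dots> \<le> \<bar>z x\<bar> ^ k * exp (- ((z x)\<^sup>2 / 2)) * 1 * exp ((z x)\<^sup>2 / 4)"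
        by (intro mult_mono mult_left_mono 1 2) auto
      also have "\<dots> = \<bar>z x\<bar> ^ k * exp (- ((z x)\<^sup>2 / 2) + (z x)\<^sup>2 / 4)"
        by (simp only: mult_1_right exp_add mult.assoc)
      also have "- ((z x)\<^sup>2 / 2) + (z x)\<^sup>2 / 4 = - (1 / 4 * (z x)\<^sup>2)" by simp
      finally show ?thesis by (simp add: abs_mult power_abs)
    qed
  qed
  then show ?case by (simp add: mult_ac)
qed

text \<open>In the variable y = exp (- z^2 / 4), which stays in \<open>{0..1}\<close>, the preceding
  lemma covers all polynomials. Weierstrass approximation is uniform there, so one bound B + 1
  serves all approximants and the Gaussian supplies integrability.\<close>

lemma continuous_gauss_dense:
  assumes "continuous_on {0..1} G"
  shows "(\<lambda>x. z x ^ k * exp (- ((z x)\<^sup>2 / 2)) * G (exp (- ((z x)\<^sup>2 / 4)))) \<in> dense"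
proof -
  let ?E = "\<lambda>x. exp (- ((z x)\<^sup>2 / 4))"
  have E01: "?E x \<in> {0..1}" for x by simp
  have "\<exists>p. real_polynomial_function p \<and> (\<forall>y\<in>{0..1}. \<bar>G y - p y\<bar> < 1 / Suc n)" for n
    by (rule Stone_Weierstrass_real_polynomial_function[of "{0..1::real}" G "1 / Suc n"]) (use assms in auto)
  then obtain p where p: "\<And>n. real_polynomial_function (p n)" "\<And>n y. y \<in> {0..1} \<Longrightarrow> \<bar>G y - p n y\<bar> < 1 / Suc n"
    by metis
  obtain B where B: "\<And>y. y \<in> {0..1} \<Longrightarrow> \<bar>G y\<bar> \<le> B"
    using compact_imp_bounded[OF compact_continuous_image[OF assms]] by (force simp: bounded_iff)
  have lim: "(\<lambda>n. p n y) \<longlonglongrightarrow> G y" if "y \<in> {0..1}" for y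
  proof (rule LIMSEQ_I)
    fix e :: real assume "0 < e"
    then obtain N where N: "1 / Suc N < e" using nat_approx_posE by blast
    show "\<exists>no. \<forall>n\<ge>no. norm (p n y - G y) < e"
    proof (intro exI allI impI)
      fix n assume "N \<le> n"
      then have "1 / Suc n \<le> 1 / Suc N" by (simp add: frac_le)
      then show "norm (p n y - G y) < e" using p(2)[OF that, of n] N by (simp add: abs_minus_commute)
    qed
  qed
  have pd: "(\<lambda>x. z x ^ k * exp (- ((z x)\<^sup>2 / 2)) * p n (?E x)) \<in> dense" for n
  proof -
    obtain c m where "p n = (\<lambda>y. \<Sum>i\<le>m. c i * y ^ i)"
      using p(1)[of n] real_polynomial_function_iff_sum by blast
    then have "(\<lambda>x. z x ^ k * exp (- ((z x)\<^sup>2 / 2)) * p n (?E x))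
       = (\<lambda>x. \<Sum>i\<le>m. c i * (z x ^ k * exp (- ((z x)\<^sup>2 / 2)) * ?E x ^ i))"
      by (simp add: sum_distrib_left mult_ac)
    also have "\<dots> \<in> dense" by (intro closure_sum closure_cmult z_power_gauss_dense)
    finally show ?thesis .
  qed
  show ?thesis
  proof (rule closure_dominated_limit[OF pd])
    show "(\<lambda>n. z x ^ k * exp (- ((z x)\<^sup>2 / 2)) * p n (?E x)) \<longlonglongrightarrow> z x ^ k * exp (- ((z x)\<^sup>2 / 2)) * G (?E x)" for x
      by (intro tendsto_intros lim E01)
    \<comment> \<open>\<open>G\<close> is continuous on \<open>{0..1}\<close> only, so measurability
      of the composition is taken from the approximants.\<close>
    then show "(\<lambda>x. z x ^ k * exp (- ((z x)\<^sup>2 / 2)) * G (?E x)) \<in> borel_measurable lborel"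
      by (intro borel_measurable_LIMSEQ_real[OF _ sq_int_measurable[OF sq_closure_sq_int[OF pd]]])
    show "(\<lambda>x. (B + 1) * (z x ^ k * exp (- (1 / 2 * (z x)\<^sup>2)))) \<in> sq_int lborel"
      by (intro sq_int_cmult sq_int_z_gauss) simp
    show "\<bar>z x ^ k * exp (- ((z x)\<^sup>2 / 2)) * p n (?E x)\<bar> \<le> \<bar>(B + 1) * (z x ^ k * exp (- (1 / 2 * (z x)\<^sup>2)))\<bar>" for n x
    proof -
      have "1 / real (Suc n) \<le> 1" by simp
      then have le: "\<bar>p n (?E x)\<bar> \<le> \<bar>B + 1\<bar>"
        using p(2)[OF E01[of x], of n] B[OF E01[of x]] by linarith
      show ?thesis
        using mult_mono[OF le order_refl, of "\<bar>z x ^ k * exp (- ((z x)\<^sup>2 / 2))\<bar>"]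
        by (simp add: abs_mult mult_ac)
    qed
  qed
qed

text \<open>The function \<open>G\<close> of \<open>continuous_gauss_dense\<close> is chosen to undo
  the weight: with y = exp (- z^2 / 4) one has exp (- z^2 / 2) = y^2 and |z| = sqrt (- 4 ln y), and
  |z| < r means y > exp (- r^2 / 4). Division by y^2 does no harm since the cut-off keeps y away
  from 0.\<close>

lemma truncated_dense:
  assumes \<rho>: "continuous_on {0..} \<rho>" and r: "0 < r"
  shows "(\<lambda>x. z x ^ k * \<rho> \<bar>z x\<bar> * (if \<bar>z x\<bar> < r then 1 else 0)) \<in> dense"
proof -
  let ?E = "\<lambda>x. exp (- ((z x)\<^sup>2 / 4))"
  define y0 where "y0 = exp (- (r\<^sup>2 / 4))"
  have y0: "0 < y0" "y0 \<le> 1" by (auto simp: y0_def)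
  \<comment> \<open>The first factor is a ramp that is 0 for y <= y0 and tends to 1 for y > y0.
    Replacing y by \<open>max y y0\<close> keeps the quotient and the logarithm continuous on
    \<open>{0..1}\<close> and changes nothing where the ramp is positive.\<close>
  define G where "G n y = min 1 (real n * max 0 (y - y0)) / (max y y0)\<^sup>2 * \<rho> (sqrt (- 4 * ln (max y y0)))" for n y
  have iff: "y0 < ?E x \<longleftrightarrow> \<bar>z x\<bar> < r" for x
    using r abs_le_square_iff[of r "z x"] by (auto simp: y0_def)
  have cont: "continuous_on {0..1} (G n)" for n
  proof -
    have ln0: "ln (max y y0) \<le> 0" if "y \<in> {0..1}" for y using that y0 by simp
    have "continuous_on {0..1} (\<lambda>y. \<rho> (sqrt (- 4 * ln (max y y0))))"
      by (rule continuous_on_compose2[OF \<rho>]) (use y0 ln0 in \<open>auto intro!: continuous_intros\<close>)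
    then show ?thesis unfolding G_def
      by (intro continuous_intros) (use y0 in auto)
  qed
  have eq: "z x ^ k * exp (- ((z x)\<^sup>2 / 2)) * G n (?E x) = z x ^ k * \<rho> \<bar>z x\<bar> * min 1 (real n * max 0 (?E x - y0))" for n x
  proof (cases "y0 < ?E x")
    case True
    then have "max (?E x) y0 = ?E x" by simp
    moreover have "(?E x)\<^sup>2 = exp (- ((z x)\<^sup>2 / 2))" by (simp flip: exp_double)
    ultimately show ?thesis by (simp add: G_def)
  qed (simp add: G_def)
  obtain B where B: "\<And>y. y \<in> {0..r} \<Longrightarrow> \<bar>\<rho> y\<bar> \<le> B"
    using compact_imp_bounded[OF compact_continuous_image[OF continuous_on_subset[OF \<rho>], of "{0..r}"]]
    by (force simp: bounded_iff)
  have B0: "0 \<le> B" using B[of r] r by auto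
  have pd: "(\<lambda>x. z x ^ k * \<rho> \<bar>z x\<bar> * min 1 (real n * max 0 (?E x - y0))) \<in> dense" for n
    using continuous_gauss_dense[OF cont, of k n] by (simp only: eq)
  show ?thesis
  proof (rule closure_dominated_limit[OF pd])
    show lim: "(\<lambda>n. z x ^ k * \<rho> \<bar>z x\<bar> * min 1 (real n * max 0 (?E x - y0))) \<longlonglongrightarrow>
       z x ^ k * \<rho> \<bar>z x\<bar> * (if \<bar>z x\<bar> < r then 1 else 0)" for x
    proof (cases "\<bar>z x\<bar> < r")
      case True
      then have pos: "0 < ?E x - y0" using iff by simp
      obtain N where N: "1 < real N * (?E x - y0)"
        using reals_Archimedean3[OF pos] by blast
      have "\<forall>\<^sub>F n in sequentially. min 1 (real n * max 0 (?E x - y0)) = 1"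
        using eventually_ge_at_top[of N]
      proof eventually_elim
        case (elim n)
        then have "real N * (?E x - y0) \<le> real n * (?E x - y0)" using pos by (intro mult_right_mono) auto
        then have "1 \<le> real n * (?E x - y0)" using N by linarith
        then show ?case using pos by simp
      qed
      then show ?thesis using True by (intro tendsto_intros) (simp add: tendsto_eventually)
    next
      case False
      then show ?thesis using iff[of x] by simp
    qed
    show "(\<lambda>x. z x ^ k * \<rho> \<bar>z x\<bar> * (if \<bar>z x\<bar> < r then 1 else 0)) \<in> borel_measurable lborel"
      by (rule borel_measurable_LIMSEQ_real[OF lim sq_int_measurable[OF sq_closure_sq_int[OF pd]]])
    have "integrable lborel (\<lambda>x. (r ^ k * B)\<^sup>2 * indicator {b - r / a..b + r / a} x)"
      by (intro integrable_mult_right integrable_real_indicator) (auto simp: emeasure_lborel_Icc_eq)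
    then show "(\<lambda>x. r ^ k * B * indicator {b - r / a..b + r / a} x) \<in> sq_int lborel"
      by (simp add: sq_int_def power_mult_distrib power2_eq_square[of "indicator _ _"] flip: indicator_inter_arith)
    show "\<bar>z x ^ k * \<rho> \<bar>z x\<bar> * min 1 (real n * max 0 (?E x - y0))\<bar>
        \<le> \<bar>r ^ k * B * indicator {b - r / a..b + r / a} x\<bar>" for n x
    proof (cases "\<bar>z x\<bar> < r")
      case True
      then have "x \<in> {b - r / a..b + r / a}"
        using a_pos by (simp add: z_def field_simps abs_less_iff)
      moreover have "\<bar>z x ^ k * \<rho> \<bar>z x\<bar> * min 1 (real n * max 0 (?E x - y0))\<bar> \<le> r ^ k * B * 1"
        unfolding abs_mult power_abs
        using True B[of "\<bar>z x\<bar>"] B0 r by (intro mult_mono power_mono) auto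
      ultimately show ?thesis using B0 r by simp
    next
      case False
      then show ?thesis using iff[of x] by simp
    qed
  qed
qed

text \<open>What depends on |z| alone is even; the odd counterpart comes from the power z^1, as z /
  max (1 / (n + 1)) |z| is bounded by 1 and tends to sgn z.\<close>

lemma sgn_truncated_dense:
  assumes r: "0 < r"
  shows "(\<lambda>x. sgn (z x) * (if \<bar>z x\<bar> < r then 1 else 0)) \<in> dense"
proof (rule closure_dominated_limit)
  show "(\<lambda>x. z x ^ 1 * (1 / max (1 / Suc n) \<bar>z x\<bar>) * (if \<bar>z x\<bar> < r then 1 else 0)) \<in> dense" for n
  proof (rule truncated_dense[OF _ r])
    have "0 < max (1 / real (Suc n)) y" for y by (simp add: less_max_iff_disj)
    then have "max (1 / real (Suc n)) y \<noteq> 0" for y by (metis less_irrefl)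
    then show "continuous_on {0..} (\<lambda>y. 1 / max (1 / real (Suc n)) y)" by (intro continuous_intros) auto
  qed
  show "(\<lambda>x. sgn (z x) * (if \<bar>z x\<bar> < r then 1 else 0)) \<in> borel_measurable lborel" by simp
  show "(\<lambda>x. z x ^ 0 * 1 * (if \<bar>z x\<bar> < r then 1 else 0)) \<in> sq_int lborel"
    by (rule sq_closure_sq_int[OF truncated_dense[OF _ r]]) simp
  show "\<bar>z x ^ 1 * (1 / max (1 / real (Suc n)) \<bar>z x\<bar>) * (if \<bar>z x\<bar> < r then 1 else 0)\<bar>
     \<le> \<bar>z x ^ 0 * 1 * (if \<bar>z x\<bar> < r then 1 else 0)\<bar>" for n x
    by (auto simp: abs_mult field_simps max_def)
  show "(\<lambda>n. z x ^ 1 * (1 / max (1 / real (Suc n)) \<bar>z x\<bar>) * (if \<bar>z x\<bar> < r then 1 else 0)) \<longlonglongrightarrow>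
     sgn (z x) * (if \<bar>z x\<bar> < r then 1 else 0)" for x
  proof (cases "z x = 0")
    case False
    then have "0 < \<bar>z x\<bar>" by simp
    then have "(\<lambda>n. z x ^ 1 * (1 / max (1 / real (Suc n)) \<bar>z x\<bar>)) \<longlonglongrightarrow> z x ^ 1 * (1 / max 0 \<bar>z x\<bar>)"
      by (intro tendsto_intros tendsto_max LIMSEQ_Suc[OF lim_1_over_n]) auto
    also have "z x ^ 1 * (1 / max 0 \<bar>z x\<bar>) = sgn (z x)" using False by (simp add: sgn_real_def)
    finally show ?thesis by (intro tendsto_intros)
  qed simp
qed

lemma indicator_interval_dense:
  assumes "s < t"
  shows "indicator {s<..<t} \<in> dense"
proof -
  define P where "P r x = (if \<bar>z x\<bar> < r then 1 else 0 :: real)" for r x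
  \<comment> \<open>Wherever z is not 0, \<open>e r\<close> is an oriented indicator in the variable
    z: 1 on (0, r) if r > 0, and -1 on (r, 0) if r < 0. Hence the difference for z t and z s is the
    indicator of (s, t) almost everywhere, wherever 0 lies.\<close>
  define e where "e r x = 1 / 2 * (sgn (z x) * P \<bar>r\<bar> x + sgn r * P \<bar>r\<bar> x)" for r x
  have P: "P r \<in> dense" if "0 < r" for r
    using truncated_dense[OF _ that, of "\<lambda>_. 1" 0] by (simp add: P_def[abs_def])
  have Q: "(\<lambda>x. sgn (z x) * P r x) \<in> dense" if "0 < r" for r
    using sgn_truncated_dense[OF that] by (simp add: P_def[abs_def])
  have e: "e r \<in> dense" for r
  proof (cases "r = 0")
    case True
    then have "e r = (\<lambda>x. 0)" by (simp add: e_def P_def fun_eq_iff)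
    then show ?thesis using incl zero by simp
  next
    case False
    then show ?thesis unfolding e_def by (intro closure_cmult closure_add Q P) auto
  qed
  have zs: "z y < z x \<longleftrightarrow> y < x" for x y using a_pos by (simp add: z_def)
  have z0: "z x = 0 \<longleftrightarrow> x = b" for x using a_pos by (simp add: z_def)
  show ?thesis
  proof (rule closure_cong_AE[OF closure_diff[OF e[of "z t"] e[of "z s"]]])
    show "AE x in lborel. e (z t) x - e (z s) x = indicator {s<..<t} x"
      using AE_lborel_singleton[of b] AE_lborel_singleton[of s] AE_lborel_singleton[of t]
    proof eventually_elim
      case (elim x)
      have *: "z x \<noteq> 0" "z x \<noteq> z s" "z x \<noteq> z t" "z s < z t"
        using elim zs[of x s] zs[of s x] zs[of x t] zs[of t x] zs[of s t] z0[of x] assms by auto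
      have "indicator {s<..<t} x = (if z s < z x \<and> z x < z t then 1 else 0 :: real)"
        by (simp add: zs)
      with * show ?case
        unfolding e_def P_def by (auto simp: sgn_real_def abs_if split: if_splits)
    qed
  qed simp
qed

end

section \<open>Completeness in several dimensions\<close>

lemma
  fixes f :: "'d::finite \<Rightarrow> real \<Rightarrow> real"
  assumes f: "\<And>j. integrable lborel (f j)"
  shows integrable_lborel_vec_prod: "integrable lborel (\<lambda>x::real^'d. \<Prod>j\<in>UNIV. f j (x $ j))" (is ?int)
    and integral_lborel_vec_prod:
      "(\<integral>x. (\<Prod>j\<in>UNIV. f j (x $ j)) \<partial>(lborel :: (real^'d) measure)) = (\<Prod>j\<in>UNIV. \<integral>t. f j t \<partial>lborel)" (is ?eq)
proof -
  have [measurable]: "f j \<in> borel_measurable borel" for j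
    using borel_measurable_integrable[OF f[of j]] by simp
  let ?P = "\<Pi>\<^sub>M b\<in>(Basis::(real^'d) set). (lborel :: real measure)"
  let ?T = "\<lambda>g. \<Sum>b\<in>Basis. g b *\<^sub>R b :: real^'d"
  have Basis: "(Basis :: (real^'d) set) = range (\<lambda>j. axis j 1)"
    by (auto simp: Basis_vec_def)
  have inj: "inj (\<lambda>j::'d. axis j (1::real))"
    by (auto simp: inj_on_def axis_eq_axis)
  \<comment> \<open>The product measure behind \<open>lborel\<close> is indexed by basis vectors;
    \<open>ix\<close> translates these back into coordinates.\<close>
  define ix where "ix = inv (\<lambda>j::'d. axis j (1::real))"
  have ix: "ix (axis j 1) = j" for j
    unfolding ix_def using inv_f_f[OF inj] .
  have comp: "?T g $ j = g (axis j 1)" for g j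
    unfolding Basis by (subst sum.reindex[OF inj]) (simp add: axis_def if_distrib[of "\<lambda>t. _ * t"] cong: if_cong)
  have eq: "(\<Prod>j\<in>UNIV. f j (?T g $ j)) = (\<Prod>b\<in>Basis. f (ix b) (g b))" for g
    unfolding comp unfolding Basis by (subst prod.reindex[OF inj]) (simp add: ix)
  interpret P: product_sigma_finite "\<lambda>b::real^'d. lborel :: real measure" ..
  have T: "?T \<in> measurable ?P borel" by simp
  have g: "(\<lambda>x. \<Prod>j\<in>UNIV. f j (x $ j)) \<in> borel_measurable (borel :: (real^'d) measure)" by measurable
  have L: "(lborel :: (real^'d) measure) = distr ?P borel ?T" by (rule lborel_eq)
  show ?int
    by (simp only: L integrable_distr_eq[OF T g] eq) (intro P.product_integrable_prod f, simp)
  have "(\<integral>x. (\<Prod>j\<in>UNIV. f j (x $ j)) \<partial>(lborel :: (real^'d) measure)) = (\<Prod>b\<in>Basis. \<integral>t. f (ix b) t \<partial>lborel)"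
    by (simp only: L integral_distr[OF T g] eq) (intro P.product_integral_prod f, simp)
  also have "\<dots> = (\<Prod>j\<in>UNIV. \<integral>t. f j t \<partial>lborel)"
    unfolding Basis by (subst prod.reindex[OF inj]) (simp add: ix)
  finally show ?eq .
qed

lemma sq_int_vec_prod:
  fixes f :: "'d::finite \<Rightarrow> real \<Rightarrow> real"
  assumes f: "\<And>j. f j \<in> sq_int lborel"
  shows "(\<lambda>x::real^'d. \<Prod>j\<in>UNIV. f j (x $ j)) \<in> sq_int lborel"
    and "(\<integral>x. (\<Prod>j\<in>UNIV. f j (x $ j))\<^sup>2 \<partial>(lborel :: (real^'d) measure)) = (\<Prod>j\<in>UNIV. \<integral>t. (f j t)\<^sup>2 \<partial>lborel)"
proof -
  have [measurable]: "f j \<in> borel_measurable borel" for j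
    using sq_int_measurable[OF f[of j]] by simp
  have "(\<lambda>x::real^'d. \<Prod>j\<in>UNIV. f j (x $ j)) \<in> borel_measurable lborel" by measurable
  then show "(\<lambda>x::real^'d. \<Prod>j\<in>UNIV. f j (x $ j)) \<in> sq_int lborel"
    using integrable_lborel_vec_prod[OF sq_int_integrable[OF f]] by (simp add: sq_int_def prod_power_distrib)
  show "(\<integral>x. (\<Prod>j\<in>UNIV. f j (x $ j))\<^sup>2 \<partial>(lborel :: (real^'d) measure)) = (\<Prod>j\<in>UNIV. \<integral>t. (f j t)\<^sup>2 \<partial>lborel)"
    unfolding prod_power_distrib by (rule integral_lborel_vec_prod[OF sq_int_integrable[OF f]])
qed

section \<open>Orthonormality, density and Parseval's inequality in R^d\<close>

definition hermite_coeff :: "real^'d \<Rightarrow> real^'d \<Rightarrow> (real^'d \<Rightarrow> real) \<Rightarrow> nat^'d \<Rightarrow> real" where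
  "hermite_coeff \<alpha> \<beta> f n = (\<integral>x. f x * hermite_fun \<alpha> \<beta> n x \<partial>lborel)"

locale hermite_vec =
  fixes \<alpha> \<beta> :: "real^'d"
  assumes \<alpha>_pos: "0 < \<alpha> $ j"
begin

lemma hermite_fun_sq_int: "hermite_fun \<alpha> \<beta> n \<in> sq_int lborel"
  unfolding hermite_fun_def[abs_def] using \<alpha>_pos by (intro sq_int_vec_prod hermite_fun1_sq_int)

lemma hermite_fun_orthonormal:
  "(\<integral>x. hermite_fun \<alpha> \<beta> n x * hermite_fun \<alpha> \<beta> m x \<partial>lborel) = (if n = m then 1 else 0)"
proof -
  have "(\<integral>x. hermite_fun \<alpha> \<beta> n x * hermite_fun \<alpha> \<beta> m x \<partial>lborel) =
    (\<Prod>j\<in>UNIV. \<integral>t. hermite_fun1 (\<alpha> $ j) (\<beta> $ j) (n $ j) t * hermite_fun1 (\<alpha> $ j) (\<beta> $ j) (m $ j) t \<partial>lborel)"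
    unfolding hermite_fun_def prod.distrib[symmetric]
    using \<alpha>_pos by (intro integral_lborel_vec_prod integrable_hermite_fun1_mult)
  also have "\<dots> = (\<Prod>j\<in>UNIV. if n $ j = m $ j then 1 else 0)"
    using \<alpha>_pos by (simp add: hermite_fun1_orthonormal)
  also have "\<dots> = (if n = m then 1 else 0)"
    by (auto simp: vec_eq_iff)
  finally show ?thesis .
qed

sublocale sq_subspace lborel "lin_span (hermite_fun \<alpha> \<beta>)"
  by (intro sq_subspace_lin_span hermite_fun_sq_int)

abbreviation dense :: "(real^'d \<Rightarrow> real) set" where
  "dense \<equiv> sq_closure lborel (lin_span (hermite_fun \<alpha> \<beta>))"

text \<open>Factors are exchanged one at a time: J collects the directions in which a Hermite
  function has already been replaced by \<open>g\<close>. With the other factors fixed, the squared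
  norm of the product is a constant times that of the remaining factor, so it suffices to
  approximate there.\<close>

lemma prod_dense_aux:
  assumes g: "\<And>j. g j \<in> sq_closure lborel (lin_span (hermite_fun1 (\<alpha> $ j) (\<beta> $ j)))"
  shows "(\<lambda>x. \<Prod>j\<in>UNIV. (if j \<in> J then g j else hermite_fun1 (\<alpha> $ j) (\<beta> $ j) (n $ j)) (x $ j)) \<in> dense"
  using finite[of J]
proof (induction J arbitrary: n rule: finite_induct)
  case empty
  then show ?case
    using incl[OF lin_span_base] by (simp add: hermite_fun_def[abs_def])
next
  case (insert i J)
  let ?h = "\<lambda>j n. hermite_fun1 (\<alpha> $ j) (\<beta> $ j) n"
  define f where "f \<phi> j = (if j = i then \<phi> else if j \<in> J then g j else ?h j (n $ j))" for \<phi> j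
  define p where "p \<phi> = (\<lambda>x::real^'d. \<Prod>j\<in>UNIV. f \<phi> j (x $ j))" for \<phi>
  define R where "R x = (\<Prod>j\<in>UNIV - {i}. (if j \<in> J then g j else ?h j (n $ j)) (x $ j))" for x
  have p_eq: "p \<phi> x = \<phi> (x $ i) * R x" for \<phi> x
  proof -
    have "p \<phi> x = f \<phi> i (x $ i) * (\<Prod>j\<in>UNIV - {i}. f \<phi> j (x $ j))"
      unfolding p_def by (rule prod.remove) auto
    then show ?thesis by (simp add: R_def f_def)
  qed
  have sq: "f \<phi> j \<in> sq_int lborel" if "\<phi> \<in> sq_int lborel" for \<phi> j
    unfolding f_def using that sq_closure_sq_int[OF g] \<alpha>_pos hermite_fun1_sq_int by simp
  have psq: "p \<phi> \<in> sq_int lborel" if "\<phi> \<in> sq_int lborel" for \<phi>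
    unfolding p_def by (intro sq_int_vec_prod sq that)
  \<comment> \<open>Squared norm of the factors other than i. It may be 0, hence the tolerance e /
    (K + 1) below.\<close>
  define K where "K = (\<Prod>j\<in>UNIV - {i}. \<integral>t. ((if j \<in> J then g j else ?h j (n $ j)) t)\<^sup>2 \<partial>lborel)"
  have K: "(\<integral>x. (p \<phi> x)\<^sup>2 \<partial>lborel) = (\<integral>t. (\<phi> t)\<^sup>2 \<partial>lborel) * K" if "\<phi> \<in> sq_int lborel" for \<phi>
  proof -
    have "(\<integral>x. (p \<phi> x)\<^sup>2 \<partial>lborel) = (\<Prod>j\<in>UNIV. \<integral>t. (f \<phi> j t)\<^sup>2 \<partial>lborel)"
      unfolding p_def by (intro sq_int_vec_prod sq that)
    also have "\<dots> = (\<integral>t. (f \<phi> i t)\<^sup>2 \<partial>lborel) * (\<Prod>j\<in>UNIV - {i}. \<integral>t. (f \<phi> j t)\<^sup>2 \<partial>lborel)"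
      by (rule prod.remove) auto
    finally show ?thesis by (simp add: K_def f_def)
  qed
  have K0: "0 \<le> K" unfolding K_def by (intro prod_nonneg) auto
  have "p (g i) \<in> dense"
  proof (rule closure_approx)
    show "p (g i) \<in> sq_int lborel" by (intro psq sq_closure_sq_int[OF g])
    fix e :: real assume e: "0 < e"
    then obtain s where s: "s \<in> lin_span (?h i)" "(\<integral>t. (g i t - s t)\<^sup>2 \<partial>lborel) < e / (K + 1)"
      using sq_closureD[OF g[of i], of "e / (K + 1)"] K0 by auto
    obtain F c where F: "s = (\<lambda>t. \<Sum>m\<in>F. c m * ?h i m t)" by (rule lin_spanE[OF s(1)])
    have "p (?h i m) \<in> dense" for m
    proof -
      \<comment> \<open>A Hermite function in direction i amounts to another i-th entry of n, which
        the induction hypothesis permits because n is arbitrary there.\<close>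
      have "p (?h i m) = (\<lambda>x. \<Prod>j\<in>UNIV. (if j \<in> J then g j else ?h j ((\<chi> j. if j = i then m else n $ j) $ j)) (x $ j))"
        unfolding p_def f_def using insert(2) by (auto simp: fun_eq_iff intro!: prod.cong)
      then show ?thesis using insert(3) by simp
    qed
    then have "(\<lambda>x. \<Sum>m\<in>F. c m * p (?h i m) x) \<in> dense"
      by (intro closure_sum closure_cmult)
    also have "(\<lambda>x. \<Sum>m\<in>F. c m * p (?h i m) x) = p s"
      by (simp add: fun_eq_iff p_eq F sum_distrib_right mult.assoc)
    finally have ps: "p s \<in> dense" .
    have ssq: "s \<in> sq_int lborel"
      unfolding F using \<alpha>_pos by (intro sq_int_sum sq_int_cmult hermite_fun1_sq_int)
    have "(\<integral>x. (p (g i) x - p s x)\<^sup>2 \<partial>lborel) = (\<integral>x. (p (\<lambda>t. g i t - s t) x)\<^sup>2 \<partial>lborel)"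
      by (simp add: p_eq left_diff_distrib)
    also have "\<dots> = (\<integral>t. (g i t - s t)\<^sup>2 \<partial>lborel) * K"
      by (intro K sq_int_diff ssq sq_closure_sq_int[OF g])
    also have "\<dots> \<le> (\<integral>t. (g i t - s t)\<^sup>2 \<partial>lborel) * (K + 1)"
      by (intro mult_left_mono) auto
    also have "\<dots> < e" using s(2) K0 by (simp add: pos_less_divide_eq)
    finally show "\<exists>h\<in>dense. (\<integral>x. (p (g i) x - h x)\<^sup>2 \<partial>lborel) < e"
      by (intro bexI[OF _ ps])
  qed
  moreover have "p (g i) = (\<lambda>x. \<Prod>j\<in>UNIV. (if j \<in> insert i J then g j else ?h j (n $ j)) (x $ j))"
    unfolding p_def f_def by (auto simp: fun_eq_iff intro!: prod.cong)
  ultimately show ?case by simp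
qed

lemma indicator_box_dense: "indicator (box s t) \<in> dense"
proof (cases "\<forall>j. s $ j < t $ j")
  case True
  have "(\<lambda>x. \<Prod>j\<in>UNIV. (if j \<in> UNIV then indicator {s $ j<..<t $ j} else hermite_fun1 (\<alpha> $ j) (\<beta> $ j) ((0::nat^'d) $ j)) (x $ j)) \<in> dense"
  proof (rule prod_dense_aux)
    show "indicator {s $ j<..<t $ j} \<in> sq_closure lborel (lin_span (hermite_fun1 (\<alpha> $ j) (\<beta> $ j)))"
      for j using True \<alpha>_pos by (intro hermite1.indicator_interval_dense hermite1.intro) auto
  qed
  also have "(\<lambda>x. \<Prod>j\<in>UNIV. (if j \<in> UNIV then indicator {s $ j<..<t $ j} else hermite_fun1 (\<alpha> $ j) (\<beta> $ j) ((0::nat^'d) $ j)) (x $ j)) = (indicator (box s t) :: _ \<Rightarrow> real)"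
    by (rule ext) (auto simp: indicator_def mem_box_cart intro!: prod.neutral)
  finally show ?thesis .
next
  case False
  then have "box s t = {}" by (auto simp: mem_box_cart) (meson less_trans)
  then show ?thesis using incl[OF zero] by (simp add: indicator_def[abs_def])
qed

text \<open>Dynkin's argument, as open boxes are a generator stable under intersection. Intersecting
  with one fixed box keeps complements and countable unions square integrable.\<close>

lemma indicator_borel_dense:
  assumes "A \<in> sets borel"
  shows "indicator (A \<inter> box s t) \<in> dense"
proof -
  have bsq: "indicator (box s t) \<in> sq_int lborel"
    by (rule sq_closure_sq_int[OF indicator_box_dense])
  let ?G = "range (\<lambda>(a, b). box a b :: (real^'d) set)"
  have int: "Int_stable ?G"
    by (auto simp: Int_stable_def box_Int_box)
  have sub: "?G \<subseteq> Pow UNIV" by auto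
  have borel: "sets (borel :: (real^'d) measure) = sigma_sets UNIV ?G"
    unfolding borel_eq_box by simp
  have A: "A \<in> sigma_sets UNIV ?G" using assms borel by simp
  show ?thesis using int sub A
  proof (induction rule: sigma_sets_induct_disjoint)
    case (basic A)
    then show ?case using indicator_box_dense by (auto simp: box_Int_box)
  next
    case empty
    then show ?case using incl[OF zero] by (simp add: indicator_def[abs_def])
  next
    case (compl A)
    have "(\<lambda>x. indicator (box s t) x - indicator (A \<inter> box s t) x) \<in> dense"
      by (intro closure_diff indicator_box_dense compl)
    also have "(\<lambda>x. indicator (box s t) x - indicator (A \<inter> box s t) x) = (indicator ((UNIV - A) \<inter> box s t) :: _ \<Rightarrow> real)"
      by (auto simp: fun_eq_iff indicator_def)
    finally show ?case .
  next
    case (union A)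
    have A: "A i \<in> sets borel" for i using union(2) borel by auto
    show ?case
    proof (rule closure_dominated_limit[OF _ _ bsq])
      show "(\<lambda>x. \<Sum>i<n. indicator (A i \<inter> box s t) x) \<in> dense" for n :: nat
        by (intro closure_sum union)
      have disj: "disjoint_family_on (\<lambda>i. A i \<inter> box s t) {..<n}" for n :: nat
        using union(1) by (auto simp: disjoint_family_on_def)
      have eq: "(\<Sum>i<n. indicator (A i \<inter> box s t) x) = (indicator (\<Union>i<n. A i \<inter> box s t) x :: real)" for n :: nat and x
        by (rule indicator_UN_disjoint[symmetric]) (use disj in auto)
      show "\<bar>\<Sum>i<n. indicator (A i \<inter> box s t) x\<bar> \<le> \<bar>indicator (box s t) x :: real\<bar>" for n :: nat and x
        unfolding eq by (auto simp: indicator_def)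
      show "(\<lambda>n. \<Sum>i<n. indicator (A i \<inter> box s t) x) \<longlonglongrightarrow> (indicator ((\<Union>i. A i) \<inter> box s t) x :: real)" for x
        unfolding eq Int_UN_distrib2 Int_UN_distrib[symmetric] UN_extend_simps by (rule LIMSEQ_indicator_UN)
      show "(indicator ((\<Union>i. A i) \<inter> box s t) :: _ \<Rightarrow> real) \<in> borel_measurable lborel"
        using A by measurable
    qed
  qed
qed

text \<open>Simple functions with |F i| <= 2 |f|, cut to boxes that exhaust the space, converge to f
  below the bound 2 |f|.\<close>

lemma dense_eq_sq_int: "dense = sq_int lborel"
proof
  show "dense \<subseteq> sq_int lborel" by (auto intro: sq_closure_sq_int)
  show "sq_int lborel \<subseteq> dense"
  proof
    fix f :: "real^'d \<Rightarrow> real" assume f: "f \<in> sq_int lborel"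
    obtain F where F: "\<And>i. simple_function lborel (F i)" "\<And>x. (\<lambda>i. F i x) \<longlonglongrightarrow> f x"
      "\<And>i x. dist (F i x) 0 \<le> 2 * dist (f x) 0"
      using borel_measurable_implies_sequence_metric[OF sq_int_measurable[OF f], of 0] by auto
    let ?B = "\<lambda>i::nat. box (\<chi> j::'d. - real i) (\<chi> j. real i)"
    have B: "x \<in> ?B i \<longleftrightarrow> (\<forall>j. \<bar>x $ j\<bar> < real i)" for i x
      by (auto simp: mem_box_cart abs_less_iff minus_less_iff)
    show "f \<in> dense"
    proof (rule closure_dominated_limit)
      show "(\<lambda>x. F i x * indicator (?B i) x) \<in> dense" for i
      proof -
        have fin: "finite (range (F i))" using F(1)[of i] by (simp add: simple_function_def)
        have "(\<lambda>x. \<Sum>y\<in>range (F i). y * indicator ((F i -` {y}) \<inter> ?B i) x) \<in> dense"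
          using F(1)[of i] by (intro closure_sum closure_cmult indicator_borel_dense) (auto simp: simple_function_def)
        also have "(\<lambda>x. \<Sum>y\<in>range (F i). y * indicator ((F i -` {y}) \<inter> ?B i) x) = (\<lambda>x. F i x * indicator (?B i) x)"
        proof
          fix x
          have "(\<Sum>y\<in>range (F i). y * indicator ((F i -` {y}) \<inter> ?B i) x)
             = (\<Sum>y\<in>range (F i). if y = F i x then F i x * indicator (?B i) x else 0)"
            by (intro sum.cong) (auto simp: indicator_def)
          then show "(\<Sum>y\<in>range (F i). y * indicator ((F i -` {y}) \<inter> ?B i) x) = F i x * indicator (?B i) x"
            using fin by simp
        qed
        finally show ?thesis .
      qed
      show "f \<in> borel_measurable lborel" by (rule sq_int_measurable[OF f])
      show "(\<lambda>x. 2 * f x) \<in> sq_int lborel" by (intro sq_int_cmult f)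
      show "\<bar>F i x * indicator (?B i) x\<bar> \<le> \<bar>2 * f x\<bar>" for i x
        using F(3)[of i x] by (simp add: indicator_def abs_mult)
      show "(\<lambda>i. F i x * indicator (?B i) x) \<longlonglongrightarrow> f x" for x
      proof -
        obtain N :: nat where N: "(\<Sum>j\<in>UNIV. \<bar>x $ j\<bar>) < real N" using reals_Archimedean2 by blast
        have "\<forall>\<^sub>F i in sequentially. indicator (?B i) x = (1::real)"
          using eventually_ge_at_top[of N]
        proof eventually_elim
          case (elim i)
          have "\<bar>x $ j\<bar> < real i" for j
          proof -
            have "\<bar>x $ j\<bar> \<le> (\<Sum>j\<in>UNIV. \<bar>x $ j\<bar>)" by (rule member_le_sum) auto
            then show ?thesis using N elim by linarith
          qed
          then show ?case using B by (simp add: indicator_def)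
        qed
        from tendsto_mult[OF F(2)[of x] tendsto_eventually[OF this]] show ?thesis by simp
      qed
    qed
  qed
qed

text \<open>Completing the square: orthonormality leaves a part independent of c and the squared
  distance of c from the Hermite coefficients. Taking c equal to them yields Bessel's inequality;
  discarding the last sum, which is nonnegative, yields \<open>parseval_le\<close>.\<close>

lemma integral_sq_diff_sum:
  assumes f: "f \<in> sq_int lborel" and F: "finite F"
  shows "(\<integral>x. (f x - (\<Sum>n\<in>F. c n * hermite_fun \<alpha> \<beta> n x))\<^sup>2 \<partial>lborel)
    = (\<integral>x. (f x)\<^sup>2 \<partial>lborel) - (\<Sum>n\<in>F. (hermite_coeff \<alpha> \<beta> f n)\<^sup>2) + (\<Sum>n\<in>F. (c n - hermite_coeff \<alpha> \<beta> f n)\<^sup>2)"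
proof -
  let ?h = "hermite_fun \<alpha> \<beta>"
  have int: "integrable lborel (\<lambda>x. f x * ?h n x)" "integrable lborel (\<lambda>x. ?h n x * ?h m x)"
    "integrable lborel (\<lambda>x. (f x)\<^sup>2)" for n m
    using f by (auto intro: sq_int_mult_integrable hermite_fun_sq_int sq_int_integrable)
  have "(f x - (\<Sum>n\<in>F. c n * ?h n x))\<^sup>2 = (f x)\<^sup>2 - (\<Sum>n\<in>F. 2 * c n * (f x * ?h n x))
     + (\<Sum>n\<in>F. \<Sum>m\<in>F. c n * c m * (?h n x * ?h m x))" for x
    by (simp add: power2_diff power2_eq_square[of "sum _ _"] sum_product sum_distrib_left mult_ac)
  then have "(\<integral>x. (f x - (\<Sum>n\<in>F. c n * ?h n x))\<^sup>2 \<partial>lborel)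
    = (\<integral>x. (f x)\<^sup>2 \<partial>lborel) - (\<Sum>n\<in>F. 2 * c n * hermite_coeff \<alpha> \<beta> f n)
     + (\<Sum>n\<in>F. \<Sum>m\<in>F. c n * c m * (if n = m then 1 else 0))"
    by (simp add: int integral_sum hermite_fun_orthonormal hermite_coeff_def)
  also have "(\<Sum>n\<in>F. \<Sum>m\<in>F. c n * c m * (if n = m then 1 else 0)) = (\<Sum>n\<in>F. (c n)\<^sup>2)"
    using F by (simp add: if_distrib[of "\<lambda>t. _ * t"] power2_eq_square cong: if_cong)
  finally show ?thesis
    by (simp add: power2_diff sum.distrib sum_subtractf)
qed

lemma bessel:
  assumes f: "f \<in> sq_int lborel" and F: "finite F"
  shows "(\<Sum>n\<in>F. (hermite_coeff \<alpha> \<beta> f n)\<^sup>2) \<le> (\<integral>x. (f x)\<^sup>2 \<partial>lborel)"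
proof -
  have "0 \<le> (\<integral>x. (f x - (\<Sum>n\<in>F. hermite_coeff \<alpha> \<beta> f n * hermite_fun \<alpha> \<beta> n x))\<^sup>2 \<partial>lborel)"
    by simp
  then show ?thesis unfolding integral_sq_diff_sum[OF assms] by simp
qed

text \<open>By density some finite combination lies within squared distance e of f, and the identity
  above then bounds the integral by e plus a finite sum of squared coefficients. As bounds on finite
  sums suffice, infinite series never occur.\<close>

lemma parseval_le:
  assumes f: "f \<in> sq_int lborel"
    and B: "\<And>F. finite F \<Longrightarrow> (\<Sum>n\<in>F. (hermite_coeff \<alpha> \<beta> f n)\<^sup>2) \<le> B"
  shows "(\<integral>x. (f x)\<^sup>2 \<partial>lborel) \<le> B"
proof (rule field_le_epsilon)
  fix e :: real assume "0 < e"
  then obtain s where s: "s \<in> lin_span (hermite_fun \<alpha> \<beta>)" "(\<integral>x. (f x - s x)\<^sup>2 \<partial>lborel) < e"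
    using sq_closureD[of f lborel] f dense_eq_sq_int by blast
  obtain F c where F: "finite F" "s = (\<lambda>x. \<Sum>n\<in>F. c n * hermite_fun \<alpha> \<beta> n x)"
    by (rule lin_spanE[OF s(1)])
  have "0 \<le> (\<Sum>n\<in>F. (c n - hermite_coeff \<alpha> \<beta> f n)\<^sup>2)" by (intro sum_nonneg) auto
  then show "(\<integral>x. (f x)\<^sup>2 \<partial>lborel) \<le> B + e"
    using s(2) B[OF F(1)] integral_sq_diff_sum[OF f F(1), of c] unfolding F(2) by linarith
qed

end

section \<open>Hermite coefficients of weak derivatives\<close>

text \<open>The classical flat function exp (- 1 / x), with a polynomial in 1 / x in front so that
  the family is closed under differentiation.\<close>

definition flat :: "real poly \<Rightarrow> real \<Rightarrow> real" where
  "flat p x = (if 0 < x then poly p (1 / x) * exp (- (1 / x)) else 0)"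

lemma poly_exp_tendsto_0: "((\<lambda>y::real. poly p y * exp (- y)) \<longlongrightarrow> 0) at_top"
proof -
  have "((\<lambda>y. \<Sum>k\<le>degree p. coeff p k * (y ^ k / exp y)) \<longlongrightarrow> (\<Sum>k\<le>degree p. coeff p k * 0)) at_top"
    by (intro tendsto_intros tendsto_power_div_exp_0)
  then show ?thesis
    by (simp add: poly_altdef sum_distrib_right exp_minus divide_inverse mult.assoc)
qed

text \<open>For x > 0 the chain rule yields 1 / x^2 from both factors, hence the operator p to X^2
  (p - p').\<close>

lemma DERIV_flat: "(flat p has_real_derivative flat (monom 1 2 * (p - pderiv p)) x) (at x)"
proof -
  consider "0 < x" | "x < 0" | "x = 0" by linarith
  then show ?thesis
  proof cases
    case 1
    let ?f = "\<lambda>x. poly p (1 / x) * exp (- (1 / x))"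
    have "((\<lambda>x. poly p (1 / x)) has_real_derivative poly (pderiv p) (1 / x) * (- 1 / x\<^sup>2)) (at x)"
      by (rule DERIV_chain2[OF poly_DERIV])
         (use 1 in \<open>auto intro!: derivative_eq_intros simp: power2_eq_square\<close>)
    moreover have "((\<lambda>x. exp (- (1 / x))) has_real_derivative exp (- (1 / x)) * (1 / x\<^sup>2)) (at x)"
      using 1 by (auto intro!: derivative_eq_intros simp: power2_eq_square)
    ultimately have "(?f has_real_derivative
        poly (pderiv p) (1 / x) * (- 1 / x\<^sup>2) * exp (- (1 / x)) + exp (- (1 / x)) * (1 / x\<^sup>2) * poly p (1 / x)) (at x)"
      by (rule DERIV_mult)
    also have "poly (pderiv p) (1 / x) * (- 1 / x\<^sup>2) * exp (- (1 / x)) + exp (- (1 / x)) * (1 / x\<^sup>2) * poly p (1 / x)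
       = flat (monom 1 2 * (p - pderiv p)) x"
      using 1 by (simp add: flat_def poly_monom power_one_over algebra_simps)
    finally show ?thesis
      by (rule has_field_derivative_transform_within_open[of _ _ _ "{0<..}"]) (use 1 in \<open>auto simp: flat_def\<close>)
  next
    case 2
    have "((\<lambda>x. 0) has_real_derivative flat (monom 1 2 * (p - pderiv p)) x) (at x)"
      using 2 by (simp add: flat_def)
    then show ?thesis
      by (rule has_field_derivative_transform_within_open[of _ _ _ "{..<0}"]) (use 2 in \<open>auto simp: flat_def\<close>)
  next
    case 3
    have R: "((\<lambda>h. (flat p (0 + h) - flat p 0) / h) \<longlongrightarrow> 0) (at_right 0)"
    proof (rule Lim_transform_eventually)
      \<comment> \<open>With y = 1 / h the difference quotient at 0 is y p(y) exp (- y);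
        \<open>pCons 0 p\<close> supplies the extra factor y.\<close>
      show "((\<lambda>h. poly (pCons 0 p) (inverse h) * exp (- inverse h)) \<longlongrightarrow> 0) (at_right 0)"
        by (rule filterlim_compose[OF poly_exp_tendsto_0 filterlim_inverse_at_top_right])
      show "\<forall>\<^sub>F h in at_right 0. poly (pCons 0 p) (inverse h) * exp (- inverse h) = (flat p (0 + h) - flat p 0) / h"
        using eventually_at_right_less[of 0] by eventually_elim (simp add: flat_def divide_inverse)
    qed
    have L: "((\<lambda>h. (flat p (0 + h) - flat p 0) / h) \<longlongrightarrow> 0) (at_left 0)"
    proof (rule Lim_transform_eventually)
      show "((\<lambda>h. 0) \<longlongrightarrow> 0) (at_left (0::real))" by simp
      have "\<forall>\<^sub>F h in at_left (0::real). h < 0" by (simp add: eventually_at_filter)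
      then show "\<forall>\<^sub>F h in at_left 0. 0 = (flat p (0 + h) - flat p 0) / h"
        by eventually_elim (simp add: flat_def)
    qed
    have "(\<lambda>h. (flat p (0 + h) - flat p 0) / h) \<midarrow>0\<rightarrow> 0"
      by (rule filterlim_split_at[OF L R])
    then show ?thesis using 3 by (simp add: DERIV_def flat_def)
  qed
qed

lemma sum_choose_Suc:
  fixes t :: "nat \<Rightarrow> real"
  shows "(\<Sum>i\<le>n. real (n choose i) * t (Suc i)) + (\<Sum>i\<le>n. real (n choose i) * t i)
    = (\<Sum>i\<le>Suc n. real (Suc n choose i) * t i)"
proof -
  have "(\<Sum>i\<le>n. real (n choose i) * t i) = (\<Sum>i\<le>Suc n. real (n choose i) * t i)" by simp
  also have "\<dots> = t 0 + (\<Sum>i\<le>n. real (n choose Suc i) * t (Suc i))"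
    by (subst sum.atMost_Suc_shift) simp
  finally show ?thesis
    by (subst sum.atMost_Suc_shift) (simp add: sum.distrib algebra_simps)
qed

text \<open>If \<open>X i\<close> and \<open>G i\<close> are successive derivatives, this is
  Leibniz' formula for the n-th derivative of the product of \<open>X 0\<close> and
  \<open>G 0\<close>.\<close>

definition leibniz :: "(nat \<Rightarrow> real \<Rightarrow> real) \<Rightarrow> (nat \<Rightarrow> real \<Rightarrow> real) \<Rightarrow> nat \<Rightarrow> real \<Rightarrow> real" where
  "leibniz X G n x = (\<Sum>i\<le>n. real (n choose i) * (X i x * G (n - i) x))"

(* With s = 1 and w = 0 this is the usual product rule, with s = -1 the one for the operator w - d/dx. *)
lemma DERIV_leibniz:
  assumes X: "\<And>i x. (X i has_real_derivative s * X (Suc i) x) (at x)"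
    and G: "\<And>i x. (G i has_real_derivative w x * G i x + s * G (Suc i) x) (at x)"
  shows "(leibniz X G n has_real_derivative w x * leibniz X G n x + s * leibniz X G (Suc n) x) (at x)"
proof -
  let ?t = "\<lambda>i. X i x * G (Suc n - i) x"
  have "(leibniz X G n has_real_derivative
    (\<Sum>i\<le>n. real (n choose i) * (s * X (Suc i) x * G (n - i) x + (w x * G (n - i) x + s * G (Suc (n - i)) x) * X i x))) (at x)"
    unfolding leibniz_def[abs_def] by (intro DERIV_sum DERIV_cmult DERIV_mult X G)
  also have "(\<Sum>i\<le>n. real (n choose i) * (s * X (Suc i) x * G (n - i) x + (w x * G (n - i) x + s * G (Suc (n - i)) x) * X i x))
    = (\<Sum>i\<le>n. w x * (real (n choose i) * (X i x * G (n - i) x)) +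
        s * (real (n choose i) * ?t (Suc i) + real (n choose i) * ?t i))"
    by (intro sum.cong) (auto simp: Suc_diff_le algebra_simps)
  also have "\<dots> = w x * leibniz X G n x + s * leibniz X G (Suc n) x"
    unfolding leibniz_def sum.distrib sum_choose_Suc[of n ?t, symmetric] by (simp only: sum.distrib flip: sum_distrib_left)
  finally show ?thesis .
qed

text \<open>A flat function of 1 + x times one of 1 - x, hence zero outside (-1, 1). All derivatives
  are delivered as one sequence, since the cut-off Hermite functions are differentiated through
  Leibniz' formula. The value at 0 only has to be nonzero: it cancels later.\<close>

lemma bump_exists:
  obtains \<Psi> :: "nat \<Rightarrow> real \<Rightarrow> real" where
    "\<And>i x. (\<Psi> i has_real_derivative \<Psi> (Suc i) x) (at x)"
    "\<And>i x. 1 \<le> \<bar>x\<bar> \<Longrightarrow> \<Psi> i x = 0" "\<Psi> 0 0 \<noteq> 0"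
proof -
  define p where "p i = ((\<lambda>p. monom 1 2 * (p - pderiv p)) ^^ i) (1 :: real poly)" for i
  define A where "A i x = flat (p i) (1 + x)" for i x
  define B where "B i x = (-1) ^ i * flat (p i) (1 - x)" for i x
  have D: "(flat (p i) has_real_derivative flat (p (Suc i)) x) (at x)" for i x
    using DERIV_flat[of "p i" x] by (simp add: p_def)
  have A: "(A i has_real_derivative A (Suc i) x) (at x)" for i x
  proof -
    have "((\<lambda>x. 1 + x) has_real_derivative 1) (at x)" by (auto intro!: derivative_eq_intros)
    from DERIV_chain2[OF D this] show ?thesis by (simp add: A_def[abs_def])
  qed
  have B: "(B i has_real_derivative B (Suc i) x) (at x)" for i x
  proof -
    have "((\<lambda>x. 1 - x) has_real_derivative -1) (at x)" by (auto intro!: derivative_eq_intros)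
    from DERIV_cmult[OF DERIV_chain2[OF D this], of "(-1) ^ i"] show ?thesis by (simp add: B_def[abs_def])
  qed
  have 1: "(leibniz A B i has_real_derivative leibniz A B (Suc i) x) (at x)" for i x
    using DERIV_leibniz[of A 1 B "\<lambda>_. 0"] A B by simp
  have 2: "leibniz A B i x = 0" if "1 \<le> \<bar>x\<bar>" for i x
  proof -
    have "A n x * B m x = 0" for n m
      using that by (auto simp: A_def B_def flat_def abs_if split: if_splits)
    then show ?thesis unfolding leibniz_def by (intro sum.neutral) (simp del: mult_eq_0_iff)
  qed
  have 3: "leibniz A B 0 0 \<noteq> 0"
    by (simp add: leibniz_def A_def B_def flat_def p_def)
  from that[OF 1 2 3] show thesis .
qed

section \<open>Derivatives of products of functions of one coordinate\<close>

lemma vec_prod_has_derivative: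
  fixes f :: "'d::finite \<Rightarrow> real \<Rightarrow> real"
  assumes "\<And>j x. (f j has_real_derivative f' j x) (at x)"
  shows "((\<lambda>x::real^'d. \<Prod>j\<in>UNIV. f j (x $ j)) has_derivative
    (\<lambda>h. \<Sum>i\<in>UNIV. (h $ i * f' i (x $ i)) * (\<Prod>j\<in>UNIV - {i}. f j (x $ j)))) (at x)"
proof (rule has_derivative_prod)
  fix i
  have "((\<lambda>x::real^'d. x $ i) has_derivative (\<lambda>h. h $ i)) (at x)"
    by (rule bounded_linear_imp_has_derivative) (rule bounded_linear_vec_nth)
  then show "((\<lambda>x. f i (x $ i)) has_derivative (\<lambda>h. h $ i * f' i (x $ i))) (at x)"
    using has_derivative_compose[where g = "f i" and g' = "(*) (f' i (x $ i))" and f = "\<lambda>x. x $ i"]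
      assms[of i "x $ i", unfolded has_field_derivative_def]
    by (simp add: mult.commute)
qed

lemma partial_vec_prod:
  fixes f :: "'d::finite \<Rightarrow> real \<Rightarrow> real"
  assumes "\<And>j x. (f j has_real_derivative f' j x) (at x)"
  shows "partial i (\<lambda>x. \<Prod>j\<in>UNIV. f j (x $ j)) x = f' i (x $ i) * (\<Prod>j\<in>UNIV - {i}. f j (x $ j))"
  unfolding partial_def frechet_derivative_at[OF vec_prod_has_derivative[OF assms], symmetric]
  by (subst sum.remove[of _ i]) (auto simp: axis_def intro!: sum.neutral)

text \<open>\<open>F j i\<close> stands for the i-th derivative of the j-th factor, and every
  occurrence of a direction in the list advances one counter. The initial counters k are arbitrary
  so that the induction goes through.\<close>

lemma fold_partial_vec_prod:
  fixes F :: "'d::finite \<Rightarrow> nat \<Rightarrow> real \<Rightarrow> real"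
  assumes F: "\<And>j i x. (F j i has_real_derivative F j (Suc i) x) (at x)"
  shows "fold partial js (\<lambda>x. \<Prod>j\<in>UNIV. F j (k j) (x $ j)) = (\<lambda>x. \<Prod>j\<in>UNIV. F j (k j + count_list js j) (x $ j))"
proof (induction js arbitrary: k)
  case (Cons i js)
  have "partial i (\<lambda>x. \<Prod>j\<in>UNIV. F j (k j) (x $ j)) = (\<lambda>x. \<Prod>j\<in>UNIV. F j ((k(i := Suc (k i))) j) (x $ j))"
  proof
    fix x
    show "partial i (\<lambda>x. \<Prod>j\<in>UNIV. F j (k j) (x $ j)) x = (\<Prod>j\<in>UNIV. F j ((k(i := Suc (k i))) j) (x $ j))"
      by (subst partial_vec_prod[OF F]) (simp add: prod.remove[of UNIV i])
  qed
  then have "fold partial (i # js) (\<lambda>x. \<Prod>j\<in>UNIV. F j (k j) (x $ j))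
    = (\<lambda>x. \<Prod>j\<in>UNIV. F j ((k(i := Suc (k i))) j + count_list js j) (x $ j))"
    by (simp only: fold_simps Cons)
  also have "\<dots> = (\<lambda>x. \<Prod>j\<in>UNIV. F j (k j + count_list (i # js) j) (x $ j))"
    by (intro ext prod.cong) auto
  finally show ?case .
qed simp

text \<open>The same counting for the adjoint operators: the hypothesis says that - d/dx + w maps
  \<open>F j i\<close> to \<open>F j (Suc i)\<close>.\<close>

lemma fold_D_adj_vec_prod:
  fixes F :: "'d::finite \<Rightarrow> nat \<Rightarrow> real \<Rightarrow> real"
  assumes F: "\<And>j i x. (F j i has_real_derivative (\<alpha> $ j)\<^sup>2 * (x - \<beta> $ j) * F j i x - F j (Suc i) x) (at x)"
  shows "fold (D_adj \<alpha> \<beta>) js (\<lambda>x. \<Prod>j\<in>UNIV. F j (k j) (x $ j)) = (\<lambda>x. \<Prod>j\<in>UNIV. F j (k j + count_list js j) (x $ j))"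
proof (induction js arbitrary: k)
  case (Cons i js)
  have "D_adj \<alpha> \<beta> i (\<lambda>x. \<Prod>j\<in>UNIV. F j (k j) (x $ j)) = (\<lambda>x. \<Prod>j\<in>UNIV. F j ((k(i := Suc (k i))) j) (x $ j))"
  proof
    fix x
    show "D_adj \<alpha> \<beta> i (\<lambda>x. \<Prod>j\<in>UNIV. F j (k j) (x $ j)) x = (\<Prod>j\<in>UNIV. F j ((k(i := Suc (k i))) j) (x $ j))"
      unfolding D_adj_def by (subst partial_vec_prod[OF F]) (simp add: prod.remove[of UNIV i] algebra_simps)
  qed
  then have "fold (D_adj \<alpha> \<beta>) (i # js) (\<lambda>x. \<Prod>j\<in>UNIV. F j (k j) (x $ j))
    = (\<lambda>x. \<Prod>j\<in>UNIV. F j ((k(i := Suc (k i))) j + count_list js j) (x $ j))"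
    by (simp only: fold_simps Cons)
  also have "\<dots> = (\<lambda>x. \<Prod>j\<in>UNIV. F j (k j + count_list (i # js) j) (x $ j))"
    by (intro ext prod.cong) auto
  finally show ?case .
qed simp

lemma vec_prod_test_fun:
  fixes F :: "'d::finite \<Rightarrow> nat \<Rightarrow> real \<Rightarrow> real"
  assumes F: "\<And>j i x. (F j i has_real_derivative F j (Suc i) x) (at x)"
    and supp: "\<And>j x. R \<le> \<bar>x\<bar> \<Longrightarrow> F j 0 x = 0"
  shows "(\<lambda>x. \<Prod>j\<in>UNIV. F j 0 (x $ j)) \<in> test_funs"
proof -
  have "{x::real^'d. (\<Prod>j\<in>UNIV. F j 0 (x $ j)) \<noteq> 0} \<subseteq> cbox (\<chi> j. - R) (\<chi> j. R)"
  proof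
    fix x :: "real^'d" assume "x \<in> {x. (\<Prod>j\<in>UNIV. F j 0 (x $ j)) \<noteq> 0}"
    then have "\<bar>x $ j\<bar> < R" for j using supp[of "x $ j" j] by (auto simp: not_le[symmetric])
    then have "- R \<le> x $ j \<and> x $ j \<le> R" for j using abs_le_iff[of "x $ j" R] less_imp_le by fastforce
    then show "x \<in> cbox (\<chi> j. - R) (\<chi> j. R)" by (simp add: mem_box_cart)
  qed
  then have "bounded {x::real^'d. (\<Prod>j\<in>UNIV. F j 0 (x $ j)) \<noteq> 0}"
    using bounded_subset bounded_cbox by blast
  moreover have "fold partial js (\<lambda>x. \<Prod>j\<in>UNIV. F j 0 (x $ j)) differentiable (at x)" for js x
    unfolding fold_partial_vec_prod[where F = F and k = "\<lambda>_. 0", OF F] differentiable_def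
    by (intro exI, rule vec_prod_has_derivative) (rule F)
  ultimately show ?thesis by (simp add: test_funs_def)
qed

lemma hermite_fun1_smooth:
  obtains H where "H 0 = hermite_fun1 a b n" "\<And>i x. (H i has_real_derivative H (Suc i) x) (at x)"
proof -
  obtain q where q: "hermite_fun1 a b n = (\<lambda>x. poly q x * exp (- (1 / 2) * a\<^sup>2 * (x - b)\<^sup>2))"
    by (rule hermite_fun1_poly_gauss)
  define T where "T p = pderiv p - [:- a\<^sup>2 * b, a\<^sup>2:] * p" for p :: "real poly"
  define H where "H i = (\<lambda>x. poly ((T ^^ i) q) x * exp (- (1 / 2) * a\<^sup>2 * (x - b)\<^sup>2))" for i
  have "((\<lambda>x. poly p x * exp (- (1 / 2) * a\<^sup>2 * (x - b)\<^sup>2)) has_real_derivative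
      poly (T p) x * exp (- (1 / 2) * a\<^sup>2 * (x - b)\<^sup>2)) (at x)" for p x
    unfolding T_def
    by (rule derivative_eq_intros poly_DERIV refl | simp add: algebra_simps)+
  then show thesis
    by (intro that[of H]) (simp_all add: H_def q)
qed

text \<open>The factor picked up when - d/dx + a^2 (x - b) is applied k times to the n-th Hermite
  function, with a multiple of the (n + k)-th as result.\<close>

definition raise_coeff :: "real \<Rightarrow> nat \<Rightarrow> nat \<Rightarrow> real" where
  "raise_coeff a n k = (\<Prod>i<k. a * sqrt (2 * real (Suc (n + i))))"

text \<open>\<open>has_weak_D\<close> quantifies over all lists with the prescribed counts and says
  nothing unless there is one.\<close>

lemma exists_count_list: "\<exists>js. \<forall>j. count_list js j = k (j :: 'd::finite)"
proof -
  obtain js where "mset js = (\<Sum>j\<in>UNIV. replicate_mset (k j) j)" using ex_mset by blast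
  then have "count (mset js) j = k j" for j
    by (simp add: count_sum)
  then show ?thesis by (metis count_mset)
qed

context hermite_vec
begin

(* The weak derivative is tested against cut-off Hermite functions, letting the cut-off tend to
   the constant Psi 0 0. *)
lemma hermite_coeff_weak_D:
  assumes u: "u \<in> sq_int lborel" and v: "v \<in> sq_int lborel" and D: "has_weak_D \<alpha> \<beta> k u v"
  shows "hermite_coeff \<alpha> \<beta> v n = (\<Prod>j\<in>UNIV. raise_coeff (\<alpha> $ j) (n $ j) (k $ j)) * hermite_coeff \<alpha> \<beta> u (n + k)"
proof -
  let ?h = "\<lambda>j. hermite_fun1 (\<alpha> $ j) (\<beta> $ j)"
  obtain \<Psi> :: "nat \<Rightarrow> real \<Rightarrow> real" where \<Psi>: "\<And>i x. (\<Psi> i has_real_derivative \<Psi> (Suc i) x) (at x)"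
    "\<And>i x. 1 \<le> \<bar>x\<bar> \<Longrightarrow> \<Psi> i x = 0" "\<Psi> 0 0 \<noteq> 0"
    using bump_exists by blast
  have \<Psi>cont: "isCont (\<Psi> i) x" for i x using \<Psi>(1) by (rule DERIV_isCont)
  have "\<exists>M. \<forall>x. \<bar>\<Psi> i x\<bar> \<le> M" for i
  proof -
    have "compact (\<Psi> i ` {-1..1})"
      by (intro compact_continuous_image continuous_at_imp_continuous_on) (auto intro: \<Psi>cont)
    then obtain M where M: "\<And>x. x \<in> {-1..1} \<Longrightarrow> \<bar>\<Psi> i x\<bar> \<le> M"
      using compact_imp_bounded by (force simp: bounded_iff)
    have "\<bar>\<Psi> i x\<bar> \<le> max 0 M" for x
      using M[of x] \<Psi>(2)[of x i] by (cases "\<bar>x\<bar> \<le> 1") (auto simp: abs_le_iff le_max_iff_disj)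
    then show ?thesis by blast
  qed
  then obtain M where M: "\<And>i x. \<bar>\<Psi> i x\<bar> \<le> M i" by metis
  \<comment> \<open>The i-fold adjoint operator applied to the Hermite function with index
    n_j.\<close>
  define G where "G j i = (\<lambda>x. raise_coeff (\<alpha> $ j) (n $ j) i * ?h j (n $ j + i) x)" for j i
  \<comment> \<open>For s = 1 the i-th derivative of the cut-off Psi (x / (r + 1)), for s = -1 the
    same with sign (-1)^i. The sign -1 fits the operator - d/dx + w; the sign 1 is for ordinary
    derivatives.\<close>
  define X where "X s r i x = (s / Suc r) ^ i * \<Psi> i (x / Suc r)" for s :: real and r i :: nat and x :: real
  have dX: "(X s r i has_real_derivative s * X s r (Suc i) x) (at x)" if "s * s = 1" for s r i x
  proof -
    have "((\<lambda>x. (s / Suc r) ^ i * \<Psi> i (x / Suc r)) has_real_derivative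
       (s / Suc r) ^ i * (\<Psi> (Suc i) (x / Suc r) * (1 / Suc r))) (at x)"
      by (intro DERIV_cmult DERIV_chain2[OF \<Psi>(1)]) (auto intro!: derivative_eq_intros)
    also have "(s / Suc r) ^ i * (\<Psi> (Suc i) (x / Suc r) * (1 / Suc r)) = (s * s) * ((s / Suc r) ^ i * (\<Psi> (Suc i) (x / Suc r) * (1 / Suc r)))"
      using that by simp
    also have "\<dots> = s * X s r (Suc i) x"
      by (simp add: X_def divide_inverse mult_ac)
    finally show ?thesis unfolding X_def .
  qed
  have dG: "(G j i has_real_derivative (\<alpha> $ j)\<^sup>2 * (x - \<beta> $ j) * G j i x - G j (Suc i) x) (at x)" for j i x
    using DERIV_cmult[OF hermite_fun1_raise[OF \<alpha>_pos, of j "\<beta> $ j" "n $ j + i" x], of "raise_coeff (\<alpha> $ j) (n $ j) i"]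
    by (simp add: G_def raise_coeff_def algebra_simps)
  define E where "E r j = leibniz (X (-1) r) (G j)" for r j
  have dE: "(E r j i has_real_derivative (\<alpha> $ j)\<^sup>2 * (x - \<beta> $ j) * E r j i x - E r j (Suc i) x) (at x)" for r j i x
    using DERIV_leibniz[of "X (-1) r" "-1" "G j" "\<lambda>x. (\<alpha> $ j)\<^sup>2 * (x - \<beta> $ j)" i x] dX[of "-1" r] dG
    by (simp add: E_def)
  \<comment> \<open>Membership in \<open>test_funs\<close> concerns ordinary derivatives, so a chain
    \<open>H\<close> of these replaces \<open>G\<close>; the two agree at index 0.\<close>
  have test: "(\<lambda>x. \<Prod>j\<in>UNIV. E r j 0 (x $ j)) \<in> test_funs" for r
  proof -
    have "\<exists>H. H 0 = G j 0 \<and> (\<forall>i x. (H i has_real_derivative H (Suc i) x) (at x))" for j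
      by (rule hermite_fun1_smooth[of "\<alpha> $ j" "\<beta> $ j" "n $ j"]) (auto simp: G_def raise_coeff_def)
    then obtain H where H: "\<And>j. H j 0 = G j 0" "\<And>j i x. (H j i has_real_derivative H j (Suc i) x) (at x)"
      by metis
    have "(\<lambda>x. \<Prod>j\<in>UNIV. leibniz (X 1 r) (H j) 0 (x $ j)) \<in> test_funs"
    proof (rule vec_prod_test_fun[where R = "Suc r"])
      show "(leibniz (X 1 r) (H j) i has_real_derivative leibniz (X 1 r) (H j) (Suc i) x) (at x)" for j i x
        using DERIV_leibniz[of "X 1 r" 1 "H j" "\<lambda>_. 0" i x] dX[of 1 r] H(2) by simp
      show "leibniz (X 1 r) (H j) 0 x = 0" if "real (Suc r) \<le> \<bar>x\<bar>" for j x
      proof -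
        have "\<Psi> 0 (x / real (Suc r)) = 0" using that by (intro \<Psi>(2)) (simp add: abs_divide)
        then show ?thesis by (simp add: leibniz_def X_def)
      qed
    qed
    also have "(\<lambda>x. \<Prod>j\<in>UNIV. leibniz (X 1 r) (H j) 0 (x $ j)) = (\<lambda>x. \<Prod>j\<in>UNIV. E r j 0 (x $ j))"
      by (simp add: E_def leibniz_def X_def H)
    finally show ?thesis .
  qed
  \<comment> \<open>Used twice: for v with l = 0 and for u with l = k.\<close>
  have lim: "(\<lambda>r. \<integral>x. f x * (\<Prod>j\<in>UNIV. E r j (l j) (x $ j)) \<partial>lborel) \<longlonglongrightarrow>
      (\<Prod>j\<in>(UNIV::'d set). \<Psi> 0 0) * ((\<Prod>j\<in>UNIV. raise_coeff (\<alpha> $ j) (n $ j) (l j)) * hermite_coeff \<alpha> \<beta> f (n + (\<chi> j. l j)))"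
    if f: "f \<in> sq_int lborel" for f l
  proof -
    note [measurable] = sq_int_measurable[OF f]
    have Gsq: "G j i \<in> sq_int lborel" for j i
      unfolding G_def using \<alpha>_pos by (intro sq_int_cmult hermite_fun1_sq_int)
    have [measurable]: "G j i \<in> borel_measurable borel" for j i
      unfolding G_def by measurable
    have Gabs: "(\<lambda>x. \<bar>G j i x\<bar>) \<in> sq_int lborel" for j i
      by (rule sq_int_bound[OF Gsq[of j i]]) simp_all
    \<comment> \<open>A bound uniform in r: the powers of 1 / (r + 1) in the cut-off are at most
      1.\<close>
    define W where "W j x = (\<Sum>i\<le>l j. real (l j choose i) * M i * \<bar>G j (l j - i) x\<bar>)" for j x
    have Wsq: "W j \<in> sq_int lborel" for j
      unfolding W_def[abs_def] by (intro sq_int_sum sq_int_cmult Gabs)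
    have EW: "\<bar>E r j (l j) x\<bar> \<le> W j x" for r j x
    proof -
      have "\<bar>X (-1) r i x\<bar> \<le> M i" for i
      proof -
        have "\<bar>(-1 / real (Suc r)) ^ i\<bar> \<le> 1"
          unfolding power_abs by (intro power_le_one) (auto simp: abs_divide)
        then have "\<bar>(-1 / real (Suc r)) ^ i\<bar> * \<bar>\<Psi> i (x / real (Suc r))\<bar> \<le> 1 * M i"
          by (intro mult_mono M) auto
        then show ?thesis by (simp only: X_def abs_mult mult_1)
      qed
      then have "\<bar>real (l j choose i) * (X (-1) r i x * G j (l j - i) x)\<bar> \<le> real (l j choose i) * M i * \<bar>G j (l j - i) x\<bar>" for i
        by (simp only: abs_mult abs_of_nat mult.assoc) (intro mult_left_mono mult_right_mono, auto)
      then show ?thesis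
        unfolding E_def leibniz_def W_def by (intro order_trans[OF sum_abs] sum_mono) auto
    qed
    have Elim: "(\<lambda>r. E r j (l j) x) \<longlonglongrightarrow> \<Psi> 0 0 * G j (l j) x" for j x
    proof -
      have inv: "(\<lambda>r. c / real (Suc r)) \<longlonglongrightarrow> 0" for c :: real
        using LIMSEQ_Suc[OF tendsto_mult[OF tendsto_const[of c] lim_1_over_n]] by simp
      \<comment> \<open>Every derivative of the cut-off costs a factor 1 / (r + 1), so all terms
        with i > 0 disappear; \<open>0 ^ 0 = 1\<close> keeps the term i = 0.\<close>
      have "(\<lambda>r. X (-1) r i x) \<longlonglongrightarrow> 0 ^ i * \<Psi> i 0" for i
        unfolding X_def by (intro tendsto_mult tendsto_power inv isCont_tendsto_compose[OF \<Psi>cont])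
      then have "(\<lambda>r. E r j (l j) x) \<longlonglongrightarrow> (\<Sum>i\<le>l j. real (l j choose i) * (0 ^ i * \<Psi> i 0 * G j (l j - i) x))"
        unfolding E_def leibniz_def by (intro tendsto_sum tendsto_mult tendsto_const)
      also have "(\<Sum>i\<le>l j. real (l j choose i) * (0 ^ i * \<Psi> i 0 * G j (l j - i) x)) = (\<Sum>i\<in>{0}. real (l j choose i) * (0 ^ i * \<Psi> i 0 * G j (l j - i) x))"
        by (rule sum.mono_neutral_right) auto
      finally show ?thesis by simp
    qed
    have [measurable]: "E r j i \<in> borel_measurable borel" for r j i
      using dE by (intro borel_measurable_continuous_onI continuous_at_imp_continuous_on) (blast intro: DERIV_isCont)
    have "(\<lambda>r. \<integral>x. f x * (\<Prod>j\<in>UNIV. E r j (l j) (x $ j)) \<partial>lborel) \<longlonglongrightarrow> (\<integral>x. f x * (\<Prod>j\<in>UNIV. \<Psi> 0 0 * G j (l j) (x $ j)) \<partial>lborel)"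
    proof (rule integral_dominated_convergence)
      show "integrable lborel (\<lambda>x. \<bar>f x * (\<Prod>j\<in>UNIV. W j (x $ j))\<bar>)"
        by (intro integrable_abs sq_int_mult_integrable f sq_int_vec_prod Wsq)
      show "AE x in lborel. norm (f x * (\<Prod>j\<in>UNIV. E r j (l j) (x $ j))) \<le> \<bar>f x * (\<Prod>j\<in>UNIV. W j (x $ j))\<bar>" for r
      proof (rule AE_I2)
        fix x :: "real^'d"
        have "(\<Prod>j\<in>UNIV. \<bar>E r j (l j) (x $ j)\<bar>) \<le> (\<Prod>j\<in>UNIV. W j (x $ j))"
          by (intro prod_mono) (auto intro: EW)
        also have "\<dots> \<le> \<bar>\<Prod>j\<in>UNIV. W j (x $ j)\<bar>" by simp
        finally show "norm (f x * (\<Prod>j\<in>UNIV. E r j (l j) (x $ j))) \<le> \<bar>f x * (\<Prod>j\<in>UNIV. W j (x $ j))\<bar>"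
          by (simp only: real_norm_def abs_mult abs_prod) (intro mult_left_mono, auto)
      qed
      show "AE x in lborel. (\<lambda>r. f x * (\<Prod>j\<in>UNIV. E r j (l j) (x $ j))) \<longlonglongrightarrow> f x * (\<Prod>j\<in>UNIV. \<Psi> 0 0 * G j (l j) (x $ j))"
        by (intro AE_I2 tendsto_mult tendsto_const tendsto_prod Elim)
    qed measurable
    also have "(\<integral>x. f x * (\<Prod>j\<in>UNIV. \<Psi> 0 0 * G j (l j) (x $ j)) \<partial>lborel)
      = (\<integral>x. ((\<Prod>j\<in>(UNIV::'d set). \<Psi> 0 0) * (\<Prod>j\<in>UNIV. raise_coeff (\<alpha> $ j) (n $ j) (l j))) * (f x * hermite_fun \<alpha> \<beta> (n + (\<chi> j. l j)) x) \<partial>lborel)"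
      by (simp only: G_def hermite_fun_def prod.distrib mult_ac vector_add_component vec_lambda_beta)
    also have "\<dots> = (\<Prod>j\<in>(UNIV::'d set). \<Psi> 0 0) * ((\<Prod>j\<in>UNIV. raise_coeff (\<alpha> $ j) (n $ j) (l j)) * hermite_coeff \<alpha> \<beta> f (n + (\<chi> j. l j)))"
      unfolding integral_mult_right_zero hermite_coeff_def by (simp only: mult.assoc)
    finally show ?thesis .
  qed
  obtain js where js: "\<And>j. count_list js j = k $ j"
    using exists_count_list[of "\<lambda>j. k $ j"] by blast
  have "(\<integral>x. v x * (\<Prod>j\<in>UNIV. E r j 0 (x $ j)) \<partial>lborel) = (\<integral>x. u x * (\<Prod>j\<in>UNIV. E r j (k $ j) (x $ j)) \<partial>lborel)" for r
    using D[unfolded has_weak_D_def, rule_format, OF js test] fold_D_adj_vec_prod[where F = "E r" and js = js and k = "\<lambda>_. 0", OF dE]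
    by (simp add: js)
  then have "(\<Prod>j\<in>(UNIV::'d set). \<Psi> 0 0) * ((\<Prod>j\<in>UNIV. raise_coeff (\<alpha> $ j) (n $ j) 0) * hermite_coeff \<alpha> \<beta> v (n + (\<chi> j. 0)))
     = (\<Prod>j\<in>(UNIV::'d set). \<Psi> 0 0) * ((\<Prod>j\<in>UNIV. raise_coeff (\<alpha> $ j) (n $ j) (k $ j)) * hermite_coeff \<alpha> \<beta> u (n + (\<chi> j. k $ j)))"
    using LIMSEQ_unique[OF lim[OF v, of "\<lambda>_. 0"]] lim[OF u, of "\<lambda>j. k $ j"] by simp
  moreover have "n + (\<chi> j. 0) = n" by (simp add: vec_eq_iff)
  ultimately show ?thesis using \<Psi>(3) by (simp add: raise_coeff_def)
qed

end

section \<open>Weak derivatives of Hermite functions\<close>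

lemma partial_eqI: "(f has_derivative f') (at x) \<Longrightarrow> partial j f x = f' (axis j 1)"
  unfolding partial_def using frechet_derivative_at by metis

lemma differentiable_has_derivative:
  "f differentiable (at x) \<Longrightarrow> (f has_derivative frechet_derivative f (at x)) (at x)"
  by (simp add: frechet_derivative_works)

lemma partial_DERIV_line:
  assumes "g differentiable (at (x + t *\<^sub>R axis j 1))"
  shows "((\<lambda>t. g (x + t *\<^sub>R axis j 1)) has_real_derivative partial j g (x + t *\<^sub>R axis j 1)) (at t)"
proof -
  let ?y = "x + t *\<^sub>R axis j 1"
  have "((\<lambda>t. x + t *\<^sub>R axis j 1) has_derivative (\<lambda>t. t *\<^sub>R axis j 1)) (at t)"
    by (auto intro!: derivative_eq_intros)
  from has_derivative_compose[OF this differentiable_has_derivative[OF assms]]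
  have "((\<lambda>t. g (x + t *\<^sub>R axis j 1)) has_derivative (\<lambda>t. frechet_derivative g (at ?y) (t *\<^sub>R axis j 1))) (at t)" .
  also have "(\<lambda>t. frechet_derivative g (at ?y) (t *\<^sub>R axis j 1)) = (*) (partial j g ?y)"
    using linear_frechet_derivative[OF assms]
    by (simp add: fun_eq_iff partial_def linear_cmul mult.commute)
  finally show ?thesis by (simp add: has_field_derivative_def)
qed

(* The difference quotients of g integrate to zero by translation invariance, and they converge
   dominatedly to the partial derivative. *)
lemma integral_partial_eq_0:
  fixes g :: "real^'d \<Rightarrow> real"
  assumes diff: "\<And>x. g differentiable (at x)" and cont: "continuous_on UNIV (partial j g)"
    and supp: "\<And>x. R < norm x \<Longrightarrow> g x = 0"
  shows "(\<integral>x. partial j g x \<partial>lborel) = 0"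
proof -
  let ?e = "axis j 1 :: real^'d"
  define dq where "dq n x = (g (x + (1 / Suc n) *\<^sub>R ?e) - g x) * Suc n" for n x
  have gcont: "continuous_on S g" for S
    using diff by (intro continuous_at_imp_continuous_on ballI differentiable_imp_continuous_within)
  have [measurable]: "g \<in> borel_measurable borel" by (intro borel_measurable_continuous_onI gcont)
  have gint: "integrable lborel g"
  proof -
    have "integrable lborel (\<lambda>x. indicator (cball 0 R) x *\<^sub>R g x)"
      by (intro borel_integrable_compact gcont) auto
    moreover have "(\<lambda>x. indicator (cball 0 R) x *\<^sub>R g x) = g"
      using supp by (auto simp: fun_eq_iff indicator_def not_le)
    ultimately show ?thesis by simp
  qed
  have shift: "integrable lborel (\<lambda>x. g (x + c))" "(\<integral>x. g (x + c) \<partial>lborel) = (\<integral>x. g x \<partial>lborel)" for c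
  proof -
    have L: "lborel = distr lborel borel ((+) c)" by (rule lborel_distr_plus[symmetric])
    have "integrable (distr lborel borel ((+) c)) g" using gint L by simp
    then show "integrable lborel (\<lambda>x. g (x + c))" by (simp add: integrable_distr_eq add.commute)
    have "(\<integral>x. g x \<partial>distr lborel borel ((+) c)) = (\<integral>x. g (c + x) \<partial>lborel)"
      by (rule integral_distr) auto
    then show "(\<integral>x. g (x + c) \<partial>lborel) = (\<integral>x. g x \<partial>lborel)" using L by (simp add: add.commute)
  qed
  \<comment> \<open>Difference quotients with step at most 1 vanish outside radius R + 1; inside, by
    the mean value theorem, they are values of the partial derivative within radius R + 2.\<close>
  obtain M where M: "\<And>x. x \<in> cball 0 (R + 2) \<Longrightarrow> \<bar>partial j g x\<bar> \<le> M"
    using compact_imp_bounded[OF compact_continuous_image[OF continuous_on_subset[OF cont] compact_cball, of 0 "R + 2"]]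
    by (force simp: bounded_iff)
  have "(\<lambda>n. \<integral>x. dq n x \<partial>lborel) \<longlonglongrightarrow> (\<integral>x. partial j g x \<partial>lborel)"
  proof (rule integral_dominated_convergence)
    show "partial j g \<in> borel_measurable lborel"
      using borel_measurable_continuous_onI[OF cont] by simp
    show "dq n \<in> borel_measurable lborel" for n unfolding dq_def by measurable
    show "integrable lborel (\<lambda>x. M * indicator (cball (0::real^'d) (R + 1)) x)"
      by (intro integrable_mult_right integrable_real_indicator)
         (use emeasure_lborel_cball_finite[of "0::real^'d" "R + 1"] in auto)
    show "AE x in lborel. (\<lambda>n. dq n x) \<longlonglongrightarrow> partial j g x"
    proof (rule AE_I2)
      fix x
      have "((\<lambda>h. (g (x + (0 + h) *\<^sub>R ?e) - g (x + 0 *\<^sub>R ?e)) / h) \<longlongrightarrow> partial j g (x + 0 *\<^sub>R ?e)) (at 0)"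
        using partial_DERIV_line[OF diff, where x = x and t = 0 and j = j] unfolding DERIV_def .
      moreover have "filterlim (\<lambda>n. 1 / real (Suc n)) (at 0) sequentially"
        using LIMSEQ_Suc[OF lim_1_over_n] by (auto simp: filterlim_at)
      ultimately have "(\<lambda>n. (g (x + (0 + 1 / real (Suc n)) *\<^sub>R ?e) - g (x + 0 *\<^sub>R ?e)) / (1 / real (Suc n))) \<longlonglongrightarrow> partial j g (x + 0 *\<^sub>R ?e)"
        by (rule filterlim_compose)
      then show "(\<lambda>n. dq n x) \<longlonglongrightarrow> partial j g x" by (simp add: dq_def)
    qed
    show "AE x in lborel. norm (dq n x) \<le> M * indicator (cball 0 (R + 1)) x" for n
    proof (rule AE_I2)
      fix x :: "real^'d"
      have n1: "0 < 1 / real (Suc n)" "1 / real (Suc n) \<le> 1" by auto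
      have nrm: "norm (t *\<^sub>R ?e) \<le> 1" if "0 \<le> t" "t \<le> 1 / Suc n" for t
        using that order_trans[OF that(2) n1(2)] by simp
      show "norm (dq n x) \<le> M * indicator (cball 0 (R + 1)) x"
      proof (cases "x \<in> cball 0 (R + 1)")
        case True
        obtain t where t: "0 < t" "t < 1 / Suc n"
          "g (x + (1 / Suc n) *\<^sub>R ?e) - g (x + 0 *\<^sub>R ?e) = (1 / Suc n - 0) * partial j g (x + t *\<^sub>R ?e)"
          using MVT2[OF n1(1), of "\<lambda>t. g (x + t *\<^sub>R ?e)" "\<lambda>t. partial j g (x + t *\<^sub>R ?e)"] partial_DERIV_line[OF diff]
          by blast
        have "x + t *\<^sub>R ?e \<in> cball 0 (R + 2)"
          using norm_triangle_ineq[of x "t *\<^sub>R ?e"] nrm[of t] t True by simp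
        from M[OF this] show ?thesis using t(3) True by (simp add: dq_def)
      next
        case False
        define c where "c = 1 / real (Suc n)"
        have "norm (c *\<^sub>R ?e) \<le> 1" using nrm[of c] n1 by (simp only: c_def less_imp_le order_refl)
        moreover have "norm x \<le> norm (x + c *\<^sub>R ?e) + norm (c *\<^sub>R ?e)"
          using norm_triangle_ineq4[of "x + c *\<^sub>R ?e" "c *\<^sub>R ?e"] by simp
        moreover have "R + 1 < norm x" using False by simp
        ultimately have "R < norm x" "R < norm (x + (1 / Suc n) *\<^sub>R ?e)"
          unfolding c_def by linarith+
        then show ?thesis using False supp by (simp add: dq_def)
      qed
    qed
  qed
  moreover have "(\<integral>x. dq n x \<partial>lborel) = 0" for n
    unfolding dq_def using shift gint by (subst integral_mult_left_zero) simp
  ultimately show ?thesis using LIMSEQ_unique[OF tendsto_const] by fastforce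
qed

section \<open>Smooth functions and test functions\<close>

lemma partial_cmult_add:
  assumes "f differentiable (at x)" "g differentiable (at x)"
  shows "partial i (\<lambda>x. c * f x + g x) x = c * partial i f x + partial i g x"
  using assms[THEN differentiable_has_derivative] unfolding partial_def[of i f] partial_def[of i g]
  by (intro partial_eqI) (auto intro!: derivative_eq_intros)

definition smooth :: "(real^'d \<Rightarrow> real) \<Rightarrow> bool" where
  "smooth f \<longleftrightarrow> (\<forall>js x. fold partial js f differentiable (at x))"

lemma smooth_differentiable: "smooth f \<Longrightarrow> f differentiable (at x)"
  unfolding smooth_def by (metis fold_simps(1))

lemma smooth_partial: "smooth f \<Longrightarrow> smooth (partial j f)"
  unfolding smooth_def by (metis fold_simps(2))

lemma smooth_continuous_on: "smooth f \<Longrightarrow> continuous_on S f"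
  by (intro continuous_at_imp_continuous_on ballI differentiable_imp_continuous_within smooth_differentiable)

lemma smooth_cmult_add:
  assumes "smooth f" "smooth g" shows "smooth (\<lambda>x. c * f x + g x)"
proof -
  have "fold partial js (\<lambda>x. c * f x + g x) differentiable (at x)" for js x
    using assms
  proof (induction js arbitrary: f g)
    case Nil
    then show ?case by (simp add: smooth_differentiable)
  next
    case (Cons i js)
    have "partial i (\<lambda>x. c * f x + g x) = (\<lambda>x. c * partial i f x + partial i g x)"
      using Cons.prems by (intro ext partial_cmult_add smooth_differentiable)
    then show ?case using Cons.IH[OF smooth_partial smooth_partial, OF Cons.prems] by simp
  qed
  then show ?thesis by (simp add: smooth_def)
qed

lemma smooth_zero: "smooth (\<lambda>x::real^'d. 0)"
proof -
  have "fold partial js (\<lambda>x::real^'d. 0) = (\<lambda>x. 0)" for js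
    by (induction js) (simp_all add: partial_def[abs_def])
  then show ?thesis by (simp add: smooth_def)
qed

text \<open>The shape f + (x_j - b) g survives every partial derivative: differentiating x_j adds a
  multiple of g to the first part, and the rest is x_j - b times a derivative of g. So the induction
  runs over all f and g. \<open>D_adj\<close> produces this shape.\<close>

lemma smooth_add_coordinate_mult:
  assumes "smooth f" "smooth g" shows "smooth (\<lambda>x. f x + (x $ j - b) * g x)"
proof -
  have "fold partial js (\<lambda>x. f x + (x $ j - b) * g x) differentiable (at x)" for js x
    using assms
  proof (induction js arbitrary: f g)
    case Nil
    have "(\<lambda>x. x $ j) differentiable (at x)"
      using bounded_linear_vec_nth by (rule bounded_linear_imp_differentiable)
    then show ?case using Nil by (simp add: smooth_differentiable)
  next
    case (Cons i js)
    let ?d = "if i = j then 1 else 0 :: real"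
    have "partial i (\<lambda>x. f x + (x $ j - b) * g x) x = (?d * g x + partial i f x) + (x $ j - b) * partial i g x" for x
    proof -
      have "((\<lambda>x. x $ j) has_derivative (\<lambda>h. h $ j)) (at x)"
        by (rule bounded_linear_imp_has_derivative) (rule bounded_linear_vec_nth)
      then have "partial i (\<lambda>x. f x + (x $ j - b) * g x) x
         = partial i f x + ((x $ j - b) * partial i g x + axis i 1 $ j * g x)"
        using Cons.prems[THEN smooth_differentiable, THEN differentiable_has_derivative]
        unfolding partial_def[of i f] partial_def[of i g]
        by (intro partial_eqI) (auto intro!: derivative_eq_intros)
      then show ?thesis by (simp add: axis_def)
    qed
    then have "partial i (\<lambda>x. f x + (x $ j - b) * g x) = (\<lambda>x. (?d * g x + partial i f x) + (x $ j - b) * partial i g x)"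
      by (rule ext)
    then show ?case
      using Cons.IH[OF smooth_cmult_add[OF Cons.prems(2) smooth_partial[OF Cons.prems(1)]] smooth_partial[OF Cons.prems(2)], of ?d]
      by simp
  qed
  then show ?thesis by (simp add: smooth_def)
qed

lemma test_funs_iff: "\<phi> \<in> test_funs \<longleftrightarrow> smooth \<phi> \<and> compact (closure {x. \<phi> x \<noteq> 0})"
  by (simp add: test_funs_def smooth_def)

lemma test_funs_bounded_support:
  fixes \<phi> :: "real^'d \<Rightarrow> real"
  assumes "\<phi> \<in> test_funs" obtains R where "\<And>x. R < norm x \<Longrightarrow> \<phi> x = 0"
proof -
  have "bounded {x. \<phi> x \<noteq> 0}"
    using assms by (auto simp: test_funs_iff intro: bounded_subset[OF compact_imp_bounded closure_subset])
  then obtain R where "\<And>x. \<phi> x \<noteq> 0 \<Longrightarrow> norm x \<le> R" by (auto simp: bounded_iff)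
  then show thesis using that by (meson not_le)
qed

lemma test_funs_sq_int:
  assumes "\<phi> \<in> test_funs" shows "\<phi> \<in> sq_int lborel"
proof -
  have cont: "continuous_on S \<phi>" for S using assms by (simp add: test_funs_iff smooth_continuous_on)
  obtain R where R: "\<And>x. R < norm x \<Longrightarrow> \<phi> x = 0" using test_funs_bounded_support[OF assms] by blast
  have "integrable lborel (\<lambda>x. indicator (cball 0 R) x *\<^sub>R (\<phi> x)\<^sup>2)"
    by (intro borel_integrable_compact continuous_intros cont) auto
  also have "(\<lambda>x. indicator (cball 0 R) x *\<^sub>R (\<phi> x)\<^sup>2) = (\<lambda>x. (\<phi> x)\<^sup>2)"
    using R by (auto simp: fun_eq_iff indicator_def not_le)
  finally show ?thesis
    using borel_measurable_continuous_onI[OF cont] by (simp add: sq_int_def)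
qed

text \<open>Off its closed support the function vanishes on an open set, so its partial derivatives
  vanish there too and the support does not grow.\<close>

lemma D_adj_test_funs:
  fixes \<phi> :: "real^'d \<Rightarrow> real"
  assumes "\<phi> \<in> test_funs" shows "D_adj \<alpha> \<beta> j \<phi> \<in> test_funs"
proof -
  have sm: "smooth \<phi>" and cp: "compact (closure {x. \<phi> x \<noteq> 0})" using assms by (auto simp: test_funs_iff)
  have "smooth (\<lambda>x. (-1 * partial j \<phi> x + 0) + (x $ j - \<beta> $ j) * ((\<alpha> $ j)\<^sup>2 * \<phi> x + 0))"
    by (intro smooth_add_coordinate_mult smooth_cmult_add smooth_zero smooth_partial sm)
  also have "(\<lambda>x. (-1 * partial j \<phi> x + 0) + (x $ j - \<beta> $ j) * ((\<alpha> $ j)\<^sup>2 * \<phi> x + 0)) = D_adj \<alpha> \<beta> j \<phi>"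
    by (simp add: fun_eq_iff D_adj_def)
  finally have "smooth (D_adj \<alpha> \<beta> j \<phi>)" .
  moreover have "{x. D_adj \<alpha> \<beta> j \<phi> x \<noteq> 0} \<subseteq> closure {x. \<phi> x \<noteq> 0}"
  proof -
    define K where "K = closure {x. \<phi> x \<noteq> 0}"
    have K: "closed K" and z: "\<phi> y = 0" if "y \<notin> K" for y
      using closure_subset[of "{x. \<phi> x \<noteq> 0}"] that by (auto simp: K_def)
    have "D_adj \<alpha> \<beta> j \<phi> x = 0" if x: "x \<notin> K" for x
    proof -
      have "((\<lambda>x. 0) has_derivative (\<lambda>x. 0)) (at x)" by simp
      then have "(\<phi> has_derivative (\<lambda>x. 0)) (at x)"
        by (rule has_derivative_transform_within_open[of _ _ _ _ "- K"]) (use K z x in auto)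
      then have "partial j \<phi> x = 0" by (rule partial_eqI)
      then show ?thesis using z[OF x] by (simp add: D_adj_def)
    qed
    then show ?thesis unfolding K_def[symmetric] by blast
  qed
  then have "closure {x. D_adj \<alpha> \<beta> j \<phi> x \<noteq> 0} \<subseteq> closure {x. \<phi> x \<noteq> 0}"
    by (intro closure_minimal) auto
  then have "compact (closure {x. D_adj \<alpha> \<beta> j \<phi> x \<noteq> 0})"
    using cp by (metis closed_closure compact_Int_closed inf.absorb_iff2)
  ultimately show ?thesis by (simp add: test_funs_iff)
qed

lemma fold_D_adj_test_funs: "\<phi> \<in> test_funs \<Longrightarrow> fold (D_adj \<alpha> \<beta>) js \<phi> \<in> test_funs"
  by (induction js arbitrary: \<phi>) (auto intro: D_adj_test_funs)

text \<open>Square integrability of the functions and of the test functions makes every product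
  integrable, which is what permits splitting the integrals.\<close>

lemma has_weak_D_cmult_add:
  fixes \<alpha> \<beta> :: "real^'d"
  assumes "u \<in> sq_int lborel" "v \<in> sq_int lborel" "has_weak_D \<alpha> \<beta> k u v"
    and "u' \<in> sq_int lborel" "v' \<in> sq_int lborel" "has_weak_D \<alpha> \<beta> k u' v'"
  shows "has_weak_D \<alpha> \<beta> k (\<lambda>x. c * u x + u' x) (\<lambda>x. c * v x + v' x)"
  unfolding has_weak_D_def
proof (intro allI impI ballI)
  fix js and \<phi> :: "real^'d \<Rightarrow> real" assume js: "\<forall>j. count_list js j = k $ j" and \<phi>: "\<phi> \<in> test_funs"
  have eq: "(\<integral>x. (c * f x + g x) * \<psi> x \<partial>lborel) = c * (\<integral>x. f x * \<psi> x \<partial>lborel) + (\<integral>x. g x * \<psi> x \<partial>lborel)"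
    if "f \<in> sq_int lborel" "g \<in> sq_int lborel" "\<psi> \<in> test_funs" for f g \<psi>
    using sq_int_mult_integrable[OF that(1) test_funs_sq_int[OF that(3)]]
      sq_int_mult_integrable[OF that(2) test_funs_sq_int[OF that(3)]]
    by (simp add: distrib_right mult.assoc)
  show "(\<integral>x. (c * v x + v' x) * \<phi> x \<partial>lborel) = (\<integral>x. (c * u x + u' x) * fold (D_adj \<alpha> \<beta>) js \<phi> x \<partial>lborel)"
    using assms js \<phi> by (simp add: eq fold_D_adj_test_funs has_weak_D_def)
qed

lemma has_weak_D_zero: "has_weak_D \<alpha> \<beta> k (\<lambda>x. 0) (\<lambda>x. 0)"
  by (simp add: has_weak_D_def)

text \<open>The factor picked up when d/dx + a^2 (x - b) is applied k times to the n-th Hermite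
  function. For k > n the factor with i = n is 0, so the truncated index n - k does no harm.\<close>

definition lower_coeff :: "real \<Rightarrow> nat \<Rightarrow> nat \<Rightarrow> real" where
  "lower_coeff a n k = (\<Prod>i<k. a * sqrt (2 * real (n - i)))"

context hermite_vec
begin

lemma hermite_fun_has_derivative:
  "hermite_fun \<alpha> \<beta> n differentiable (at x)"
  "partial j (hermite_fun \<alpha> \<beta> n) x = \<alpha> $ j * sqrt (2 * real (n $ j)) * hermite_fun \<alpha> \<beta> (\<chi> i. if i = j then n $ i - 1 else n $ i) x
     - (\<alpha> $ j)\<^sup>2 * (x $ j - \<beta> $ j) * hermite_fun \<alpha> \<beta> n x"
proof -
  note D = hermite_fun1_lower[OF \<alpha>_pos]
  show "hermite_fun \<alpha> \<beta> n differentiable (at x)"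
    unfolding hermite_fun_def[abs_def] differentiable_def
    by (intro exI, rule vec_prod_has_derivative) (rule D)
  have "partial j (hermite_fun \<alpha> \<beta> n) x = (\<alpha> $ j * sqrt (2 * real (n $ j)) * hermite_fun1 (\<alpha> $ j) (\<beta> $ j) (n $ j - 1) (x $ j)
     - (\<alpha> $ j)\<^sup>2 * (x $ j - \<beta> $ j) * hermite_fun1 (\<alpha> $ j) (\<beta> $ j) (n $ j) (x $ j))
     * (\<Prod>i\<in>UNIV - {j}. hermite_fun1 (\<alpha> $ i) (\<beta> $ i) (n $ i) (x $ i))"
    unfolding hermite_fun_def[abs_def] by (rule partial_vec_prod) (rule D)
  also have "\<dots> = \<alpha> $ j * sqrt (2 * real (n $ j)) * hermite_fun \<alpha> \<beta> (\<chi> i. if i = j then n $ i - 1 else n $ i) x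
     - (\<alpha> $ j)\<^sup>2 * (x $ j - \<beta> $ j) * hermite_fun \<alpha> \<beta> n x"
    by (simp add: hermite_fun_def prod.remove[of UNIV j] algebra_simps)
  finally show "partial j (hermite_fun \<alpha> \<beta> n) x = \<alpha> $ j * sqrt (2 * real (n $ j)) * hermite_fun \<alpha> \<beta> (\<chi> i. if i = j then n $ i - 1 else n $ i) x
     - (\<alpha> $ j)\<^sup>2 * (x $ j - \<beta> $ j) * hermite_fun \<alpha> \<beta> n x" .
qed

lemma continuous_on_hermite_fun: "continuous_on S (hermite_fun \<alpha> \<beta> n)"
  by (intro continuous_at_imp_continuous_on ballI differentiable_imp_continuous_within hermite_fun_has_derivative)

text \<open>The partial derivative of the product of the Hermite function and the test function
  integrates to 0. In the product rule the lowering formula and \<open>D_adj\<close> contribute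
  opposite terms with x_j - beta_j.\<close>

lemma integral_hermite_fun_D_adj:
  assumes \<phi>: "\<phi> \<in> test_funs"
  shows "(\<integral>x. hermite_fun \<alpha> \<beta> n x * D_adj \<alpha> \<beta> j \<phi> x \<partial>lborel)
    = \<alpha> $ j * sqrt (2 * real (n $ j)) * (\<integral>x. hermite_fun \<alpha> \<beta> (\<chi> i. if i = j then n $ i - 1 else n $ i) x * \<phi> x \<partial>lborel)"
proof -
  let ?H = "hermite_fun \<alpha> \<beta>" and ?n = "\<chi> i. if i = j then n $ i - 1 else n $ i"
  let ?c = "\<alpha> $ j * sqrt (2 * real (n $ j))"
  have sm: "smooth \<phi>" using \<phi> by (simp add: test_funs_iff)
  obtain R where R: "\<And>x. R < norm x \<Longrightarrow> \<phi> x = 0" using test_funs_bounded_support[OF \<phi>] by blast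
  have eq: "partial j (\<lambda>x. ?H n x * \<phi> x) x = ?c * (?H ?n x * \<phi> x) - ?H n x * D_adj \<alpha> \<beta> j \<phi> x" for x
  proof -
    have "partial j (\<lambda>x. ?H n x * \<phi> x) x = ?H n x * partial j \<phi> x + partial j (?H n) x * \<phi> x"
      using smooth_differentiable[OF sm, of x, THEN differentiable_has_derivative]
        hermite_fun_has_derivative(1)[of n x, THEN differentiable_has_derivative]
      unfolding partial_def[of j \<phi>] partial_def[of j "?H n"]
      by (intro partial_eqI) (rule has_derivative_mult)
    then show ?thesis
      by (simp add: hermite_fun_has_derivative(2) D_adj_def algebra_simps)
  qed
  have "(\<integral>x. partial j (\<lambda>x. ?H n x * \<phi> x) x \<partial>lborel) = 0"
  proof (rule integral_partial_eq_0)
    show "(\<lambda>x. ?H n x * \<phi> x) differentiable (at x)" for x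
      by (intro derivative_intros hermite_fun_has_derivative smooth_differentiable sm)
    show "continuous_on UNIV (partial j (\<lambda>x. ?H n x * \<phi> x))"
      unfolding eq[abs_def]
      by (intro continuous_intros continuous_on_hermite_fun smooth_continuous_on[OF sm] smooth_continuous_on)
         (use D_adj_test_funs[OF \<phi>] in \<open>simp add: test_funs_iff\<close>)
    show "?H n x * \<phi> x = 0" if "R < norm x" for x using R[OF that] by simp
  qed
  moreover have "integrable lborel (\<lambda>x. ?H ?n x * \<phi> x)" "integrable lborel (\<lambda>x. ?H n x * D_adj \<alpha> \<beta> j \<phi> x)"
    by (intro sq_int_mult_integrable hermite_fun_sq_int test_funs_sq_int D_adj_test_funs \<phi>)+
  ultimately show ?thesis unfolding eq by simp
qed

text \<open>The head of the list acts first on the test function, so it is the last to be moved to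
  the Hermite function, whose index the others have lowered by then.\<close>

lemma integral_hermite_fun_fold_D_adj:
  assumes "\<phi> \<in> test_funs"
  shows "(\<integral>x. hermite_fun \<alpha> \<beta> n x * fold (D_adj \<alpha> \<beta>) js \<phi> x \<partial>lborel)
    = (\<Prod>j\<in>UNIV. lower_coeff (\<alpha> $ j) (n $ j) (count_list js j)) *
      (\<integral>x. hermite_fun \<alpha> \<beta> (\<chi> j. n $ j - count_list js j) x * \<phi> x \<partial>lborel)"
  using assms
proof (induction js arbitrary: \<phi>)
  case Nil
  then show ?case by (simp add: lower_coeff_def)
next
  case (Cons i js)
  let ?L = "\<lambda>js j. lower_coeff (\<alpha> $ j) (n $ j) (count_list js j)"
  have "(\<integral>x. hermite_fun \<alpha> \<beta> n x * fold (D_adj \<alpha> \<beta>) (i # js) \<phi> x \<partial>lborel)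
    = (\<Prod>j\<in>UNIV. ?L js j) * (\<integral>x. hermite_fun \<alpha> \<beta> (\<chi> j. n $ j - count_list js j) x * D_adj \<alpha> \<beta> i \<phi> x \<partial>lborel)"
    using Cons.IH[OF D_adj_test_funs[OF Cons.prems]] by simp
  also have "\<dots> = ((\<Prod>j\<in>UNIV. ?L js j) * (\<alpha> $ i * sqrt (2 * real (n $ i - count_list js i)))) *
    (\<integral>x. hermite_fun \<alpha> \<beta> (\<chi> j. if j = i then n $ j - count_list js j - 1 else n $ j - count_list js j) x * \<phi> x \<partial>lborel)"
    unfolding integral_hermite_fun_D_adj[OF Cons.prems] by (simp add: mult.assoc cong: if_cong)
  also have "(\<Prod>j\<in>UNIV. ?L js j) * (\<alpha> $ i * sqrt (2 * real (n $ i - count_list js i))) = (\<Prod>j\<in>UNIV. ?L (i # js) j)"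
    by (simp add: prod.remove[of UNIV i] lower_coeff_def)
  also have "(\<chi> j. if j = i then n $ j - count_list js j - 1 else n $ j - count_list js j) = (\<chi> j. n $ j - count_list (i # js) j)"
    by (simp add: vec_eq_iff)
  finally show ?case .
qed

lemma has_weak_D_hermite_fun:
  "has_weak_D \<alpha> \<beta> k (hermite_fun \<alpha> \<beta> n)
    (\<lambda>x. (\<Prod>j\<in>UNIV. lower_coeff (\<alpha> $ j) (n $ j) (k $ j)) * hermite_fun \<alpha> \<beta> (\<chi> j. n $ j - k $ j) x)"
  unfolding has_weak_D_def by (auto simp: integral_hermite_fun_fold_D_adj mult.assoc)

text \<open>Ensures that \<open>weak_D\<close> of u - U is a genuine weak derivative and not an
  arbitrary choice.\<close>

lemma has_weak_D_hermite_span: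
  assumes "U \<in> lin_span (hermite_fun \<alpha> \<beta>)"
  shows "\<exists>V\<in>sq_int lborel. has_weak_D \<alpha> \<beta> k U V"
proof -
  obtain F c where "finite F" "U = (\<lambda>x. \<Sum>n\<in>F. c n * hermite_fun \<alpha> \<beta> n x)"
    by (rule lin_spanE[OF assms])
  moreover have "\<exists>V\<in>sq_int lborel. has_weak_D \<alpha> \<beta> k (\<lambda>x. \<Sum>n\<in>F. c n * hermite_fun \<alpha> \<beta> n x) V"
    using \<open>finite F\<close>
  proof (induction F)
    case empty
    show ?case unfolding sum.empty by (intro bexI[of _ "\<lambda>x. 0"] has_weak_D_zero sq_int_zero)
  next
    case (insert n F)
    then obtain V where V: "V \<in> sq_int lborel" "has_weak_D \<alpha> \<beta> k (\<lambda>x. \<Sum>n\<in>F. c n * hermite_fun \<alpha> \<beta> n x) V" by blast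
    let ?W = "\<lambda>x. (\<Prod>j\<in>UNIV. lower_coeff (\<alpha> $ j) (n $ j) (k $ j)) * hermite_fun \<alpha> \<beta> (\<chi> j. n $ j - k $ j) x"
    have W: "?W \<in> sq_int lborel" by (intro sq_int_cmult hermite_fun_sq_int)
    have "has_weak_D \<alpha> \<beta> k (\<lambda>x. c n * hermite_fun \<alpha> \<beta> n x + (\<Sum>n\<in>F. c n * hermite_fun \<alpha> \<beta> n x)) (\<lambda>x. c n * ?W x + V x)"
      by (intro has_weak_D_cmult_add has_weak_D_hermite_fun V W hermite_fun_sq_int sq_int_sum sq_int_cmult)
    moreover have "(\<lambda>x. c n * ?W x + V x) \<in> sq_int lborel" by (intro sq_int_add sq_int_cmult[OF W] V)
    ultimately show ?case using insert(1,2) by auto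
  qed
  ultimately show ?thesis by simp
qed

end

section \<open>Truncation to a hyperbolic cross\<close>

lemma mi_max_le_iff: "mi_max k \<le> l \<longleftrightarrow> (\<forall>j. k $ j \<le> l)"
  by (simp add: mi_max_def)

lemma le_mi_max: "k $ j \<le> mi_max k"
  by (simp add: mi_max_def)

lemma mi_max_le_mi_sum: "mi_max k \<le> mi_sum k"
  by (simp add: mi_max_le_iff mi_sum_def member_le_sum)

lemma finite_mi_max: "finite {k::nat^'d. mi_max k \<le> l}"
proof (rule finite_subset)
  show "{k::nat^'d. mi_max k \<le> l} \<subseteq> vec_lambda ` (UNIV \<rightarrow>\<^sub>E {..l})"
    by (auto simp: mi_max_le_iff image_iff intro!: bexI[of _ "($) _"])
qed (intro finite_imageI finite_PiE; simp)

lemma le_mi_mix: "max 1 (n $ j) \<le> mi_mix n"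
proof -
  have "max 1 (n $ j) * 1 \<le> max 1 (n $ j) * (\<Prod>j\<in>UNIV - {j}. max 1 (n $ j))"
    by (intro mult_left_mono) (auto intro!: prod_pos simp: Suc_le_eq)
  then show ?thesis unfolding mi_mix_def by (subst prod.remove[of _ j]) auto
qed

lemma mi_max_le_mi_mix: "mi_max n \<le> mi_mix n"
  using le_mi_mix[of n] by (auto simp: mi_max_le_iff)

lemma mi_mix_pos: "0 < mi_mix n"
  by (auto simp: mi_mix_def intro!: prod_pos)

text \<open>If all d entries were below m, their product would be at most m^d. This is the origin of
  the threshold for N.\<close>

lemma exists_large_component:
  fixes n :: "nat^'d"
  assumes "1 \<le> m" "m ^ CARD('d) < mi_mix n"
  shows "\<exists>j. m \<le> n $ j"
proof (rule ccontr)
  assume "\<nexists>j. m \<le> n $ j"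
  then have "mi_mix n \<le> (\<Prod>j\<in>(UNIV::'d set). m)"
    unfolding mi_mix_def using assms(1) by (intro prod_mono) (auto simp: not_le intro: less_imp_le)
  then show False using assms(2) by simp
qed

lemma raise_coeff_power2: "(raise_coeff a n k)\<^sup>2 = (\<Prod>i<k. 2 * a\<^sup>2 * real (Suc (n + i)))"
  unfolding raise_coeff_def prod_power_distrib
  by (intro prod.cong refl) (simp add: power_mult_distrib del: of_nat_Suc)

text \<open>As i < k, each n + i + 1 is at most n + k. The maximum with 1 permits raising the
  exponent k of the constant to m, which makes it independent of k.\<close>

lemma raise_coeff_upper:
  assumes "k \<le> m"
  shows "(raise_coeff a n k)\<^sup>2 \<le> max 1 (2 * a\<^sup>2) ^ m * real (max 1 (n + k)) ^ k"
proof -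
  have "(raise_coeff a n k)\<^sup>2 \<le> (\<Prod>i<k. max 1 (2 * a\<^sup>2) * real (max 1 (n + k)))"
    unfolding raise_coeff_power2 by (intro prod_mono conjI mult_mono) auto
  also have "\<dots> = max 1 (2 * a\<^sup>2) ^ k * real (max 1 (n + k)) ^ k"
    by (simp only: prod_constant card_lessThan power_mult_distrib)
  also have "\<dots> \<le> max 1 (2 * a\<^sup>2) ^ m * real (max 1 (n + k)) ^ k"
    using assms by (intro mult_right_mono power_increasing) auto
  finally show ?thesis .
qed

text \<open>Each n + i + 1 is at least n + 1, and n + m <= m (n + 1); the loss of 1 / m per factor
  goes into the constant.\<close>

lemma raise_coeff_lower:
  assumes "1 \<le> m"
  shows "(min 1 (2 * a\<^sup>2) / real m) ^ m * real (n + m) ^ m \<le> (raise_coeff a n m)\<^sup>2"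
proof -
  have "(min 1 (2 * a\<^sup>2) / real m) ^ m * real (n + m) ^ m = (\<Prod>i<m. min 1 (2 * a\<^sup>2) * (real (n + m) / real m))"
    by (simp add: power_divide power_mult_distrib)
  also have "\<dots> \<le> (raise_coeff a n m)\<^sup>2"
    unfolding raise_coeff_power2
  proof (intro prod_mono conjI mult_mono)
    fix i
    have "real n + real m \<le> real m * (real n + 1)"
      using mult_right_mono[of 1 "real m" "real n"] assms by (simp add: algebra_simps)
    then have "real (n + m) / real m \<le> real n + 1" using assms by (simp add: pos_divide_le_eq mult.commute)
    then show "real (n + m) / real m \<le> real (Suc (n + i))" by simp
  qed (auto intro!: mult_nonneg_nonneg)
  finally show ?thesis .
qed

lemma L2_norm_power2: "(L2_norm f)\<^sup>2 = (\<integral>x. (f x)\<^sup>2 \<partial>lborel)"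
  by (simp add: L2_norm_def)

lemma weak_D_spec:
  assumes "v \<in> L2" "has_weak_D \<alpha> \<beta> k u v"
  shows "weak_D \<alpha> \<beta> k u \<in> sq_int lborel" "has_weak_D \<alpha> \<beta> k u (weak_D \<alpha> \<beta> k u)"
proof -
  have "weak_D \<alpha> \<beta> k u \<in> L2 \<and> has_weak_D \<alpha> \<beta> k u (weak_D \<alpha> \<beta> k u)"
    unfolding weak_D_def by (rule someI[where P = "\<lambda>v. v \<in> L2 \<and> has_weak_D \<alpha> \<beta> k u v" and x = v]) (intro conjI assms)
  then show "weak_D \<alpha> \<beta> k u \<in> sq_int lborel" "has_weak_D \<alpha> \<beta> k u (weak_D \<alpha> \<beta> k u)"
    by (auto simp: L2_eq_sq_int)
qed

lemma K_space_weak_D: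
  assumes "u \<in> K_space \<alpha> \<beta> m" "mi_max k \<le> m"
  shows "weak_D \<alpha> \<beta> k u \<in> sq_int lborel" "has_weak_D \<alpha> \<beta> k u (weak_D \<alpha> \<beta> k u)"
proof -
  obtain v where "v \<in> L2" "has_weak_D \<alpha> \<beta> k u v" using assms unfolding K_space_def by blast
  then show "weak_D \<alpha> \<beta> k u \<in> sq_int lborel" "has_weak_D \<alpha> \<beta> k u (weak_D \<alpha> \<beta> k u)"
    by (rule weak_D_spec)+
qed

lemma K_norm_nonneg: "0 \<le> K_norm \<alpha> \<beta> r u"
  by (auto simp: K_norm_def intro!: sum_nonneg)

lemma W_norm_nonneg: "0 \<le> W_norm \<alpha> \<beta> r u"
  by (auto simp: W_norm_def intro!: sum_nonneg)

lemma K_seminorm_nonneg: "0 \<le> K_seminorm \<alpha> \<beta> r u"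
  by (auto simp: K_seminorm_def intro!: sum_nonneg)

text \<open>The minimum with 1 keeps the lower bound valid in directions that are not
  differentiated: there n_j < m, and the bound need not exceed the empty product 1.\<close>

definition lower_const :: "nat \<Rightarrow> real^'d \<Rightarrow> real" where
  "lower_const m \<alpha> = (\<Prod>j\<in>UNIV. (min 1 (2 * (\<alpha> $ j)\<^sup>2) / real m) ^ m)"

definition upper_const :: "nat \<Rightarrow> real^'d \<Rightarrow> real" where
  "upper_const m \<alpha> = (\<Prod>j\<in>UNIV. max 1 (2 * (\<alpha> $ j)\<^sup>2) ^ m)"

lemma upper_const_nonneg: "0 \<le> upper_const m \<alpha>"
  by (auto simp: upper_const_def intro!: prod_nonneg)

definition truncation :: "real^'d \<Rightarrow> real^'d \<Rightarrow> (nat^'d) set \<Rightarrow> (real^'d \<Rightarrow> real) \<Rightarrow> real^'d \<Rightarrow> real" where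
  "truncation \<alpha> \<beta> I u x = (\<Sum>n\<in>I. hermite_coeff \<alpha> \<beta> u n * hermite_fun \<alpha> \<beta> n x)"

lemma truncation_in_hermite_span:
  assumes "finite I" shows "truncation \<alpha> \<beta> I u \<in> hermite_span \<alpha> \<beta> I"
  unfolding hermite_span_def truncation_def[abs_def] mem_Collect_eq
  by (intro exI conjI) (rule assms, rule subset_refl, rule refl)

context hermite_vec
begin

lemma lower_const_pos: "1 \<le> m \<Longrightarrow> 0 < lower_const m \<alpha>"
  using \<alpha>_pos less_imp_neq[OF \<alpha>_pos] by (auto simp: lower_const_def intro!: prod_pos zero_less_power divide_pos_pos)

(* Differentiating m times in exactly the directions with n $ j >= m gains a factor comparable to
   n $ j ^ m there; the remaining n $ j are bounded. *)
lemma sum_mi_mix_le_K_seminorm: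
  assumes m: "1 \<le> m" and u: "u \<in> K_space \<alpha> \<beta> m"
    and T: "finite T" "\<And>n. n \<in> T \<Longrightarrow> \<exists>j. m \<le> n $ j"
  shows "lower_const m \<alpha> * (\<Sum>n\<in>T. real (mi_mix n) ^ m * (hermite_coeff \<alpha> \<beta> u n)\<^sup>2) \<le> (K_seminorm \<alpha> \<beta> m u)\<^sup>2"
proof -
  define \<kappa> where "\<kappa> n = (\<chi> j. if m \<le> n $ j then m else 0)" for n :: "nat^'d"
  define v where "v k = weak_D \<alpha> \<beta> k u" for k
  have usq: "u \<in> sq_int lborel" using u by (simp add: K_space_def L2_eq_sq_int)
  let ?K = "{k::nat^'d. mi_max k = m}"
  have fin: "finite ?K" by (rule finite_subset[OF _ finite_mi_max[of m]]) auto
  have \<kappa>: "mi_max (\<kappa> n) = m" if "n \<in> T" for n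
  proof (rule antisym)
    show "mi_max (\<kappa> n) \<le> m" by (simp add: mi_max_le_iff \<kappa>_def)
    obtain j where j: "m \<le> n $ j" using T(2) \<open>n \<in> T\<close> by blast
    show "m \<le> mi_max (\<kappa> n)" using le_mi_max[of "\<kappa> n" j] j by (simp add: \<kappa>_def)
  qed
  \<comment> \<open>No entry of \<open>\<kappa> n\<close> exceeds that of n, so the truncated
    subtraction is exact.\<close>
  have \<kappa>n: "(n - \<kappa> n) + \<kappa> n = n" for n by (simp add: vec_eq_iff \<kappa>_def)
  have bound: "lower_const m \<alpha> * (real (mi_mix n) ^ m * (hermite_coeff \<alpha> \<beta> u n)\<^sup>2) \<le> (hermite_coeff \<alpha> \<beta> (v (\<kappa> n)) (n - \<kappa> n))\<^sup>2"
    if n: "n \<in> T" for n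
  proof -
    let ?r = "\<lambda>j. raise_coeff (\<alpha> $ j) ((n - \<kappa> n) $ j) (\<kappa> n $ j)"
    have "lower_const m \<alpha> * real (mi_mix n) ^ m = (\<Prod>j\<in>UNIV. (min 1 (2 * (\<alpha> $ j)\<^sup>2) / real m) ^ m * real (max 1 (n $ j)) ^ m)"
      by (simp only: lower_const_def mi_mix_def of_nat_prod prod_power_distrib prod.distrib)
    also have "\<dots> \<le> (\<Prod>j\<in>UNIV. (?r j)\<^sup>2)"
    proof (intro prod_mono conjI)
      fix j
      show "(min 1 (2 * (\<alpha> $ j)\<^sup>2) / real m) ^ m * real (max 1 (n $ j)) ^ m \<le> (?r j)\<^sup>2"
      proof (cases "m \<le> n $ j")
        case True
        then show ?thesis
          using raise_coeff_lower[OF m, of "\<alpha> $ j" "n $ j - m"] m by (simp add: \<kappa>_def)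
      next
        case False
        have "(min 1 (2 * (\<alpha> $ j)\<^sup>2) / real m) ^ m * real (max 1 (n $ j)) ^ m
           = (min 1 (2 * (\<alpha> $ j)\<^sup>2) * (real (max 1 (n $ j)) / real m)) ^ m"
          by (simp add: power_mult_distrib power_divide)
        also have "\<dots> \<le> 1"
          using False m by (intro power_le_one mult_nonneg_nonneg mult_le_one) (auto simp: field_simps)
        finally show ?thesis using False by (simp add: \<kappa>_def raise_coeff_def)
      qed
    qed (auto intro!: mult_nonneg_nonneg zero_le_power divide_nonneg_nonneg)
    finally have "lower_const m \<alpha> * real (mi_mix n) ^ m * (hermite_coeff \<alpha> \<beta> u n)\<^sup>2
       \<le> (\<Prod>j\<in>UNIV. (?r j)\<^sup>2) * (hermite_coeff \<alpha> \<beta> u n)\<^sup>2"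
      by (rule mult_right_mono) simp
    also have "\<dots> = (hermite_coeff \<alpha> \<beta> (v (\<kappa> n)) (n - \<kappa> n))\<^sup>2"
      using hermite_coeff_weak_D[OF usq K_space_weak_D[OF u], of "\<kappa> n" "n - \<kappa> n"] \<kappa>[OF n]
      by (simp add: v_def \<kappa>n power_mult_distrib prod_power_distrib)
    finally show ?thesis by (simp only: mult.assoc)
  qed
  have "lower_const m \<alpha> * (\<Sum>n\<in>T. real (mi_mix n) ^ m * (hermite_coeff \<alpha> \<beta> u n)\<^sup>2)
     \<le> (\<Sum>n\<in>T. (hermite_coeff \<alpha> \<beta> (v (\<kappa> n)) (n - \<kappa> n))\<^sup>2)"
    unfolding sum_distrib_left by (intro sum_mono bound)
  \<comment> \<open>Many n share one value k of \<open>\<kappa>\<close>. Within such a group the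
    shifted indices n - k are distinct, so Bessel's inequality for the single derivative
    \<open>v k\<close> covers the group.\<close>
  also have "\<dots> = (\<Sum>k\<in>?K. \<Sum>n\<in>{n\<in>T. \<kappa> n = k}. (hermite_coeff \<alpha> \<beta> (v (\<kappa> n)) (n - \<kappa> n))\<^sup>2)"
    by (rule sum.group[symmetric]) (use T fin \<kappa> in auto)
  also have "\<dots> \<le> (\<Sum>k\<in>?K. (L2_norm (v k))\<^sup>2)"
  proof (rule sum_mono)
    fix k assume k: "k \<in> ?K"
    have inj: "inj_on (\<lambda>n. n - k) {n\<in>T. \<kappa> n = k}"
      by (rule inj_onI) (metis (mono_tags, lifting) \<kappa>n mem_Collect_eq)
    have "(\<Sum>n\<in>{n\<in>T. \<kappa> n = k}. (hermite_coeff \<alpha> \<beta> (v (\<kappa> n)) (n - \<kappa> n))\<^sup>2)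
       = (\<Sum>n\<in>(\<lambda>n. n - k) ` {n\<in>T. \<kappa> n = k}. (hermite_coeff \<alpha> \<beta> (v k) n)\<^sup>2)"
      by (subst sum.reindex[OF inj]) simp
    also have "\<dots> \<le> (L2_norm (v k))\<^sup>2"
      unfolding L2_norm_power2 v_def using k T by (intro bessel K_space_weak_D[OF u]) auto
    finally show "(\<Sum>n\<in>{n\<in>T. \<kappa> n = k}. (hermite_coeff \<alpha> \<beta> (v (\<kappa> n)) (n - \<kappa> n))\<^sup>2) \<le> (L2_norm (v k))\<^sup>2" .
  qed
  also have "\<dots> = (K_seminorm \<alpha> \<beta> m u)\<^sup>2"
    unfolding K_seminorm_def v_def by (subst real_sqrt_pow2) (auto intro!: sum_nonneg)
  finally show ?thesis .
qed

lemma truncation_span: "finite I \<Longrightarrow> truncation \<alpha> \<beta> I u \<in> lin_span (hermite_fun \<alpha> \<beta>)"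
  unfolding truncation_def[abs_def] by (rule lin_spanI)

lemma hermite_coeff_truncation:
  assumes u: "u \<in> sq_int lborel" and I: "finite I"
  shows "hermite_coeff \<alpha> \<beta> (\<lambda>x. u x - truncation \<alpha> \<beta> I u x) n = (if n \<in> I then 0 else hermite_coeff \<alpha> \<beta> u n)"
proof -
  let ?H = "hermite_fun \<alpha> \<beta>" and ?c = "hermite_coeff \<alpha> \<beta> u"
  have int: "integrable lborel (\<lambda>x. u x * ?H n x)" "integrable lborel (\<lambda>x. ?H i x * ?H n x)" for i
    by (intro sq_int_mult_integrable u hermite_fun_sq_int)+
  have "(u x - truncation \<alpha> \<beta> I u x) * ?H n x = u x * ?H n x - (\<Sum>i\<in>I. ?c i * (?H i x * ?H n x))" for x
    by (simp add: truncation_def left_diff_distrib sum_distrib_right mult.assoc)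
  then have "hermite_coeff \<alpha> \<beta> (\<lambda>x. u x - truncation \<alpha> \<beta> I u x) n = ?c n - (\<Sum>i\<in>I. ?c i * (if i = n then 1 else 0))"
    by (simp add: hermite_coeff_def[of _ _ "\<lambda>x. u x - _ x"] hermite_coeff_def[of _ _ u n, symmetric] int hermite_fun_orthonormal)
  then show ?thesis using I by (simp add: if_distrib[of "\<lambda>t. _ * t"] cong: if_cong)
qed

text \<open>The common core of both estimates, with B = N^(l - m) in either case. The coefficient at
  n of the k-th derivative of the error comes from the error at n + k: it vanishes if n + k is in I
  and is controlled by \<open>le\<close> otherwise. Parseval's inequality passes from these
  coefficients to the norm.\<close>

lemma weak_D_truncation_error:
  assumes m: "1 \<le> m" and u: "u \<in> K_space \<alpha> \<beta> m" and k: "mi_max k \<le> m" and I: "finite I" and B: "0 \<le> B"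
    and large: "\<And>n. n \<notin> I \<Longrightarrow> \<exists>j. m \<le> n $ j"
    and le: "\<And>n. n \<notin> I \<Longrightarrow> (\<Prod>j\<in>UNIV. real (max 1 (n $ j)) ^ (k $ j)) \<le> B * real (mi_mix n) ^ m"
  shows "(L2_norm (weak_D \<alpha> \<beta> k (\<lambda>x. u x - truncation \<alpha> \<beta> I u x)))\<^sup>2
    \<le> upper_const m \<alpha> / lower_const m \<alpha> * B * (K_seminorm \<alpha> \<beta> m u)\<^sup>2"
proof -
  let ?e = "\<lambda>x. u x - truncation \<alpha> \<beta> I u x" and ?c = "hermite_coeff \<alpha> \<beta> u"
  let ?U = "upper_const m \<alpha>"
  define w where "w = weak_D \<alpha> \<beta> k ?e"
  have usq: "u \<in> sq_int lborel" using u by (simp add: K_space_def L2_eq_sq_int)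
  have tsq: "truncation \<alpha> \<beta> I u \<in> sq_int lborel" using truncation_span[OF I] subset by blast
  have esq: "?e \<in> sq_int lborel" by (intro sq_int_diff usq tsq)
  obtain V where V: "V \<in> sq_int lborel" "has_weak_D \<alpha> \<beta> k (truncation \<alpha> \<beta> I u) V"
    using has_weak_D_hermite_span[OF truncation_span[OF I]] by blast
  have "has_weak_D \<alpha> \<beta> k (\<lambda>x. -1 * truncation \<alpha> \<beta> I u x + u x) (\<lambda>x. -1 * V x + weak_D \<alpha> \<beta> k u x)"
    by (intro has_weak_D_cmult_add tsq V usq K_space_weak_D[OF u k])
  then have "has_weak_D \<alpha> \<beta> k ?e (\<lambda>x. weak_D \<alpha> \<beta> k u x - V x)" by simp
  moreover have "(\<lambda>x. weak_D \<alpha> \<beta> k u x - V x) \<in> L2"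
    unfolding L2_eq_sq_int by (intro sq_int_diff V K_space_weak_D[OF u k])
  ultimately have w: "w \<in> sq_int lborel" "has_weak_D \<alpha> \<beta> k ?e w"
    unfolding w_def by (blast intro: weak_D_spec)+
  have coeff: "(hermite_coeff \<alpha> \<beta> w n)\<^sup>2 \<le> (if n + k \<in> I then 0 else ?U * B * (real (mi_mix (n + k)) ^ m * (?c (n + k))\<^sup>2))" for n
  proof (cases "n + k \<in> I")
    case True
    then show ?thesis
      by (simp add: hermite_coeff_weak_D[OF esq w] hermite_coeff_truncation[OF usq I])
  next
    case False
    let ?r = "\<lambda>j. raise_coeff (\<alpha> $ j) (n $ j) (k $ j)"
    have "(\<Prod>j\<in>UNIV. (?r j)\<^sup>2) \<le> (\<Prod>j\<in>UNIV. max 1 (2 * (\<alpha> $ j)\<^sup>2) ^ m * real (max 1 (n $ j + k $ j)) ^ (k $ j))"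
      using k by (intro prod_mono conjI raise_coeff_upper) (auto simp: mi_max_le_iff)
    also have "\<dots> = ?U * (\<Prod>j\<in>UNIV. real (max 1 ((n + k) $ j)) ^ (k $ j))"
      by (simp add: upper_const_def prod.distrib)
    also have "\<dots> \<le> ?U * (B * real (mi_mix (n + k)) ^ m)"
      by (intro mult_left_mono le False upper_const_nonneg)
    finally have "(\<Prod>j\<in>UNIV. (?r j)\<^sup>2) * (?c (n + k))\<^sup>2 \<le> ?U * (B * real (mi_mix (n + k)) ^ m) * (?c (n + k))\<^sup>2"
      by (rule mult_right_mono) simp
    then show ?thesis using False
      by (simp add: hermite_coeff_weak_D[OF esq w] hermite_coeff_truncation[OF usq I] power_mult_distrib
          prod_power_distrib mult.assoc)
  qed
  have "(L2_norm w)\<^sup>2 \<le> ?U * B * ((K_seminorm \<alpha> \<beta> m u)\<^sup>2 / lower_const m \<alpha>)"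
    unfolding L2_norm_power2
  proof (rule parseval_le[OF w(1)])
    fix F :: "(nat^'d) set" assume F: "finite F"
    \<comment> \<open>The shift by k is injective, so the sum over F becomes a sum over distinct
      indices, of which only those outside I contribute.\<close>
    define T where "T = (\<lambda>n. n + k) ` F - I"
    have "(\<Sum>n\<in>F. (hermite_coeff \<alpha> \<beta> w n)\<^sup>2)
       \<le> (\<Sum>n\<in>F. if n + k \<in> I then 0 else ?U * B * (real (mi_mix (n + k)) ^ m * (?c (n + k))\<^sup>2))"
      by (intro sum_mono coeff)
    also have "\<dots> = (\<Sum>n\<in>(\<lambda>n. n + k) ` F. if n \<in> I then 0 else ?U * B * (real (mi_mix n) ^ m * (?c n)\<^sup>2))"
      by (subst sum.reindex) (auto simp: inj_on_def)
    also have "\<dots> = (\<Sum>n\<in>T. ?U * B * (real (mi_mix n) ^ m * (?c n)\<^sup>2))"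
      unfolding T_def using F by (intro sum.mono_neutral_cong_right) auto
    also have "\<dots> = ?U * B * (\<Sum>n\<in>T. real (mi_mix n) ^ m * (?c n)\<^sup>2)"
      by (simp add: sum_distrib_left)
    also have "\<dots> \<le> ?U * B * ((K_seminorm \<alpha> \<beta> m u)\<^sup>2 / lower_const m \<alpha>)"
    proof (intro mult_left_mono)
      have "lower_const m \<alpha> * (\<Sum>n\<in>T. real (mi_mix n) ^ m * (?c n)\<^sup>2) \<le> (K_seminorm \<alpha> \<beta> m u)\<^sup>2"
        using F large by (intro sum_mi_mix_le_K_seminorm[OF m u]) (auto simp: T_def)
      then show "(\<Sum>n\<in>T. real (mi_mix n) ^ m * (?c n)\<^sup>2) \<le> (K_seminorm \<alpha> \<beta> m u)\<^sup>2 / lower_const m \<alpha>"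
        using lower_const_pos[OF m] by (simp add: field_simps)
    qed (intro mult_nonneg_nonneg B upper_const_nonneg)
    finally show "(\<Sum>n\<in>F. (hermite_coeff \<alpha> \<beta> w n)\<^sup>2) \<le> ?U * B * ((K_seminorm \<alpha> \<beta> m u)\<^sup>2 / lower_const m \<alpha>)" .
  qed
  then show ?thesis by (simp add: w_def mult_ac)
qed

end

text \<open>All derivatives in a norm obey the same bound, so their number enters the constant as a
  square root.\<close>

lemma sqrt_sum_le:
  assumes "0 < N" "0 \<le> c" "0 \<le> s"
    and "\<And>k. k \<in> K \<Longrightarrow> f k \<le> c * real N powr p * s\<^sup>2"
  shows "sqrt (\<Sum>k\<in>K. f k) \<le> sqrt (real (card K) * c) * real N powr (p / 2) * s"
proof -
  have "(\<Sum>k\<in>K. f k) \<le> real (card K) * (c * real N powr p * s\<^sup>2)"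
    using assms(4) by (intro sum_bounded_above) auto
  then have "sqrt (\<Sum>k\<in>K. f k) \<le> sqrt (real (card K) * c * real N powr p * s\<^sup>2)"
    by (simp add: mult.assoc)
  also have "\<dots> = sqrt (real (card K) * c) * sqrt (real N powr p) * s"
    using assms by (simp add: real_sqrt_mult)
  also have "sqrt (real N powr p) = real N powr (p / 2)"
    using assms(1) by (simp add: powr_half_sqrt[symmetric] powr_powr)
  finally show ?thesis .
qed

text \<open>The left side is at most mix(n)^l = mix(n)^(l - m) mix(n)^m; since l - m is negative and
  mix(n) > N, the first factor is at most N^(l - m).\<close>

lemma regular_index_bound:
  fixes k n :: "nat^'d"
  assumes "mi_max k \<le> l" "l < m" "0 < N" "N < mi_mix n"
  shows "(\<Prod>j\<in>UNIV. real (max 1 (n $ j)) ^ (k $ j)) \<le> real N powr (real l - real m) * real (mi_mix n) ^ m"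
proof -
  have "(\<Prod>j\<in>UNIV. real (max 1 (n $ j)) ^ (k $ j)) \<le> (\<Prod>j\<in>UNIV. real (max 1 (n $ j)) ^ l)"
    using assms(1) by (intro prod_mono conjI power_increasing) (auto simp: mi_max_le_iff)
  also have "\<dots> = real (mi_mix n) powr real l"
    using mi_mix_pos[of n] by (simp only: powr_realpow of_nat_0_less_iff) (simp only: mi_mix_def of_nat_prod prod_power_distrib)
  also have "\<dots> = real (mi_mix n) powr (real l - real m) * real (mi_mix n) ^ m"
    using mi_mix_pos[of n] by (simp flip: powr_realpow powr_add)
  also have "\<dots> \<le> real N powr (real l - real m) * real (mi_mix n) ^ m"
    using assms by (intro mult_right_mono powr_mono2') auto
  finally show ?thesis .
qed

section \<open>The optimized hyperbolic cross\<close>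

definition opt_index :: "real \<Rightarrow> nat \<Rightarrow> (nat^'d) set" where
  "opt_index \<gamma> N = {n. n = 0 \<or> real (mi_mix n) * real (mi_max n) powr (- \<gamma>) \<le> real N powr (1 - \<gamma>)}"

lemma mi_max_pos: "n \<noteq> 0 \<Longrightarrow> 0 < mi_max n"
  using mi_max_le_iff[of n 0] by (auto simp: vec_eq_iff)

text \<open>Since mix(n) >= max(n), membership of a nonzero n bounds max(n)^(1 - gamma) by N^(1 -
  gamma).\<close>

lemma finite_opt_index:
  assumes "\<gamma> < 1" shows "finite (opt_index \<gamma> N :: (nat^'d) set)"
proof (rule finite_subset[OF _ finite_mi_max[of N]], rule subsetI)
  fix n :: "nat^'d" assume n: "n \<in> opt_index \<gamma> N"
  show "n \<in> {n. mi_max n \<le> N}"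
  proof (cases "n = 0")
    case False
    note pos = mi_max_pos[OF False]
    have "real (mi_max n) powr (1 - \<gamma>) = real (mi_max n) * real (mi_max n) powr (- \<gamma>)"
      using pos by (simp add: powr_diff powr_minus divide_inverse)
    also have "\<dots> \<le> real (mi_mix n) * real (mi_max n) powr (- \<gamma>)"
      using mi_max_le_mi_mix[of n] by (intro mult_right_mono) auto
    also have "\<dots> \<le> real N powr (1 - \<gamma>)" using n False by (simp add: opt_index_def)
    finally have "mi_max n \<le> N" using assms pos
      by (metis powr_less_mono2 diff_gt_0_iff_gt not_le of_nat_0_le_iff of_nat_less_iff)
    then show ?thesis by simp
  qed (simp add: mi_max_le_iff)
qed

lemma not_opt_index:
  assumes "n \<notin> opt_index \<gamma> N"
  shows "0 < mi_max n" "real N powr (1 - \<gamma>) * real (mi_max n) powr \<gamma> \<le> real (mi_mix n)"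
proof -
  show pos: "0 < mi_max n" using assms by (intro mi_max_pos) (auto simp: opt_index_def)
  have "real N powr (1 - \<gamma>) < real (mi_mix n) / real (mi_max n) powr \<gamma>"
    using assms by (simp add: opt_index_def powr_minus divide_inverse)
  then show "real N powr (1 - \<gamma>) * real (mi_max n) powr \<gamma> \<le> real (mi_mix n)"
    using pos by (simp add: field_simps)
qed

text \<open>With M = max(n), the left side is at most M^l. If M >= N, split off M^(l - m) <= N^(l -
  m) and use mix(n) >= M. If M < N, write M^l = M^(l - gamma m) M^(gamma m) and enlarge the first
  factor to N^(l - gamma m), where gamma m <= l is needed. The result is N^(l - m) times the m-th
  power of N^(1 - gamma) M^gamma, which mix(n) dominates outside the cross.\<close>

lemma optimized_index_bound:
  fixes k n :: "nat^'d"
  assumes "mi_sum k \<le> l" "l < m" "0 < N" "\<gamma> * real m \<le> real l" "0 < \<gamma>" "n \<notin> opt_index \<gamma> N"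
  shows "(\<Prod>j\<in>UNIV. real (max 1 (n $ j)) ^ (k $ j)) \<le> real N powr (real l - real m) * real (mi_mix n) ^ m"
proof -
  define M where "M = mi_max n"
  have M: "1 \<le> M" and mix: "real N powr (1 - \<gamma>) * real M powr \<gamma> \<le> real (mi_mix n)"
    using not_opt_index[OF assms(6)] by (simp_all add: M_def)
  have "(\<Prod>j\<in>UNIV. real (max 1 (n $ j)) ^ (k $ j)) \<le> (\<Prod>j\<in>UNIV. real M ^ (k $ j))"
    using M le_mi_max[of n] by (intro prod_mono conjI power_mono) (auto simp: M_def)
  also have "\<dots> = real M ^ mi_sum k" by (simp add: mi_sum_def power_sum)
  also have "\<dots> \<le> real M ^ l" using assms(1) M by (intro power_increasing) auto
  also have "\<dots> = real M powr real l" using M by (simp add: powr_realpow)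
  also have "\<dots> \<le> real N powr (real l - real m) * real (mi_mix n) powr real m"
  proof (cases "N \<le> M")
    case True
    have "real M powr real l = real M powr (real l - real m) * real M powr real m"
      by (simp flip: powr_add)
    also have "\<dots> \<le> real N powr (real l - real m) * real (mi_mix n) powr real m"
      using True assms mi_max_le_mi_mix[of n] by (intro mult_mono powr_mono2' powr_mono2) (auto simp: M_def)
    finally show ?thesis .
  next
    case False
    have "real M powr real l = real M powr (real l - \<gamma> * real m) * real M powr (\<gamma> * real m)"
      by (simp flip: powr_add)
    also have "\<dots> \<le> real N powr (real l - \<gamma> * real m) * real M powr (\<gamma> * real m)"
      using False assms by (intro mult_right_mono powr_mono2) auto
    also have "\<dots> = real N powr (real l - real m) * (real N powr (1 - \<gamma>) * real M powr \<gamma>) powr real m"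
      by (simp add: powr_mult powr_powr algebra_simps flip: powr_add)
    also have "\<dots> \<le> real N powr (real l - real m) * real (mi_mix n) powr real m"
      using mix by (intro mult_left_mono powr_mono2) auto
    finally show ?thesis .
  qed
  also have "real (mi_mix n) powr real m = real (mi_mix n) ^ m"
    using mi_mix_pos[of n] by (simp add: powr_realpow)
  finally show ?thesis .
qed

theorem theorem1p1:
  fixes l m :: nat
  assumes "l < m"
  shows
    "(\<exists>N0::nat. \<forall>\<alpha>::real^'d. (\<forall>j. 0 < \<alpha> $ j) \<longrightarrow>
       (\<exists>C::real. \<forall>\<beta>::real^'d. \<forall>N\<ge>N0. \<forall>u\<in>K_space \<alpha> \<beta> m.
          (INF U\<in>X_reg \<alpha> \<beta> N. K_norm \<alpha> \<beta> l (\<lambda>x. u x - U x))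
            \<le> C * real N powr ((real l - real m) / 2) * K_seminorm \<alpha> \<beta> m u))
     \<and>
     (\<forall>\<gamma>::real. 0 < \<gamma> \<and> \<gamma> \<le> real l / real m \<longrightarrow>
       (\<exists>N0::nat. \<forall>\<alpha>::real^'d. (\<forall>j. 0 < \<alpha> $ j) \<longrightarrow>
         (\<exists>C::real. \<forall>\<beta>::real^'d. \<forall>N\<ge>N0. \<forall>u\<in>K_space \<alpha> \<beta> m.
            (INF U\<in>X_opt \<alpha> \<beta> N \<gamma>. W_norm \<alpha> \<beta> l (\<lambda>x. u x - U x))
              \<le> C * real N powr ((real l - real m) / 2) * K_seminorm \<alpha> \<beta> m u)))"
proof (intro conjI allI impI)
  have m: "1 \<le> m" using assms by simp
  show "\<exists>N0::nat. \<forall>\<alpha>::real^'d. (\<forall>j. 0 < \<alpha> $ j) \<longrightarrow>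
       (\<exists>C::real. \<forall>\<beta>::real^'d. \<forall>N\<ge>N0. \<forall>u\<in>K_space \<alpha> \<beta> m.
          (INF U\<in>X_reg \<alpha> \<beta> N. K_norm \<alpha> \<beta> l (\<lambda>x. u x - U x))
            \<le> C * real N powr ((real l - real m) / 2) * K_seminorm \<alpha> \<beta> m u)"
  \<comment> \<open>Outside the cross mix(n) > N >= m^d, which forces an entry >= m. The constant is
    left open here, before beta, N and u are fixed, so it cannot depend on them.\<close>
  proof (rule exI[of _ "m ^ CARD('d)"], intro allI impI, rule exI, intro allI impI ballI)
    fix \<alpha> \<beta> :: "real^'d" and N :: nat and u
    assume pos: "\<forall>j. 0 < \<alpha> $ j" and N: "m ^ CARD('d) \<le> N" and u: "u \<in> K_space \<alpha> \<beta> m"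
    interpret hermite_vec \<alpha> \<beta> using pos by unfold_locales auto
    let ?I = "{n::nat^'d. mi_mix n \<le> N}" and ?K = "{k::nat^'d. mi_max k \<le> l}"
    let ?T = "truncation \<alpha> \<beta> ?I u"
    have N0: "0 < N" using N m by (metis One_nat_def Suc_le_lessD le_trans one_le_power)
    have I: "finite ?I"
      by (rule finite_subset[OF _ finite_mi_max[of N]]) (auto intro: order_trans[OF mi_max_le_mi_mix])
    have "(INF U\<in>X_reg \<alpha> \<beta> N. K_norm \<alpha> \<beta> l (\<lambda>x. u x - U x)) \<le> K_norm \<alpha> \<beta> l (\<lambda>x. u x - ?T x)"
      unfolding X_reg_def
      by (rule cINF_lower[OF bdd_belowI[of _ 0] truncation_in_hermite_span[OF I]]) (auto simp: K_norm_nonneg)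
    also have "\<dots> \<le> sqrt (real (card ?K) * (upper_const m \<alpha> / lower_const m \<alpha>)) * real N powr ((real l - real m) / 2) * K_seminorm \<alpha> \<beta> m u"
      unfolding K_norm_def
    proof (rule sqrt_sum_le[OF N0 _ K_seminorm_nonneg])
      show "(L2_norm (weak_D \<alpha> \<beta> k (\<lambda>x. u x - ?T x)))\<^sup>2
          \<le> upper_const m \<alpha> / lower_const m \<alpha> * real N powr (real l - real m) * (K_seminorm \<alpha> \<beta> m u)\<^sup>2" if "k \<in> ?K" for k
      proof (rule weak_D_truncation_error[OF m u _ I])
        show "mi_max k \<le> m" using that assms by simp
        show "\<exists>j. m \<le> n $ j" if "n \<notin> ?I" for n
          using that N by (intro exists_large_component[OF m]) auto
        show "(\<Prod>j\<in>UNIV. real (max 1 (n $ j)) ^ (k $ j)) \<le> real N powr (real l - real m) * real (mi_mix n) ^ m" if "n \<notin> ?I" for n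
          using that \<open>k \<in> ?K\<close> N0 assms by (intro regular_index_bound) auto
      qed simp
    qed (use upper_const_nonneg[of m \<alpha>] lower_const_pos[OF m] in simp)
    finally show "(INF U\<in>X_reg \<alpha> \<beta> N. K_norm \<alpha> \<beta> l (\<lambda>x. u x - U x))
       \<le> sqrt (real (card ?K) * (upper_const m \<alpha> / lower_const m \<alpha>)) * real N powr ((real l - real m) / 2) * K_seminorm \<alpha> \<beta> m u" .
  qed
next
  fix \<gamma> :: real assume \<gamma>: "0 < \<gamma> \<and> \<gamma> \<le> real l / real m"
  have m: "1 \<le> m" using assms by simp
  have \<gamma>m: "\<gamma> * real m \<le> real l" using \<gamma> m by (simp add: field_simps)
  have \<gamma>1: "\<gamma> < 1"
  proof -
    have "real l / real m < 1" using assms by simp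
    then show ?thesis using \<gamma> by linarith
  qed
  \<comment> \<open>Chosen so that N^(1 - gamma) >= m^d + 1. Outside the cross mix(n) is at least
    N^(1 - gamma), as max(n) >= 1, and so exceeds m^d.\<close>
  define N0 where "N0 = nat \<lceil>(real (m ^ CARD('d)) + 1) powr (1 / (1 - \<gamma>))\<rceil>"
  show "\<exists>N0::nat. \<forall>\<alpha>::real^'d. (\<forall>j. 0 < \<alpha> $ j) \<longrightarrow>
         (\<exists>C::real. \<forall>\<beta>::real^'d. \<forall>N\<ge>N0. \<forall>u\<in>K_space \<alpha> \<beta> m.
            (INF U\<in>X_opt \<alpha> \<beta> N \<gamma>. W_norm \<alpha> \<beta> l (\<lambda>x. u x - U x))
              \<le> C * real N powr ((real l - real m) / 2) * K_seminorm \<alpha> \<beta> m u)"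
  proof (rule exI[of _ N0], intro allI impI, rule exI, intro allI impI ballI)
    fix \<alpha> \<beta> :: "real^'d" and N :: nat and u
    assume pos: "\<forall>j. 0 < \<alpha> $ j" and N: "N0 \<le> N" and u: "u \<in> K_space \<alpha> \<beta> m"
    interpret hermite_vec \<alpha> \<beta> using pos by unfold_locales auto
    let ?I = "opt_index \<gamma> N :: (nat^'d) set" and ?K = "{k::nat^'d. mi_sum k \<le> l}"
    let ?T = "truncation \<alpha> \<beta> ?I u"
    have Nge: "(real (m ^ CARD('d)) + 1) powr (1 / (1 - \<gamma>)) \<le> real N"
      using N unfolding N0_def by linarith
    have pos1: "0 < real (m ^ CARD('d)) + 1" by (intro add_nonneg_pos) auto
    have "0 < (real (m ^ CARD('d)) + 1) powr (1 / (1 - \<gamma>))"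
      using pos1 powr_gt_zero less_imp_neq by metis
    then have Npos: "0 < N" using Nge by (metis less_le_trans of_nat_0_less_iff)
    have Npow: "real (m ^ CARD('d)) + 1 \<le> real N powr (1 - \<gamma>)"
      using powr_mono2[OF _ _ Nge, of "1 - \<gamma>"] \<gamma>1 by (simp add: powr_powr add_nonneg_pos)
    have I: "finite ?I" by (rule finite_opt_index[OF \<gamma>1])
    have "(INF U\<in>X_opt \<alpha> \<beta> N \<gamma>. W_norm \<alpha> \<beta> l (\<lambda>x. u x - U x)) \<le> W_norm \<alpha> \<beta> l (\<lambda>x. u x - ?T x)"
      unfolding X_opt_def opt_index_def[symmetric]
      by (rule cINF_lower[OF bdd_belowI[of _ 0] truncation_in_hermite_span[OF I]]) (auto simp: W_norm_nonneg)
    also have "\<dots> \<le> sqrt (real (card ?K) * (upper_const m \<alpha> / lower_const m \<alpha>)) * real N powr ((real l - real m) / 2) * K_seminorm \<alpha> \<beta> m u"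
      unfolding W_norm_def
    proof (rule sqrt_sum_le[OF Npos _ K_seminorm_nonneg])
      show "(L2_norm (weak_D \<alpha> \<beta> k (\<lambda>x. u x - ?T x)))\<^sup>2
          \<le> upper_const m \<alpha> / lower_const m \<alpha> * real N powr (real l - real m) * (K_seminorm \<alpha> \<beta> m u)\<^sup>2" if "k \<in> ?K" for k
      proof (rule weak_D_truncation_error[OF m u _ I])
        show "mi_max k \<le> m" using that assms mi_max_le_mi_sum[of k] by simp
        show "\<exists>j. m \<le> n $ j" if n: "n \<notin> ?I" for n
        proof (rule exists_large_component[OF m])
          have "1 \<le> real (mi_max n) powr \<gamma>"
            using not_opt_index(1)[OF n] \<gamma> by (intro ge_one_powr_ge_zero) auto
          then have "real N powr (1 - \<gamma>) * 1 \<le> real N powr (1 - \<gamma>) * real (mi_max n) powr \<gamma>"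
            by (intro mult_left_mono) auto
          then have "real (m ^ CARD('d)) + 1 \<le> real (mi_mix n)"
            using Npow not_opt_index(2)[OF n] by linarith
          then show "m ^ CARD('d) < mi_mix n" by linarith
        qed
        show "(\<Prod>j\<in>UNIV. real (max 1 (n $ j)) ^ (k $ j)) \<le> real N powr (real l - real m) * real (mi_mix n) ^ m" if "n \<notin> ?I" for n
          using that \<open>k \<in> ?K\<close> Npos assms \<gamma> \<gamma>m by (intro optimized_index_bound) auto
      qed simp
    qed (use upper_const_nonneg[of m \<alpha>] lower_const_pos[OF m] in simp)
    finally show "(INF U\<in>X_opt \<alpha> \<beta> N \<gamma>. W_norm \<alpha> \<beta> l (\<lambda>x. u x - U x))
       \<le> sqrt (real (card ?K) * (upper_const m \<alpha> / lower_const m \<alpha>)) * real N powr ((real l - real m) / 2) * K_seminorm \<alpha> \<beta> m u" .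
  qed
qed

end
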